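(* Let $\lambda,\mu,\nu \vdash n$ be partitions and let $k\ge 1$ be a fixed integer. Define, for integers $t\ge 0$, $$G_k(t) \,:=\, g\bigl(\lambda + (t^k),\ \mu + (t^k),\ \nu + (tk)\bigr).$$ Then the function $G_k(t)$ is bounded and monotone increasing (weakly) as $t$ grows.
   Context: For partitions $\alpha,\beta,\gamma\vdash N$, the Kronecker coefficient $g(\alpha,\beta,\gamma)$ is defined by $\chi^\alpha\otimes\chi^\beta=\sum_{\gamma\vdash N} g(\alpha,\beta,\gamma)\chi^\gamma$, where $\chi^\alpha$ is the character of the irreducible representation of the symmetric group $S_N$ indexed by $\alpha$. Partitions are added as vectors: $\alpha+\beta=(\alpha_1+\beta_1,\alpha_2+\beta_2,\ldots)$ (padding with zeros). $(t^k)$ denotes the partition $(t,t,\ldots,t)$ with $k$ parts equal to $t$, and $(tk)$ denotes the one-part partition with the single part $tk$. Thus $\lambda+(t^k)$, $\mu+(t^k)$, $\nu+(tk)$ are partitions of $n+tk$. *)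

theory Defs
  imports Complex_Main "HOL-Combinatorics.Permutations" "HOL-Library.Function_Algebras"
begin

text \<open>
  A partition is the weakly decreasing, finitely supported sequence of its parts, indexed from 0.
  Padding with zeros is thus built in, and addition of partitions is the pointwise addition of
  functions.
\<close>

definition partition_of :: "nat \<Rightarrow> (nat \<Rightarrow> nat) \<Rightarrow> bool" where
  "partition_of N \<alpha> \<longleftrightarrow> antimono \<alpha> \<and> finite {i. \<alpha> i \<noteq> 0} \<and> (\<Sum>i | \<alpha> i \<noteq> 0. \<alpha> i) = N"

definition rect_partition :: "nat \<Rightarrow> nat \<Rightarrow> nat \<Rightarrow> nat" where
  "rect_partition t k = (\<lambda>i. if i < k then t else 0)"

definition row_partition :: "nat \<Rightarrow> nat \<Rightarrow> nat" where
  "row_partition m = (\<lambda>i. if i = 0 then m else 0)"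

lemma partition_of_add:
  assumes "partition_of M \<alpha>" and "partition_of N \<beta>"
  shows "partition_of (M + N) (\<alpha> + \<beta>)"
proof -
  let ?S = "{i. \<alpha> i \<noteq> 0} \<union> {i. \<beta> i \<noteq> 0}"
  have fin: "finite ?S" using assms by (simp add: partition_of_def)
  have eq: "{i. (\<alpha> + \<beta>) i \<noteq> 0} = ?S" by auto
  have "(\<Sum>i\<in>?S. \<alpha> i) = (\<Sum>i | \<alpha> i \<noteq> 0. \<alpha> i)"
    by (rule sum.mono_neutral_right) (use fin in auto)
  moreover have "(\<Sum>i\<in>?S. \<beta> i) = (\<Sum>i | \<beta> i \<noteq> 0. \<beta> i)"
    by (rule sum.mono_neutral_right) (use fin in auto)
  ultimately have "(\<Sum>i\<in>?S. \<alpha> i) = M" "(\<Sum>i\<in>?S. \<beta> i) = N"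
    using assms by (simp_all add: partition_of_def)
  then have "(\<Sum>i | (\<alpha> + \<beta>) i \<noteq> 0. (\<alpha> + \<beta>) i) = M + N"
    unfolding eq by (simp add: sum.distrib)
  moreover have "antimono (\<alpha> + \<beta>)"
    using assms by (auto simp: partition_of_def monotone_def intro: add_mono)
  ultimately show ?thesis unfolding partition_of_def using fin eq by simp
qed

lemma partition_of_rect: "partition_of (t * k) (rect_partition t k)"
proof (cases "t = 0")
  case False
  then have "{i. rect_partition t k i \<noteq> 0} = {..<k}"
    by (auto simp: rect_partition_def)
  then show ?thesis
    by (auto simp: partition_of_def monotone_def rect_partition_def)
qed (simp add: partition_of_def rect_partition_def monotone_def)

lemma partition_of_row: "partition_of m (row_partition m)"
proof (cases "m = 0")
  case False
  then have "{i. row_partition m i \<noteq> 0} = {0}"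
    by (auto simp: row_partition_def)
  then show ?thesis
    by (auto simp: partition_of_def monotone_def row_partition_def)
qed (simp add: partition_of_def row_partition_def monotone_def)

text \<open>
  The symmetric group on \<open>{..<N}\<close>, with product \<open>p \<circ> q\<close>.  Its complex group algebra consists of the
  functions that vanish outside it, the function \<open>x\<close> standing for the sum of all \<open>x p \<cdot> p\<close>.
\<close>

definition sym_group :: "nat \<Rightarrow> (nat \<Rightarrow> nat) set" where
  "sym_group N = {p. p permutes {..<N}}"

definition group_algebra :: "nat \<Rightarrow> ((nat \<Rightarrow> nat) \<Rightarrow> complex) set" where
  "group_algebra N = {x. \<forall>p. p \<notin> sym_group N \<longrightarrow> x p = 0}"

definition convolve ::
    "nat \<Rightarrow> ((nat \<Rightarrow> nat) \<Rightarrow> complex) \<Rightarrow> ((nat \<Rightarrow> nat) \<Rightarrow> complex) \<Rightarrow> (nat \<Rightarrow> nat) \<Rightarrow> complex" where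
  "convolve N x y = (\<lambda>g. \<Sum>h\<in>sym_group N. x h * y (inv h \<circ> g))"

definition left_mult ::
    "(nat \<Rightarrow> nat) \<Rightarrow> ((nat \<Rightarrow> nat) \<Rightarrow> complex) \<Rightarrow> (nat \<Rightarrow> nat) \<Rightarrow> complex" where
  "left_mult \<sigma> x = (\<lambda>g. x (inv \<sigma> \<circ> g))"

text \<open>
  The boxes of the Young diagram of \<open>\<alpha>\<close> are the pairs \<open>(i, j)\<close> with \<open>j < \<alpha> i\<close> (row \<open>i\<close>, column \<open>j\<close>).
  The canonical tableau numbers them \<open>0, 1, 2, \<dots>\<close> row by row.
\<close>

definition tableau :: "(nat \<Rightarrow> nat) \<Rightarrow> nat \<Rightarrow> nat \<Rightarrow> nat" where
  "tableau \<alpha> i j = (\<Sum>r<i. \<alpha> r) + j"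

definition row_group :: "nat \<Rightarrow> (nat \<Rightarrow> nat) \<Rightarrow> (nat \<Rightarrow> nat) set" where
  "row_group N \<alpha> = {p \<in> sym_group N.
     \<forall>i j. j < \<alpha> i \<longrightarrow> (\<exists>j'. j' < \<alpha> i \<and> p (tableau \<alpha> i j) = tableau \<alpha> i j')}"

definition column_group :: "nat \<Rightarrow> (nat \<Rightarrow> nat) \<Rightarrow> (nat \<Rightarrow> nat) set" where
  "column_group N \<alpha> = {q \<in> sym_group N.
     \<forall>i j. j < \<alpha> i \<longrightarrow> (\<exists>i'. j < \<alpha> i' \<and> q (tableau \<alpha> i j) = tableau \<alpha> i' j)}"

text \<open>The sum of \<open>sign q \<cdot> (p \<circ> q)\<close> over \<open>p\<close> in the row group and \<open>q\<close> in the column group.\<close>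

definition young_symmetrizer :: "nat \<Rightarrow> (nat \<Rightarrow> nat) \<Rightarrow> (nat \<Rightarrow> nat) \<Rightarrow> complex" where
  "young_symmetrizer N \<alpha> = (\<lambda>g. \<Sum>p\<in>row_group N \<alpha>. \<Sum>q\<in>column_group N \<alpha>.
     if p \<circ> q = g then of_int (sign q) else 0)"

text \<open>
  The irreducible module indexed by \<open>\<alpha>\<close>: the left ideal generated by the Young symmetrizer, on which
  the symmetric group acts by left multiplication.  In this convention a one-row partition gives
  the trivial representation and a one-column partition the sign representation.
\<close>

definition specht_module :: "nat \<Rightarrow> (nat \<Rightarrow> nat) \<Rightarrow> ((nat \<Rightarrow> nat) \<Rightarrow> complex) set" where
  "specht_module N \<alpha> = (\<lambda>x. convolve N x (young_symmetrizer N \<alpha>)) ` group_algebra N"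

global_interpretation cfun: vector_space "\<lambda>(c::complex) (f::'a \<Rightarrow> complex) x. c * f x"
  by unfold_locales (auto simp: fun_eq_iff algebra_simps)

text \<open>
  The trace of a linear operator that maps the finite-dimensional space \<open>V\<close> to itself: the sum of the
  diagonal entries with respect to a basis, the choice of which is immaterial.
\<close>

definition trace_on :: "('a \<Rightarrow> complex) set \<Rightarrow> (('a \<Rightarrow> complex) \<Rightarrow> 'a \<Rightarrow> complex) \<Rightarrow> complex" where
  "trace_on V f =
     (let B = (SOME B. cfun.independent B \<and> cfun.span B = V)
      in \<Sum>b\<in>B. cfun.representation B (f b) b)"

definition irr_character :: "nat \<Rightarrow> (nat \<Rightarrow> nat) \<Rightarrow> (nat \<Rightarrow> nat) \<Rightarrow> complex" where
  "irr_character N \<alpha> \<sigma> = trace_on (specht_module N \<alpha>) (left_mult \<sigma>)"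

text \<open>
  For partitions \<open>\<alpha>\<close>, \<open>\<beta>\<close> of \<open>N\<close>, the coefficients in the decomposition of the product character.
  They are set to 0 off the partitions of \<open>N\<close>, so that the function to be described is unique.
\<close>

definition kronecker :: "nat \<Rightarrow> (nat \<Rightarrow> nat) \<Rightarrow> (nat \<Rightarrow> nat) \<Rightarrow> (nat \<Rightarrow> nat) \<Rightarrow> nat" where
  "kronecker N \<alpha> \<beta> = (THE g.
     (\<forall>\<gamma>. \<not> partition_of N \<gamma> \<longrightarrow> g \<gamma> = 0) \<and>
     (\<forall>\<sigma>\<in>sym_group N. irr_character N \<alpha> \<sigma> * irr_character N \<beta> \<sigma> =
        (\<Sum>\<gamma> | partition_of N \<gamma>. of_nat (g \<gamma>) * irr_character N \<gamma> \<sigma>)))"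

end

theory Submission
  imports Defs "HOL-Computational_Algebra.Polynomial"
begin

text \<open>
  The Kronecker coefficient \<open>g(\<alpha>, \<beta>, \<gamma>)\<close> is the multiplicity of the trivial representation in
  \<open>S\<^sup>\<alpha> \<otimes> S\<^sup>\<beta> \<otimes> S\<^sup>\<gamma>\<close>, hence the rank of an idempotent acting on functions on \<open>S\<^sub>N\<^sup>3\<close>, and this rank is the
  dimension of a space of polynomials in the coordinates \<open>x(i, j, l)\<close>: the highest weight vectors of weight
  \<open>(\<alpha>, \<beta>, \<gamma>)\<close>, spanned by products of column determinants. The determinant of \<open>(x(i, j, 0))\<close>
  with \<open>i, j < k\<close> is such a polynomial of weight \<open>(1\<^sup>k, 1\<^sup>k, (k))\<close>. Multiplication by it is injective and maps
  the space for parameter \<open>t\<close> to the one for \<open>t + 1\<close>, which gives monotonicity.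

  The polynomials are invariant under adding multiples of a row or column of the tensor \<open>x\<close> to a later one.
  Gaussian elimination on the slice \<open>(x(i, j, 0))\<close> therefore shows that they are determined by their restriction
  to the points where this slice is diagonal. There the exponents of the diagonal coordinates are determined by
  the others, whose total degree is \<open>n - \<nu>\<^sub>1\<close> for all \<open>t\<close>, so the number of monomials is bounded.
\<close>

section \<open>Traces of operators on function spaces\<close>

text \<open>\<open>kronecker\<close> is a \<open>THE\<close> over expansions with natural
  coefficients, so it says nothing before existence and uniqueness are settled. Uniqueness is
  orthogonality of the characters. For existence, orthogonality together with the bound of the
  number of conjugacy classes by the number of partitions gives complex coefficients; that they are
  natural numbers comes from recognising them as ranks. The traces in \<open>irr_character\<close>
  refer to an arbitrarily chosen basis; writing the Specht module as the image of an idempotent of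
  the group algebra turns them into explicit sums over the group, so every statement about
  representations becomes one about convolutions. Polynomials are kept as functions on points:
  independence of monomials follows from their multiplicativity in the point, cancellation of the
  determinant from restriction to lines. The spaces belonging to different t are compared through
  generators, which are monomials antisymmetrised along the columns of three fillings; no basis of
  highest weight vectors is ever written down.\<close>

abbreviation clinear :: "(('a \<Rightarrow> complex) \<Rightarrow> 'b \<Rightarrow> complex) \<Rightarrow> bool" where
  "clinear \<equiv> Vector_Spaces.linear (\<lambda>c f x. c * f x) (\<lambda>c f x. c * f x)"

definition supported_on :: "'a set \<Rightarrow> ('a \<Rightarrow> complex) set" where
  "supported_on X = {u. \<forall>p. p \<notin> X \<longrightarrow> u p = 0}"

definition delta :: "'a \<Rightarrow> 'a \<Rightarrow> complex" where
  "delta x = (\<lambda>y. if y = x then 1 else 0)"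

lemma clinearI:
  assumes "\<And>u v x. f (\<lambda>z. u z + v z) x = f u x + f v x"
    and "\<And>c u x. f (\<lambda>z. c * u z) x = c * f u x"
  shows "clinear f"
proof -
  have "f (u + v) = f u + f v" for u v
    using assms(1)[of u v] by (auto simp: fun_eq_iff plus_fun_def)
  moreover have "f (\<lambda>z. c * u z) = (\<lambda>z. c * f u z)" for c u
    using assms(2)[of c u] by auto
  ultimately show ?thesis
    unfolding Vector_Spaces.linear_iff by (auto simp: cfun.vector_space_axioms)
qed

lemma sum_fun_apply: "(\<Sum>i\<in>I. f i) x = (\<Sum>i\<in>I. f i x)" for f :: "'i \<Rightarrow> 'a \<Rightarrow> 'b::comm_monoid_add"
  by (induction I rule: infinite_finite_induct) auto

lemma clinear_sum:
  assumes "clinear f"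
  shows "f (\<lambda>z. \<Sum>i\<in>I. c i * u i z) x = (\<Sum>i\<in>I. c i * f (u i) x)"
proof -
  interpret f: Vector_Spaces.linear "\<lambda>c f x. c * f x" "\<lambda>c f x. c * f x" f by fact
  have "(\<lambda>z. \<Sum>i\<in>I. c i * u i z) = (\<Sum>i\<in>I. (\<lambda>z. c i * u i z))"
    by (auto simp: fun_eq_iff sum_fun_apply)
  then have "f (\<lambda>z. \<Sum>i\<in>I. c i * u i z) = (\<Sum>i\<in>I. (\<lambda>z. c i * f (u i) z))"
    by (simp add: f.sum f.scale)
  then show ?thesis by (simp add: sum_fun_apply)
qed

lemma clinear_scale:
  assumes "clinear f"
  shows "f (\<lambda>z. c * u z) = (\<lambda>z. c * f u z)"
proof -
  interpret f: Vector_Spaces.linear "\<lambda>c f x. c * f x" "\<lambda>c f x. c * f x" f by fact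
  show ?thesis by (simp add: f.scale)
qed

lemma subspace_supported_on: "cfun.subspace (supported_on X)"
  by (rule cfun.subspaceI) (auto simp: supported_on_def)

lemma delta_expansion:
  assumes "finite X" and "u \<in> supported_on X"
  shows "(\<lambda>z. \<Sum>x\<in>X. u x * delta x z) = u"
proof
  fix z
  have "(\<Sum>x\<in>X. u x * delta x z) = (\<Sum>x\<in>X. if x = z then u x else 0)"
    by (intro sum.cong) (auto simp: delta_def)
  also have "\<dots> = u z"
    using assms by (auto simp: supported_on_def)
  finally show "(\<Sum>x\<in>X. u x * delta x z) = u z" .
qed

lemma supported_on_subset_span: "finite X \<Longrightarrow> supported_on X \<subseteq> cfun.span (delta ` X)"
proof
  fix u assume *: "finite X" "u \<in> supported_on X"
  have "u = (\<Sum>x\<in>X. (\<lambda>z. u x * delta x z))"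
    using delta_expansion[OF *] by (auto simp: fun_eq_iff sum_fun_apply)
  also have "\<dots> \<in> cfun.span (delta ` X)"
    by (intro cfun.span_sum cfun.span_scale cfun.span_base) auto
  finally show "u \<in> cfun.span (delta ` X)" .
qed

lemma finite_independent_supported_on:
  assumes "finite X" "B \<subseteq> supported_on X" "cfun.independent B"
  shows "finite B"
  using cfun.independent_span_bound[of "delta ` X" B] supported_on_subset_span[OF assms(1)] assms
  by auto

lemma clinear_delta_sum:
  assumes "finite X" and "u \<in> supported_on X" and "clinear f"
  shows "f u x = (\<Sum>y\<in>X. u y * f (delta y) x)"
  using clinear_sum[OF assms(3), where I = X and c = u and u = delta and x = x] delta_expansion[OF assms(1,2)] by simp

text \<open>Expanding \<open>f (P (delta x))\<close> in a basis B of V, and each b in B in point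
  masses, turns both sides into the same double sum, because P b = b. The computation works for
  every B, hence for the one picked by \<open>SOME\<close>. The dimension formula is the case of the
  identity operator.\<close>

lemma trace_on_projection:
  assumes X: "finite X" and P: "clinear P" and f: "clinear f"
    and V: "P ` supported_on X = V" "V \<subseteq> supported_on X" and PV: "\<And>v. v \<in> V \<Longrightarrow> P v = v"
    and fV: "\<And>v. v \<in> V \<Longrightarrow> f v \<in> V"
  shows "trace_on V f = (\<Sum>x\<in>X. f (P (delta x)) x)"
    and "of_nat (cfun.dim V) = (\<Sum>x\<in>X. P (delta x) x)"
proof -
  have sV: "cfun.subspace V"
    unfolding V(1)[symmetric] using P subspace_supported_on
    by (metis Vector_Spaces.linear_iff_module_hom module_hom.subspace_image)
  have main: "(\<Sum>b\<in>B. cfun.representation B (h b) b) = (\<Sum>x\<in>X. h (P (delta x)) x)"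
    if B: "cfun.independent B" "cfun.span B = V" and h: "clinear h" "\<And>v. v \<in> V \<Longrightarrow> h v \<in> V" for B h
  proof -
    have BV: "B \<subseteq> V" using B(2) cfun.span_superset by blast
    have fB: "finite B"
      using finite_independent_supported_on[OF X _ B(1)] BV V(2) by blast
    have hP: "clinear (\<lambda>u. h (P u))"
      using Vector_Spaces.linear_compose[OF P h(1)] by (simp add: o_def)
    have inV: "h (P (delta x)) \<in> cfun.span B" if "x \<in> X" for x
    proof -
      have "delta x \<in> supported_on X" using that by (auto simp: supported_on_def delta_def)
      then show ?thesis using h(2) V(1) B(2) by blast
    qed
    have 1: "h (P (delta x)) x = (\<Sum>b\<in>B. cfun.representation B (h (P (delta x))) b * b x)" if "x \<in> X" for x
      using cfun.sum_representation_eq[OF B(1) inV[OF that] fB subset_refl]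
      by (metis (no_types, lifting) sum.cong sum_fun_apply)
    have 2: "(\<Sum>x\<in>X. b x * cfun.representation B (h (P (delta x))) b) = cfun.representation B (h b) b"
      if b: "b \<in> B" for b
    proof -
      have "h (P b) = (\<Sum>x\<in>X. (\<lambda>z. b x * h (P (delta x)) z))"
      proof
        fix z show "h (P b) z = (\<Sum>x\<in>X. (\<lambda>z. b x * h (P (delta x)) z)) z"
          using clinear_delta_sum[OF X _ hP, of b] b BV V(2) by (auto simp: sum_fun_apply)
      qed
      moreover have "cfun.representation B (\<Sum>x\<in>X. (\<lambda>z. b x * h (P (delta x)) z))
          = (\<lambda>b'. \<Sum>x\<in>X. cfun.representation B (\<lambda>z. b x * h (P (delta x)) z) b')"
        by (rule cfun.representation_sum[OF B(1)]) (intro cfun.span_scale inV)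
      ultimately have "cfun.representation B (h (P b)) b
          = (\<Sum>x\<in>X. cfun.representation B (\<lambda>z. b x * h (P (delta x)) z) b)"
        by simp
      then show ?thesis
        using PV b BV by (simp add: cfun.representation_scale[OF B(1) inV] subset_eq)
    qed
    have "(\<Sum>x\<in>X. h (P (delta x)) x) = (\<Sum>b\<in>B. \<Sum>x\<in>X. cfun.representation B (h (P (delta x))) b * b x)"
      by (subst sum.swap) (intro sum.cong refl 1)
    also have "\<dots> = (\<Sum>b\<in>B. cfun.representation B (h b) b)"
      by (intro sum.cong refl) (simp add: 2[symmetric] mult.commute)
    finally show ?thesis by simp
  qed
  have ex: "\<exists>B. cfun.independent B \<and> cfun.span B = V"
    using cfun.basis_exists[of V] cfun.span_subspace[OF _ _ sV] by metis
  define B where "B = (SOME B. cfun.independent B \<and> cfun.span B = V)"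
  have B: "cfun.independent B" "cfun.span B = V"
    using someI_ex[OF ex] unfolding B_def by auto
  show "trace_on V f = (\<Sum>x\<in>X. f (P (delta x)) x)"
    unfolding trace_on_def Let_def B_def[symmetric] by (rule main[OF B f fV])
  have "clinear (\<lambda>u::'a \<Rightarrow> complex. u)" by (rule clinearI) auto
  from main[OF B this] have "(\<Sum>b\<in>B. cfun.representation B b b) = (\<Sum>x\<in>X. P (delta x) x)" by simp
  moreover have "cfun.representation B b b = 1" if "b \<in> B" for b
    using cfun.representation_basis[OF B(1) that] by simp
  moreover have "cfun.dim V = card B"
    using B cfun.dim_span_eq_card_independent by metis
  ultimately show "of_nat (cfun.dim V) = (\<Sum>x\<in>X. P (delta x) x)" by simp
qed

section \<open>The group algebra\<close>

lemma finite_sym_group [simp]: "finite (sym_group N)"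
  by (simp add: sym_group_def finite_permutations)

lemma sym_group_id [simp]: "id \<in> sym_group N"
  by (simp add: sym_group_def)

lemma sym_group_comp [simp]: "p \<in> sym_group N \<Longrightarrow> q \<in> sym_group N \<Longrightarrow> p \<circ> q \<in> sym_group N"
  by (simp add: sym_group_def permutes_compose)

lemma sym_group_inv [simp]: "p \<in> sym_group N \<Longrightarrow> inv p \<in> sym_group N"
  by (simp add: sym_group_def Permutations.permutes_inv)

lemma sym_group_bij: "p \<in> sym_group N \<Longrightarrow> bij p"
  by (simp add: sym_group_def permutes_bij)

lemma sym_group_permutation: "p \<in> sym_group N \<Longrightarrow> permutation p"
  by (auto simp: sym_group_def permutation_permutes)

lemma sym_group_cancel [simp]:
  assumes "p \<in> sym_group N"
  shows "p \<circ> inv p = id" "inv p \<circ> p = id"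
    "p \<circ> (inv p \<circ> q) = q" "inv p \<circ> (p \<circ> q) = q" "inv (inv p) = p"
    "p (inv p x) = x" "inv p (p x) = x"
proof -
  have b: "bij p" by (rule sym_group_bij[OF assms])
  show 1: "p \<circ> inv p = id" "inv p \<circ> p = id"
    using b by (auto simp: bij_def surj_iff inj_iff)
  show "p \<circ> (inv p \<circ> q) = q" "inv p \<circ> (p \<circ> q) = q" "p (inv p x) = x" "inv p (p x) = x"
    using 1 by (auto simp: fun_eq_iff)
  show "inv (inv p) = p" using b by (rule inv_inv_eq)
qed

lemma sym_group_inv_comp [simp]:
  "p \<in> sym_group N \<Longrightarrow> q \<in> sym_group N \<Longrightarrow> inv (p \<circ> q) = inv q \<circ> inv p"
  by (simp add: o_inv_distrib sym_group_bij)

lemma sym_group_inv_comp' [simp]: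
  assumes "p \<in> sym_group N" "q \<in> sym_group N"
  shows "inv (inv p \<circ> q) = inv q \<circ> p" "inv (p \<circ> inv q) = q \<circ> inv p"
  using sym_group_inv_comp[of "inv p" N q] sym_group_inv_comp[of p N "inv q"] assms by simp_all

lemma sym_group_comp_left_iff [simp]:
  assumes "p \<in> sym_group N"
  shows "p \<circ> q \<in> sym_group N \<longleftrightarrow> q \<in> sym_group N"
  using assms sym_group_comp sym_group_inv sym_group_cancel(4) by metis

lemma sym_group_comp_right_iff [simp]:
  assumes "p \<in> sym_group N"
  shows "q \<circ> p \<in> sym_group N \<longleftrightarrow> q \<in> sym_group N"
proof
  assume "q \<circ> p \<in> sym_group N"
  then have "(q \<circ> p) \<circ> inv p \<in> sym_group N" by (rule sym_group_comp) (use assms in simp)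
  moreover have "(q \<circ> p) \<circ> inv p = q" using assms by (simp add: comp_assoc)
  ultimately show "q \<in> sym_group N" by simp
qed (use assms in auto)

lemma sum_sym_group_left:
  "h \<in> sym_group N \<Longrightarrow> (\<Sum>g\<in>sym_group N. f (h \<circ> g)) = sum f (sym_group N)"
  by (rule sum.reindex_bij_witness[of _ "\<lambda>g. inv h \<circ> g" "\<lambda>g. h \<circ> g"]) auto

lemma sum_sym_group_right:
  "h \<in> sym_group N \<Longrightarrow> (\<Sum>g\<in>sym_group N. f (g \<circ> h)) = sum f (sym_group N)"
  by (rule sum.reindex_bij_witness[of _ "\<lambda>g. g \<circ> inv h" "\<lambda>g. g \<circ> h"]) (auto simp: comp_assoc)

lemma sum_sym_group_inv: "(\<Sum>g\<in>sym_group N. f (inv g)) = sum f (sym_group N)"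
  by (rule sum.reindex_bij_witness[of _ "\<lambda>g. inv g" "\<lambda>g. inv g"]) auto

lemma group_algebra_eq: "group_algebra N = supported_on (sym_group N)"
  by (simp add: group_algebra_def supported_on_def)

lemma convolve_assoc:
  "convolve N (convolve N x y) z = convolve N x (convolve N y z)"
proof
  fix g
  have "convolve N (convolve N x y) z g
      = (\<Sum>k\<in>sym_group N. \<Sum>h\<in>sym_group N. x k * y (inv k \<circ> h) * z (inv h \<circ> g))"
    unfolding convolve_def by (simp add: sum_distrib_right, subst sum.swap, simp)
  also have "\<dots> = (\<Sum>k\<in>sym_group N. \<Sum>h\<in>sym_group N. x k * y h * z (inv h \<circ> (inv k \<circ> g)))"
  proof (rule sum.cong[OF refl])
    fix k assume k: "k \<in> sym_group N"
    show "(\<Sum>h\<in>sym_group N. x k * y (inv k \<circ> h) * z (inv h \<circ> g))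
        = (\<Sum>h\<in>sym_group N. x k * y h * z (inv h \<circ> (inv k \<circ> g)))"
      by (subst sum_sym_group_left[OF k, symmetric]) (use k in \<open>simp add: comp_assoc\<close>)
  qed
  also have "\<dots> = convolve N x (convolve N y z) g"
    unfolding convolve_def by (simp add: sum_distrib_left mult.assoc)
  finally show "convolve N (convolve N x y) z g = convolve N x (convolve N y z) g" .
qed

lemma convolve_in_group_algebra:
  assumes "y \<in> group_algebra N"
  shows "convolve N x y \<in> group_algebra N"
  using assms unfolding group_algebra_def convolve_def
  by (auto intro!: sum.neutral)

lemma clinear_convolve_left: "clinear (\<lambda>x. convolve N x y)"
  by (rule clinearI) (simp_all add: convolve_def algebra_simps sum.distrib sum_distrib_left)

lemma clinear_convolve_right: "clinear (convolve N x)"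
  by (rule clinearI) (simp_all add: convolve_def algebra_simps sum.distrib sum_distrib_left)

lemma clinear_left_mult: "clinear (left_mult g)"
  by (rule clinearI) (simp_all add: left_mult_def)

text \<open>The product of y and z is a combination of left translates of z, so claims about triple
  products with an arbitrary middle factor reduce to a single permutation in the middle.\<close>

lemma convolve_left_mult_expansion:
  "convolve N x (convolve N y z) w = (\<Sum>k\<in>sym_group N. y k * convolve N x (left_mult k z) w)"
proof -
  have "convolve N y z = (\<lambda>w. \<Sum>k\<in>sym_group N. y k * left_mult k z w)"
    by (simp add: convolve_def left_mult_def)
  then show ?thesis
    using clinear_sum[where f = "convolve N x", OF clinear_convolve_right,
        where I = "sym_group N" and c = y and u = "\<lambda>k. left_mult k z" and x = w] by simp
qed

section \<open>Tableaux and the dominance argument\<close>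

definition diagram :: "(nat \<Rightarrow> nat) \<Rightarrow> (nat \<times> nat) set" where
  "diagram \<alpha> = {(i, j). j < \<alpha> i}"

text \<open>
  A filling of the diagram of \<open>\<alpha>\<close> by the elements of \<open>S\<close>, given by the row \<open>\<rho> s\<close> and the column \<open>\<kappa> s\<close> of
  each entry \<open>s\<close>.
\<close>
definition labelling :: "'s set \<Rightarrow> (nat \<Rightarrow> nat) \<Rightarrow> ('s \<Rightarrow> nat) \<Rightarrow> ('s \<Rightarrow> nat) \<Rightarrow> bool" where
  "labelling S \<alpha> \<rho> \<kappa> \<longleftrightarrow> bij_betw (\<lambda>s. (\<rho> s, \<kappa> s)) S (diagram \<alpha>)"

text \<open>The inverse of the numbering by \<open>tableau\<close>. For a partition of N its values
  are unspecified at s \<ge> N, hence the restriction to s < N in what follows.\<close>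

definition box :: "(nat \<Rightarrow> nat) \<Rightarrow> nat \<Rightarrow> nat \<times> nat" where
  "box \<alpha> = inv_into (diagram \<alpha>) (\<lambda>(i, j). tableau \<alpha> i j)"

definition trow :: "(nat \<Rightarrow> nat) \<Rightarrow> nat \<Rightarrow> nat" where
  "trow \<alpha> s = fst (box \<alpha> s)"

definition tcol :: "(nat \<Rightarrow> nat) \<Rightarrow> nat \<Rightarrow> nat" where
  "tcol \<alpha> s = snd (box \<alpha> s)"

lemma partition_of_antimono: "partition_of N \<alpha> \<Longrightarrow> i \<le> j \<Longrightarrow> \<alpha> j \<le> \<alpha> i"
  by (auto simp: partition_of_def antimono_def)

lemma partition_of_prefix_sum:
  assumes "partition_of N \<alpha>"
  shows "(\<Sum>r<i. \<alpha> r) \<le> N" and "\<exists>m. \<forall>i\<ge>m. \<alpha> i = 0 \<and> (\<Sum>r<i. \<alpha> r) = N"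
proof -
  have fin: "finite {i. \<alpha> i \<noteq> 0}" and sum: "(\<Sum>i | \<alpha> i \<noteq> 0. \<alpha> i) = N"
    using assms by (auto simp: partition_of_def)
  obtain m where m: "\<And>i. \<alpha> i \<noteq> 0 \<Longrightarrow> i < m"
    using finite_nat_set_iff_bounded[of "{i. \<alpha> i \<noteq> 0}"] fin by auto
  have eq: "(\<Sum>r<i. \<alpha> r) = N" if "i \<ge> m" for i
    unfolding sum[symmetric] by (rule sum.mono_neutral_right) (use m that in \<open>auto intro: less_le_trans\<close>)
  then show "\<exists>m. \<forall>i\<ge>m. \<alpha> i = 0 \<and> (\<Sum>r<i. \<alpha> r) = N"
    using m by (intro exI[of _ m]) (auto simp: not_less[symmetric])
  have "(\<Sum>r<i. \<alpha> r) \<le> (\<Sum>r<max i m. \<alpha> r)"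
    by (rule sum_mono2) auto
  then show "(\<Sum>r<i. \<alpha> r) \<le> N" using eq[of "max i m"] by simp
qed

lemma tableau_less:
  assumes "j < \<alpha> i" "i < i'"
  shows "tableau \<alpha> i j < tableau \<alpha> i' j'"
proof -
  have "tableau \<alpha> i j < (\<Sum>r<Suc i. \<alpha> r)" using assms by (simp add: tableau_def)
  also have "\<dots> \<le> (\<Sum>r<i'. \<alpha> r)" by (rule sum_mono2) (use assms in auto)
  finally show ?thesis by (simp add: tableau_def)
qed

lemma bij_betw_tableau:
  assumes "partition_of N \<alpha>"
  shows "bij_betw (\<lambda>(i, j). tableau \<alpha> i j) (diagram \<alpha>) {..<N}"
  unfolding bij_betw_def
proof
  have "i = i' \<and> j = j'" if "j < \<alpha> i" "j' < \<alpha> i'" "tableau \<alpha> i j = tableau \<alpha> i' j'" for i j i' j'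
    using that tableau_less[of j \<alpha> i i' j'] tableau_less[of j' \<alpha> i' i j]
    by (cases i i' rule: linorder_cases) (auto simp: tableau_def)
  then show "inj_on (\<lambda>(i, j). tableau \<alpha> i j) (diagram \<alpha>)"
    by (fastforce simp: inj_on_def diagram_def)
  have "s \<in> (\<lambda>(i, j). tableau \<alpha> i j) ` diagram \<alpha>" if "s < N" for s
  proof -
    obtain m where m: "(\<Sum>r<m. \<alpha> r) = N" using partition_of_prefix_sum(2)[OF assms] by auto
    define i where "i = (LEAST i. s < (\<Sum>r<Suc i. \<alpha> r))"
    have "s < (\<Sum>r<Suc m. \<alpha> r)" using m that by simp
    then have 1: "s < (\<Sum>r<Suc i. \<alpha> r)" unfolding i_def by (rule LeastI)
    have 2: "(\<Sum>r<i. \<alpha> r) \<le> s"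
    proof (cases i)
      case (Suc i')
      then show ?thesis
        using not_less_Least[of i' "\<lambda>i. s < (\<Sum>r<Suc i. \<alpha> r)"] unfolding i_def[symmetric] by simp
    qed simp
    show ?thesis
      by (rule image_eqI[of _ _ "(i, s - (\<Sum>r<i. \<alpha> r))"]) (use 1 2 in \<open>auto simp: tableau_def diagram_def\<close>)
  qed
  moreover have "tableau \<alpha> i j < N" if "j < \<alpha> i" for i j
    using that partition_of_prefix_sum(1)[OF assms, of "Suc i"] by (simp add: tableau_def)
  ultimately show "(\<lambda>(i, j). tableau \<alpha> i j) ` diagram \<alpha> = {..<N}"
    by (auto simp: diagram_def)
qed

lemma labelling_canonical:
  assumes "partition_of N \<alpha>"
  shows "labelling {..<N} \<alpha> (trow \<alpha>) (tcol \<alpha>)"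
  unfolding labelling_def trow_def tcol_def
  using bij_betw_inv_into[OF bij_betw_tableau[OF assms]] by (simp add: box_def)

lemma box_tableau:
  assumes "partition_of N \<alpha>" "j < \<alpha> i"
  shows "trow \<alpha> (tableau \<alpha> i j) = i" "tcol \<alpha> (tableau \<alpha> i j) = j"
proof -
  have "box \<alpha> (tableau \<alpha> i j) = (i, j)"
    unfolding box_def
    using inv_into_f_f[OF bij_betw_imp_inj_on[OF bij_betw_tableau[OF assms(1)]], of "(i, j)"] assms(2)
    by (simp add: diagram_def)
  then show "trow \<alpha> (tableau \<alpha> i j) = i" "tcol \<alpha> (tableau \<alpha> i j) = j"
    by (simp_all add: trow_def tcol_def)
qed

lemma tableau_box:
  assumes "partition_of N \<alpha>" "s < N"
  shows "tableau \<alpha> (trow \<alpha> s) (tcol \<alpha> s) = s" "tcol \<alpha> s < \<alpha> (trow \<alpha> s)"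
proof -
  have s: "s \<in> (\<lambda>(i, j). tableau \<alpha> i j) ` diagram \<alpha>"
    using bij_betw_imp_surj_on[OF bij_betw_tableau[OF assms(1)]] assms(2) by auto
  show "tableau \<alpha> (trow \<alpha> s) (tcol \<alpha> s) = s"
    using f_inv_into_f[OF s] by (simp add: box_def trow_def tcol_def split: prod.splits)
  show "tcol \<alpha> s < \<alpha> (trow \<alpha> s)"
    using inv_into_into[OF s] by (simp add: box_def trow_def tcol_def diagram_def case_prod_beta)
qed

lemma sym_group_less: "p \<in> sym_group N \<Longrightarrow> p s < N \<longleftrightarrow> s < N"
  using permutes_in_image[of p "{..<N}" s] by (simp add: sym_group_def)

lemma tableau_less_card:
  assumes "partition_of N \<alpha>" "j < \<alpha> i"
  shows "tableau \<alpha> i j < N"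
  using bij_betw_imp_surj_on[OF bij_betw_tableau[OF assms(1)]] assms(2) by (auto simp: diagram_def)

text \<open>Translates the quantification over boxes in \<open>row_group\<close> and
  \<open>column_group\<close> into one over entries, after which both groups are stabilizers of a
  function on \<open>{..<N}\<close>.\<close>

lemma all_boxes_iff:
  assumes "partition_of N \<alpha>"
  shows "(\<forall>i j. j < \<alpha> i \<longrightarrow> Q i j (tableau \<alpha> i j)) \<longleftrightarrow> (\<forall>s<N. Q (trow \<alpha> s) (tcol \<alpha> s) s)"
proof (intro iffI allI impI)
  fix s assume h: "\<forall>i j. j < \<alpha> i \<longrightarrow> Q i j (tableau \<alpha> i j)" "s < N"
  show "Q (trow \<alpha> s) (tcol \<alpha> s) s"
    using h(1)[rule_format, OF tableau_box(2)[OF assms h(2)]] tableau_box(1)[OF assms h(2)] by simp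
next
  fix i j assume h: "\<forall>s<N. Q (trow \<alpha> s) (tcol \<alpha> s) s" "j < \<alpha> i"
  show "Q i j (tableau \<alpha> i j)"
    using h(1)[rule_format, OF tableau_less_card[OF assms h(2)]] box_tableau[OF assms h(2)] by simp
qed

lemma row_group_eq:
  assumes "partition_of N \<alpha>"
  shows "row_group N \<alpha> = {p \<in> sym_group N. \<forall>s<N. trow \<alpha> (p s) = trow \<alpha> s}"
proof -
  have "(\<exists>j'. j' < \<alpha> i \<and> s = tableau \<alpha> i j') \<longleftrightarrow> trow \<alpha> s = i" if "s < N" for s i
    using box_tableau[OF assms] tableau_box[OF assms that] by metis
  then show ?thesis
    unfolding row_group_def all_boxes_iff[OF assms, where Q = "\<lambda>i j s. \<exists>j'. j' < \<alpha> i \<and> _ s = tableau \<alpha> i j'"]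
    by (auto simp: sym_group_less)
qed

lemma column_group_eq:
  assumes "partition_of N \<alpha>"
  shows "column_group N \<alpha> = {p \<in> sym_group N. \<forall>s<N. tcol \<alpha> (p s) = tcol \<alpha> s}"
proof -
  have "(\<exists>i'. j < \<alpha> i' \<and> s = tableau \<alpha> i' j) \<longleftrightarrow> tcol \<alpha> s = j" if "s < N" for s j
    using box_tableau[OF assms] tableau_box[OF assms that] by metis
  then show ?thesis
    unfolding column_group_def all_boxes_iff[OF assms, where Q = "\<lambda>i j s. \<exists>i'. j < \<alpha> i' \<and> _ s = tableau \<alpha> i' j"]
    by (auto simp: sym_group_less)
qed

section \<open>Comparison of two fillings\<close>

lemma labelling_transport:
  assumes "labelling S \<alpha> \<rho> \<kappa>" "labelling S \<alpha> \<rho>' \<kappa>'"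
  obtains p where "p permutes S" "\<And>s. s \<in> S \<Longrightarrow> \<rho>' (p s) = \<rho> s" "\<And>s. s \<in> S \<Longrightarrow> \<kappa>' (p s) = \<kappa> s"
proof -
  let ?f = "\<lambda>s. (\<rho> s, \<kappa> s)" and ?f' = "\<lambda>s. (\<rho>' s, \<kappa>' s)"
  let ?q = "inv_into S ?f' \<circ> ?f"
  define p where "p = (\<lambda>s. if s \<in> S then ?q s else s)"
  have "bij_betw ?q S S"
    using assms unfolding labelling_def by (intro bij_betw_trans[OF _ bij_betw_inv_into])
  then have "bij_betw p S S" by (subst bij_betw_cong[of S p ?q]) (auto simp: p_def)
  then have "p permutes S" by (rule bij_imp_permutes) (auto simp: p_def)
  moreover have "?f' (p s) = ?f s" if "s \<in> S" for s
  proof -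
    have "?f s \<in> ?f' ` S"
      using assms that unfolding labelling_def bij_betw_def by auto
    from f_inv_into_f[OF this] show ?thesis using that by (simp add: p_def)
  qed
  ultimately show ?thesis using that by auto
qed

lemma labelling_card_rows:
  assumes "labelling S \<alpha> \<rho> \<kappa>"
  shows "card {s\<in>S. \<rho> s < i} = (\<Sum>r<i. \<alpha> r)"
proof -
  have inj: "inj_on (\<lambda>s. (\<rho> s, \<kappa> s)) S" and im: "(\<lambda>s. (\<rho> s, \<kappa> s)) ` S = diagram \<alpha>"
    using assms by (auto simp: labelling_def bij_betw_def)
  have "bij_betw (\<lambda>s. (\<rho> s, \<kappa> s)) {s\<in>S. \<rho> s < i} (SIGMA r:{..<i}. {..<\<alpha> r})"
    unfolding bij_betw_def
  proof
    show "inj_on (\<lambda>s. (\<rho> s, \<kappa> s)) {s \<in> S. \<rho> s < i}" using inj by (rule inj_on_subset) auto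
    show "(\<lambda>s. (\<rho> s, \<kappa> s)) ` {s \<in> S. \<rho> s < i} = (SIGMA r:{..<i}. {..<\<alpha> r})"
    proof (rule set_eqI, clarify)
      fix a b
      show "((a, b) \<in> (\<lambda>s. (\<rho> s, \<kappa> s)) ` {s \<in> S. \<rho> s < i}) \<longleftrightarrow> (a, b) \<in> (SIGMA r:{..<i}. {..<\<alpha> r})"
        using im[THEN eqset_imp_iff, of "(a, b)"] by (auto simp: diagram_def)
    qed
  qed
  from bij_betw_same_card[OF this] show ?thesis by simp
qed

lemma labelling_card_column:
  assumes "labelling S \<alpha> \<rho> \<kappa>"
  shows "bij_betw \<rho> {s\<in>S. \<kappa> s = j \<and> Q (\<rho> s)} {i. j < \<alpha> i \<and> Q i}"
proof -
  have inj: "inj_on (\<lambda>s. (\<rho> s, \<kappa> s)) S" and im: "(\<lambda>s. (\<rho> s, \<kappa> s)) ` S = diagram \<alpha>"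
    using assms by (auto simp: labelling_def bij_betw_def)
  have "a \<in> \<rho> ` {s\<in>S. \<kappa> s = j \<and> Q (\<rho> s)} \<longleftrightarrow> a \<in> {i. j < \<alpha> i \<and> Q i}" for a
    using im[THEN eqset_imp_iff, of "(a, j)"] by (auto simp: diagram_def)
  then show ?thesis unfolding bij_betw_def using inj by (auto simp: inj_on_def)
qed

text \<open>
  If no two entries share a row of the first filling and a column of the second, then a column of
  length \<open>h\<close> of the second contains at most \<open>min i h\<close> of the entries in the first \<open>i\<close> rows of the first.
\<close>
lemma column_count_le:
  assumes fin: "finite S" and anti: "antimono \<beta>" and lab: "labelling S \<beta> \<rho>' \<kappa>'"
    and inj: "inj_on (\<lambda>s. (\<rho> s, \<kappa>' s)) S"
  shows "card {s\<in>S. \<kappa>' s = j \<and> \<rho> s < i} \<le> card {s\<in>S. \<kappa>' s = j \<and> \<rho>' s < i}"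
\<comment> \<open>If column j of \<open>\<beta>\<close> has at least i boxes, the right side equals
  i, and the entries on the left lie in distinct rows of index less than i. Otherwise the whole
  column lies in rows of index less than i, so the right side counts all of its entries.\<close>
proof (cases "\<forall>r<i. j < \<beta> r")
  case True
  have "card {s\<in>S. \<kappa>' s = j \<and> \<rho> s < i} \<le> card {..<i}"
    by (rule card_inj_on_le[of \<rho>]) (use inj in \<open>auto simp: inj_on_def\<close>)
  also have "{..<i} = {r. j < \<beta> r \<and> r < i}" using True by auto
  also have "card \<dots> = card {s\<in>S. \<kappa>' s = j \<and> \<rho>' s < i}"
    using bij_betw_same_card[OF labelling_card_column[OF lab, of j "\<lambda>r. r < i"]] by simp
  finally show ?thesis .
next
  case False
  then obtain r0 where r0: "r0 < i" "\<beta> r0 \<le> j" by auto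
  have "\<rho>' s < i" if "s \<in> S" "\<kappa>' s = j" for s
  proof -
    have "(\<rho>' s, j) \<in> diagram \<beta>"
      using that lab by (auto simp: labelling_def bij_betw_def)
    then have "j < \<beta> (\<rho>' s)" by (simp add: diagram_def)
    then have "\<rho>' s < r0" using anti r0(2) by (metis antimono_def leI le_trans not_le)
    then show ?thesis using r0 by simp
  qed
  then show ?thesis using fin by (intro card_mono) auto
qed

lemma card_column_split:
  assumes "finite S"
  shows "card {s\<in>S. Q s} = (\<Sum>j\<in>\<kappa> ` S. card {s\<in>S. \<kappa> s = j \<and> Q s})"
proof -
  have "card {s\<in>S. Q s} = card (\<Union>j\<in>\<kappa> ` S. {s\<in>S. \<kappa> s = j \<and> Q s})"
    by (rule arg_cong[of _ _ card]) auto
  also have "\<dots> = (\<Sum>j\<in>\<kappa> ` S. card {s\<in>S. \<kappa> s = j \<and> Q s})"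
    using assms by (intro card_UN_disjoint) auto
  finally show ?thesis .
qed

text \<open>Each side counts the entries in the first i rows of one filling. Both counts are split
  along the columns of the second filling and compared there by \<open>column_count_le\<close>. This
  is the combinatorial source of all vanishing products of row and column sums.\<close>

lemma dominance:
  assumes "finite S" "antimono \<beta>" "labelling S \<alpha> \<rho> \<kappa>" "labelling S \<beta> \<rho>' \<kappa>'"
    and "inj_on (\<lambda>s. (\<rho> s, \<kappa>' s)) S"
  shows "(\<Sum>r<i. \<alpha> r) \<le> (\<Sum>r<i. \<beta> r)"
proof -
  have "(\<Sum>r<i. \<alpha> r) = (\<Sum>j\<in>\<kappa>' ` S. card {s\<in>S. \<kappa>' s = j \<and> \<rho> s < i})"
    using labelling_card_rows[OF assms(3)] card_column_split[OF assms(1)] by metis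
  also have "\<dots> \<le> (\<Sum>j\<in>\<kappa>' ` S. card {s\<in>S. \<kappa>' s = j \<and> \<rho>' s < i})"
    by (intro sum_mono column_count_le[OF assms(1,2,4,5)])
  also have "\<dots> = (\<Sum>r<i. \<beta> r)"
    using labelling_card_rows[OF assms(4)] card_column_split[OF assms(1)] by metis
  finally show ?thesis .
qed

text \<open>For equal shapes the inequalities of \<open>column_count_le\<close> add up to an
  equality, so each of them is one. The rows of the first filling then meet the columns of the
  second exactly as in the diagram, which lets a permutation without conflicts factor into a row and
  a column permutation.\<close>

lemma labelling_mixed:
  assumes fin: "finite S" and anti: "antimono \<alpha>" and lab: "labelling S \<alpha> \<rho> \<kappa>" "labelling S \<alpha> \<rho>' \<kappa>'"
    and inj: "inj_on (\<lambda>s. (\<rho> s, \<kappa>' s)) S"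
  shows "labelling S \<alpha> \<rho> \<kappa>'"
proof -
  have eq: "card {s\<in>S. \<kappa>' s = j \<and> \<rho> s < i} = card {s\<in>S. \<kappa>' s = j \<and> \<rho>' s < i}" for i j
  proof (cases "j \<in> \<kappa>' ` S")
    case True
    have "(\<Sum>j\<in>\<kappa>' ` S. card {s\<in>S. \<kappa>' s = j \<and> \<rho> s < i}) = (\<Sum>j\<in>\<kappa>' ` S. card {s\<in>S. \<kappa>' s = j \<and> \<rho>' s < i})"
      using labelling_card_rows[OF lab(1)] labelling_card_rows[OF lab(2)] card_column_split[OF fin] by metis
    from sum_mono_inv[OF this column_count_le[OF fin anti lab(2) inj] True] fin
    show ?thesis by simp
  qed (auto intro!: arg_cong[of _ _ card])
  \<comment> \<open>If no entry sat in row a and column b, the counts of column b for a and for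
    \<open>Suc a\<close> would agree, whereas the shape has a box of that column in row a.\<close>
  have "(a, b) \<in> (\<lambda>s. (\<rho> s, \<kappa>' s)) ` S" if "b < \<alpha> a" for a b
  proof (rule ccontr)
    assume "(a, b) \<notin> (\<lambda>s. (\<rho> s, \<kappa>' s)) ` S"
    then have "{s\<in>S. \<kappa>' s = b \<and> \<rho> s < Suc a} = {s\<in>S. \<kappa>' s = b \<and> \<rho> s < a}"
      by (auto simp: less_Suc_eq)
    then have "card {s\<in>S. \<kappa>' s = b \<and> \<rho>' s < Suc a} = card {s\<in>S. \<kappa>' s = b \<and> \<rho>' s < a}"
      using eq by metis
    moreover have "card {s\<in>S. \<kappa>' s = b \<and> \<rho>' s < i} = card {r. b < \<alpha> r \<and> r < i}" for i
      using bij_betw_same_card[OF labelling_card_column[OF lab(2), of b "\<lambda>r. r < i"]] .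
    moreover have "{r. b < \<alpha> r \<and> r < Suc a} = insert a {r. b < \<alpha> r \<and> r < a}"
      using that by auto
    ultimately show False by simp
  qed
  then have sub: "diagram \<alpha> \<subseteq> (\<lambda>s. (\<rho> s, \<kappa>' s)) ` S" by (auto simp: diagram_def)
  have "card (diagram \<alpha>) = card S" using lab(1) bij_betw_same_card unfolding labelling_def by metis
  also have "\<dots> = card ((\<lambda>s. (\<rho> s, \<kappa>' s)) ` S)" using inj by (simp add: card_image)
  finally have "diagram \<alpha> = (\<lambda>s. (\<rho> s, \<kappa>' s)) ` S"
    using sub fin by (intro card_subset_eq) auto
  then show ?thesis using inj by (simp add: labelling_def bij_betw_def)
qed

section \<open>Young symmetrizers\<close>

definition row_sum :: "nat \<Rightarrow> (nat \<Rightarrow> nat) \<Rightarrow> (nat \<Rightarrow> nat) \<Rightarrow> complex" where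
  "row_sum N \<alpha> = (\<lambda>p. if p \<in> row_group N \<alpha> then 1 else 0)"

definition column_sum :: "nat \<Rightarrow> (nat \<Rightarrow> nat) \<Rightarrow> (nat \<Rightarrow> nat) \<Rightarrow> complex" where
  "column_sum N \<alpha> = (\<lambda>q. if q \<in> column_group N \<alpha> then of_int (sign q) else 0)"

lemma row_group_subset: "row_group N \<alpha> \<subseteq> sym_group N"
  and column_group_subset: "column_group N \<alpha> \<subseteq> sym_group N"
  by (auto simp: row_group_def column_group_def)

lemma row_sum_in_group_algebra: "row_sum N \<alpha> \<in> group_algebra N"
  and column_sum_in_group_algebra: "column_sum N \<alpha> \<in> group_algebra N"
  using row_group_subset[of N \<alpha>] column_group_subset[of N \<alpha>]
  by (auto simp: row_sum_def column_sum_def group_algebra_def)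

lemma finite_row_group [simp]: "finite (row_group N \<alpha>)"
  and finite_column_group [simp]: "finite (column_group N \<alpha>)"
  using finite_subset row_group_subset column_group_subset finite_sym_group by metis+

lemma young_symmetrizer_eq: "young_symmetrizer N \<alpha> = convolve N (row_sum N \<alpha>) (column_sum N \<alpha>)"
proof
  fix g
  have "convolve N (row_sum N \<alpha>) (column_sum N \<alpha>) g
      = (\<Sum>p\<in>sym_group N. if p \<in> row_group N \<alpha> then column_sum N \<alpha> (inv p \<circ> g) else 0)"
    unfolding convolve_def by (intro sum.cong) (auto simp: row_sum_def)
  also have "\<dots> = (\<Sum>p\<in>row_group N \<alpha>. column_sum N \<alpha> (inv p \<circ> g))"
    using row_group_subset[of N \<alpha>] by (simp add: sum.If_cases Int_absorb1)
  also have "\<dots> = (\<Sum>p\<in>row_group N \<alpha>. \<Sum>q\<in>column_group N \<alpha>. if p \<circ> q = g then of_int (sign q) else 0)"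
  proof (rule sum.cong[OF refl])
    fix p assume "p \<in> row_group N \<alpha>"
    then have p: "p \<in> sym_group N" using row_group_subset by auto
    have "p \<circ> q = g \<longleftrightarrow> q = inv p \<circ> g" for q
      using p by (auto simp: comp_assoc[symmetric])
    then show "column_sum N \<alpha> (inv p \<circ> g) = (\<Sum>q\<in>column_group N \<alpha>. if p \<circ> q = g then of_int (sign q) else 0)"
      by (simp add: column_sum_def)
  qed
  finally show "young_symmetrizer N \<alpha> g = convolve N (row_sum N \<alpha>) (column_sum N \<alpha>) g"
    by (simp add: young_symmetrizer_def)
qed

lemma stabilizer_closed:
  assumes H: "H = {p \<in> sym_group N. \<forall>s<N. f (p s) = f s}"
  shows "p \<in> H \<Longrightarrow> q \<in> H \<Longrightarrow> p \<circ> q \<in> H" and "p \<in> H \<Longrightarrow> inv p \<in> H" and "id \<in> H"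
proof -
  show "p \<circ> q \<in> H" if "p \<in> H" "q \<in> H" using that by (auto simp: H sym_group_less)
  show "inv p \<in> H" if pH: "p \<in> H"
  proof -
    have p: "p \<in> sym_group N" using pH by (simp add: H)
    have "f (inv p s) = f s" if "s < N" for s
    proof -
      have "inv p s < N" using that p sym_group_less[of "inv p" N s] by simp
      then have "f (p (inv p s)) = f (inv p s)" using pH by (auto simp: H)
      then show ?thesis using p by simp
    qed
    then show ?thesis using p by (simp add: H)
  qed
  show "id \<in> H" by (simp add: H)
qed

lemmas row_group_closed = stabilizer_closed[OF row_group_eq]
  and column_group_closed = stabilizer_closed[OF column_group_eq]

lemma row_sum_mult:
  assumes "partition_of N \<alpha>" "p \<in> row_group N \<alpha>"
  shows "row_sum N \<alpha> (p \<circ> h) = row_sum N \<alpha> h" "row_sum N \<alpha> (h \<circ> p) = row_sum N \<alpha> h"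
proof -
  have p: "p \<in> sym_group N" using assms row_group_subset by auto
  have "p \<circ> h \<in> row_group N \<alpha> \<longleftrightarrow> h \<in> row_group N \<alpha>"
    using row_group_closed(1,2)[OF assms(1)] assms(2) sym_group_cancel(4)[OF p] by metis
  moreover have "h \<circ> p \<in> row_group N \<alpha> \<longleftrightarrow> h \<in> row_group N \<alpha>"
  proof
    assume "h \<circ> p \<in> row_group N \<alpha>"
    then have "(h \<circ> p) \<circ> inv p \<in> row_group N \<alpha>"
      by (rule row_group_closed(1)[OF assms(1)]) (use row_group_closed(2) assms in auto)
    moreover have "(h \<circ> p) \<circ> inv p = h" using p by (simp add: comp_assoc)
    ultimately show "h \<in> row_group N \<alpha>" by simp
  qed (use row_group_closed(1)[OF assms(1)] assms(2) in auto)
  ultimately show "row_sum N \<alpha> (p \<circ> h) = row_sum N \<alpha> h" "row_sum N \<alpha> (h \<circ> p) = row_sum N \<alpha> h"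
    by (auto simp: row_sum_def)
qed

lemma column_sum_mult:
  assumes "partition_of N \<alpha>" "q \<in> column_group N \<alpha>"
  shows "column_sum N \<alpha> (q \<circ> h) = of_int (sign q) * column_sum N \<alpha> h"
proof -
  have q: "q \<in> sym_group N" using assms column_group_subset by auto
  have "q \<circ> h \<in> column_group N \<alpha> \<longleftrightarrow> h \<in> column_group N \<alpha>"
    using column_group_closed(1,2)[OF assms(1)] assms(2) sym_group_cancel(4)[OF q] by metis
  moreover have "sign (q \<circ> h) = sign q * sign h" if "h \<in> column_group N \<alpha>"
    using that q column_group_subset by (intro sign_compose sym_group_permutation) auto
  ultimately show ?thesis by (auto simp: column_sum_def)
qed

lemma row_sum_inv:
  assumes "partition_of N \<alpha>" "p \<in> sym_group N"
  shows "row_sum N \<alpha> (inv p) = row_sum N \<alpha> p"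
  using row_group_closed(2)[OF assms(1)] assms sym_group_cancel(5) unfolding row_sum_def by metis

lemma column_sum_inv:
  assumes "partition_of N \<alpha>" "p \<in> sym_group N"
  shows "column_sum N \<alpha> (inv p) = column_sum N \<alpha> p"
  using column_group_closed(2)[OF assms(1)] assms sym_group_cancel(5) sign_inverse sym_group_permutation
  unfolding column_sum_def by metis

text \<open>Inversion is an anti-automorphism of the group algebra. It exchanges the two orders of
  multiplying a row sum and a column sum, each of which it fixes.\<close>

lemma convolve_inv:
  assumes "g \<in> sym_group N"
  shows "convolve N x y (inv g) = convolve N (\<lambda>w. y (inv w)) (\<lambda>w. x (inv w)) g"
proof -
  have "convolve N x y (inv g) = (\<Sum>h\<in>sym_group N. x (inv g \<circ> h) * y (inv (inv g \<circ> h) \<circ> inv g))"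
    unfolding convolve_def by (rule sum_sym_group_left[symmetric]) (use assms in auto)
  also have "\<dots> = (\<Sum>h\<in>sym_group N. y (inv h) * x (inv (inv h \<circ> g)))"
    by (intro sum.cong) (use assms in \<open>auto simp: comp_assoc\<close>)
  finally show ?thesis by (simp add: convolve_def)
qed

lemma convolve_cong:
  assumes "\<And>h. h \<in> sym_group N \<Longrightarrow> x h = x' h" "\<And>h. h \<in> sym_group N \<Longrightarrow> y h = y' h" "g \<in> sym_group N"
  shows "convolve N x y g = convolve N x' y' g"
  unfolding convolve_def by (intro sum.cong arg_cong2[of _ _ _ _ "(*)"]) (use assms in auto)

text \<open>The transposition t of s and s' lies in the row group of \<alpha>, and its conjugate t'
  with t g = g t' in the column group of \<beta>. With a the row sum and b the column sum, a g b = a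
  t g b = a g t' b = - a g b.\<close>

lemma convolve_row_column_conflict:
  assumes \<alpha>: "partition_of N \<alpha>" and \<beta>: "partition_of N \<beta>" and g: "g \<in> sym_group N"
    and s: "s < N" "s' < N" "s \<noteq> s'" "trow \<alpha> s = trow \<alpha> s'" "tcol \<beta> (inv g s) = tcol \<beta> (inv g s')"
  shows "convolve N (row_sum N \<alpha>) (left_mult g (column_sum N \<beta>)) w = 0"
proof -
  define t where "t = transpose s s'"
  define t' where "t' = transpose (inv g s) (inv g s')"
  have t_perm: "t \<in> sym_group N"
    using s by (simp add: t_def sym_group_def permutes_swap_id)
  have t: "t \<in> row_group N \<alpha>"
    using t_perm s unfolding row_group_eq[OF \<alpha>] by (auto simp: t_def transpose_def)
  have invt: "inv t = t" by (simp add: t_def)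
  have gs: "inv g s < N" "inv g s' < N" "inv g s \<noteq> inv g s'"
  proof -
    show "inv g s < N" "inv g s' < N" using g s sym_group_less[of "inv g" N] by simp_all
    show "inv g s \<noteq> inv g s'" using sym_group_cancel(6)[OF g] s by metis
  qed
  have t': "t' \<in> column_group N \<beta>"
    using gs s permutes_swap_id[of "inv g s" "{..<N}" "inv g s'"] unfolding column_group_eq[OF \<beta>]
    by (auto simp: t'_def sym_group_def) (auto simp: transpose_def)
  have sgn: "sign t' = -1" using gs by (simp add: t'_def sign_swap_id)
  have tt': "inv g \<circ> t = t' \<circ> inv g"
    using sym_group_bij[of "inv g" N] g
    by (auto simp: fun_eq_iff t_def t'_def transpose_def bij_def inj_def)
  let ?f = "\<lambda>h. row_sum N \<alpha> h * column_sum N \<beta> (inv g \<circ> (inv h \<circ> w))"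
  have "sum ?f (sym_group N) = (\<Sum>h\<in>sym_group N. ?f (h \<circ> t))"
    by (rule sum_sym_group_right[symmetric]) (rule t_perm)
  also have "\<dots> = (\<Sum>h\<in>sym_group N. - ?f h)"
  proof (rule sum.cong[OF refl])
    fix h assume h: "h \<in> sym_group N"
    have "inv g \<circ> (inv (h \<circ> t) \<circ> w) = t' \<circ> (inv g \<circ> (inv h \<circ> w))"
    proof -
      have "inv g \<circ> (inv (h \<circ> t) \<circ> w) = (inv g \<circ> t) \<circ> (inv h \<circ> w)"
        using h t_perm invt by (simp add: comp_assoc)
      then show ?thesis by (simp add: tt' comp_assoc)
    qed
    then show "?f (h \<circ> t) = - ?f h"
      using column_sum_mult[OF \<beta> t'] row_sum_mult(2)[OF \<alpha> t] sgn by simp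
  qed
  also have "\<dots> = - sum ?f (sym_group N)" by (simp add: sum_negf)
  finally have "sum ?f (sym_group N) = 0" by simp
  then show ?thesis by (simp add: convolve_def left_mult_def)
qed

lemma labelling_translate:
  assumes "partition_of N \<alpha>" "g \<in> sym_group N"
  shows "labelling {..<N} \<alpha> (\<lambda>s. trow \<alpha> (g s)) (\<lambda>s. tcol \<alpha> (g s))"
proof -
  have "bij_betw g {..<N} {..<N}"
    using assms(2) by (simp add: sym_group_def permutes_imp_bij)
  from bij_betw_trans[OF this] show ?thesis
    using labelling_canonical[OF assms(1)] unfolding labelling_def o_def by blast
qed

text \<open>If some g in the middle gave no conflict, \<open>dominance\<close> for the canonical
  filling of \<alpha> and a translate of that of \<beta> would yield the excluded inequalities. So
  every g contributes 0.\<close>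

lemma convolve_row_column_zero:
  assumes \<alpha>: "partition_of N \<alpha>" and \<beta>: "partition_of N \<beta>"
    and dom: "\<not> (\<forall>i. (\<Sum>r<i. \<alpha> r) \<le> (\<Sum>r<i. \<beta> r))"
  shows "convolve N (row_sum N \<alpha>) (convolve N y (column_sum N \<beta>)) w = 0"
proof -
  have "convolve N (row_sum N \<alpha>) (left_mult g (column_sum N \<beta>)) w = 0" if g: "g \<in> sym_group N" for g
  proof (rule ccontr)
    assume nz: "\<not> ?thesis"
    have "inj_on (\<lambda>s. (trow \<alpha> s, tcol \<beta> (inv g s))) {..<N}"
      using convolve_row_column_conflict[OF \<alpha> \<beta> g, of _ _ w] nz by (auto simp: inj_on_def)
    from dominance[OF _ _ labelling_canonical[OF \<alpha>] labelling_translate[OF \<beta>] this] g \<beta> dom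
    show False by (auto simp: partition_of_def)
  qed
  then show ?thesis by (simp add: convolve_left_mult_expansion)
qed

text \<open>Von Neumann's lemma: between the row sum a and the column sum b of one shape, each g
  either creates a conflict and gives 0, or factors as p q with p in the row group and q in the
  column group and gives sign q times a b.\<close>

lemma convolve_row_column_scalar:
  assumes \<alpha>: "partition_of N \<alpha>"
  obtains c where "convolve N (row_sum N \<alpha>) (convolve N y (column_sum N \<alpha>)) = (\<lambda>w. c * young_symmetrizer N \<alpha> w)"
proof -
  have "\<exists>c. \<forall>w. convolve N (row_sum N \<alpha>) (left_mult g (column_sum N \<alpha>)) w = c * young_symmetrizer N \<alpha> w"
    if g: "g \<in> sym_group N" for g
  proof (cases "inj_on (\<lambda>s. (trow \<alpha> s, tcol \<alpha> (inv g s))) {..<N}")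
    case False
    then have "convolve N (row_sum N \<alpha>) (left_mult g (column_sum N \<alpha>)) w = 0" for w
      using convolve_row_column_conflict[OF \<alpha> \<alpha> g] by (auto simp: inj_on_def)
    then show ?thesis by (intro exI[of _ 0]) auto
  next
    case True
    \<comment> \<open>The rows of the canonical filling and the columns of its translate again form
      a filling of shape \<open>\<alpha>\<close>. The permutation p matching it with the canonical
      one preserves rows, and \<open>inv p \<circ> g\<close> preserves columns.\<close>
    have "labelling {..<N} \<alpha> (trow \<alpha>) (\<lambda>s. tcol \<alpha> (inv g s))"
      by (rule labelling_mixed[OF _ _ labelling_canonical[OF \<alpha>] labelling_translate[OF \<alpha>] True])
        (use \<alpha> g in \<open>auto simp: partition_of_def\<close>)
    from labelling_transport[OF labelling_canonical[OF \<alpha>] this] obtain p where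
      p: "p permutes {..<N}" "\<And>s. s < N \<Longrightarrow> trow \<alpha> (p s) = trow \<alpha> s"
        "\<And>s. s < N \<Longrightarrow> tcol \<alpha> (inv g (p s)) = tcol \<alpha> s" by auto
    have pG: "p \<in> sym_group N" using p by (simp add: sym_group_def)
    have pR: "p \<in> row_group N \<alpha>" using p by (simp add: row_group_eq[OF \<alpha>] sym_group_def)
    have "inv g \<circ> p \<in> column_group N \<alpha>"
      using p pG g by (simp add: column_group_eq[OF \<alpha>])
    then have q: "inv p \<circ> g \<in> column_group N \<alpha>" (is "?q \<in> _")
      using column_group_closed(2)[OF \<alpha>, of "inv g \<circ> p"] pG g by simp
    have "convolve N (row_sum N \<alpha>) (left_mult g (column_sum N \<alpha>)) w = of_int (sign (inv ?q)) * young_symmetrizer N \<alpha> w" for w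
    proof -
      have iq: "inv ?q \<in> column_group N \<alpha>" by (rule column_group_closed(2)[OF \<alpha> q])
      have "convolve N (row_sum N \<alpha>) (left_mult g (column_sum N \<alpha>)) w
          = (\<Sum>h\<in>sym_group N. row_sum N \<alpha> h * column_sum N \<alpha> (inv g \<circ> (inv h \<circ> w)))"
        by (simp add: convolve_def left_mult_def)
      also have "\<dots> = (\<Sum>h\<in>sym_group N. row_sum N \<alpha> (h \<circ> inv p) * column_sum N \<alpha> (inv g \<circ> (inv (h \<circ> inv p) \<circ> w)))"
        by (rule sum_sym_group_right[symmetric]) (use pG in simp)
      also have "\<dots> = (\<Sum>h\<in>sym_group N. of_int (sign (inv ?q)) * (row_sum N \<alpha> h * column_sum N \<alpha> (inv h \<circ> w)))"
      proof (rule sum.cong[OF refl])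
        fix h assume h: "h \<in> sym_group N"
        have "inv g \<circ> (inv (h \<circ> inv p) \<circ> w) = inv ?q \<circ> (inv h \<circ> w)"
          using h g pG by (simp add: comp_assoc)
        then show "row_sum N \<alpha> (h \<circ> inv p) * column_sum N \<alpha> (inv g \<circ> (inv (h \<circ> inv p) \<circ> w))
          = of_int (sign (inv ?q)) * (row_sum N \<alpha> h * column_sum N \<alpha> (inv h \<circ> w))"
          using row_sum_mult(2)[OF \<alpha> row_group_closed(2)[OF \<alpha> pR]] column_sum_mult[OF \<alpha> iq] by simp
      qed
      finally show ?thesis by (simp add: young_symmetrizer_eq convolve_def sum_distrib_left)
    qed
    then show ?thesis by blast
  qed
  then obtain c where c: "\<And>g w. g \<in> sym_group N \<Longrightarrow>
      convolve N (row_sum N \<alpha>) (left_mult g (column_sum N \<alpha>)) w = c g * young_symmetrizer N \<alpha> w"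
    by metis
  have "convolve N (row_sum N \<alpha>) (convolve N y (column_sum N \<alpha>)) w = (\<Sum>g\<in>sym_group N. y g * c g) * young_symmetrizer N \<alpha> w" for w
    by (simp add: convolve_left_mult_expansion c sum_distrib_right mult.assoc)
  then show ?thesis using that by blast
qed

section \<open>Characters\<close>

text \<open>Evaluated at \<open>inv \<sigma>\<close>, this is the trace on the group algebra of
  right multiplication by x followed by left translation by \<sigma>. The sum runs over all g, so
  each conjugate is counted as often as the order of its centralizer.\<close>

definition class_sum :: "nat \<Rightarrow> ((nat \<Rightarrow> nat) \<Rightarrow> complex) \<Rightarrow> (nat \<Rightarrow> nat) \<Rightarrow> complex" where
  "class_sum N x \<sigma> = (\<Sum>g\<in>sym_group N. x (inv g \<circ> (\<sigma> \<circ> g)))"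

text \<open>An element of the row group is absorbed by the row sum on its left. The trailing factor
  z lets the identity rewrite inside products nested to the right.\<close>

lemma convolve_row_row:
  assumes "partition_of N \<alpha>"
  shows "convolve N (row_sum N \<alpha>) (convolve N (row_sum N \<alpha>) z)
    = (\<lambda>w. of_nat (card (row_group N \<alpha>)) * convolve N (row_sum N \<alpha>) z w)"
proof
  fix w
  have "convolve N (row_sum N \<alpha>) (left_mult p z) w = convolve N (row_sum N \<alpha>) z w"
    if p: "p \<in> row_group N \<alpha>" for p
  proof -
    have pG: "p \<in> sym_group N" using p row_group_subset by auto
    have "convolve N (row_sum N \<alpha>) (left_mult p z) w
        = (\<Sum>h\<in>sym_group N. row_sum N \<alpha> (h \<circ> p) * z (inv (h \<circ> p) \<circ> w))"
      unfolding convolve_def left_mult_def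
      by (rule sum.cong[OF refl]) (use pG row_sum_mult(2)[OF assms p] in \<open>simp add: comp_assoc\<close>)
    also have "\<dots> = convolve N (row_sum N \<alpha>) z w"
      unfolding convolve_def using sum_sym_group_right[OF pG] .
    finally show ?thesis .
  qed
  then have "convolve N (row_sum N \<alpha>) (convolve N (row_sum N \<alpha>) z) w
      = (\<Sum>p\<in>sym_group N. if p \<in> row_group N \<alpha> then convolve N (row_sum N \<alpha>) z w else 0)"
    unfolding convolve_left_mult_expansion by (intro sum.cong) (auto simp: row_sum_def)
  then show "convolve N (row_sum N \<alpha>) (convolve N (row_sum N \<alpha>) z) w
      = of_nat (card (row_group N \<alpha>)) * convolve N (row_sum N \<alpha>) z w"
    using row_group_subset[of N \<alpha>] by (simp add: sum.If_cases Int_absorb1)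
qed

lemma convolve_column_column:
  assumes "partition_of N \<alpha>"
  shows "convolve N (column_sum N \<alpha>) (column_sum N \<alpha>)
    = (\<lambda>w. of_nat (card (column_group N \<alpha>)) * column_sum N \<alpha> w)"
proof
  fix w
  have "convolve N (column_sum N \<alpha>) (column_sum N \<alpha>) w
      = (\<Sum>q\<in>sym_group N. if q \<in> column_group N \<alpha> then column_sum N \<alpha> w else 0)"
    unfolding convolve_def
  proof (rule sum.cong[OF refl])
    fix q assume q: "q \<in> sym_group N"
    show "column_sum N \<alpha> q * column_sum N \<alpha> (inv q \<circ> w) = (if q \<in> column_group N \<alpha> then column_sum N \<alpha> w else 0)"
    proof (cases "q \<in> column_group N \<alpha>")
      case True
      have "column_sum N \<alpha> w = of_int (sign q) * column_sum N \<alpha> (inv q \<circ> w)"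
        using column_sum_mult[OF assms True, of "inv q \<circ> w"] q by simp
      then show ?thesis using True by (simp add: column_sum_def[of N \<alpha>])
    qed (simp add: column_sum_def)
  qed
  then show "convolve N (column_sum N \<alpha>) (column_sum N \<alpha>) w = of_nat (card (column_group N \<alpha>)) * column_sum N \<alpha> w"
    using column_group_subset[of N \<alpha>] by (simp add: sum.If_cases Int_absorb1)
qed

lemma row_column_inter:
  assumes "partition_of N \<alpha>" "p \<in> row_group N \<alpha>" "p \<in> column_group N \<alpha>"
  shows "p = id"
proof
  fix s
  have p: "p permutes {..<N}" using assms row_group_subset by (auto simp: sym_group_def)
  show "p s = id s"
  proof (cases "s < N")
    case True
    then have "p s < N" using p permutes_in_image by fastforce
    moreover have "trow \<alpha> (p s) = trow \<alpha> s" "tcol \<alpha> (p s) = tcol \<alpha> s"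
      using True assms by (auto simp: row_group_eq column_group_eq)
    ultimately show ?thesis
      using tableau_box(1)[OF assms(1)] True by (metis id_apply)
  qed (use p in \<open>simp add: permutes_not_in\<close>)
qed

text \<open>The row and column groups meet only in \<open>id\<close>, so a single pair contributes.
  This shows that the symmetrizer is not 0 and later allows coefficients at \<open>id\<close> to be
  compared.\<close>

lemma young_symmetrizer_id:
  assumes "partition_of N \<alpha>"
  shows "young_symmetrizer N \<alpha> id = 1"
proof -
  have "young_symmetrizer N \<alpha> id = (\<Sum>h\<in>sym_group N. if h = id then 1 else 0)"
    unfolding young_symmetrizer_eq convolve_def
  proof (rule sum.cong[OF refl])
    fix h assume h: "h \<in> sym_group N"
    have "row_sum N \<alpha> h * column_sum N \<alpha> h = (if h = id then 1 else 0)"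
      using row_column_inter[OF assms, of h] row_group_closed(3)[OF assms] column_group_closed(3)[OF assms]
      by (auto simp: row_sum_def column_sum_def)
    then show "row_sum N \<alpha> h * column_sum N \<alpha> (inv h \<circ> id) = (if h = id then 1 else 0)"
      using column_sum_inv[OF assms h] by simp
  qed
  then show ?thesis by simp
qed

lemma young_symmetrizer_in_group_algebra: "young_symmetrizer N \<alpha> \<in> group_algebra N"
  by (simp add: young_symmetrizer_eq convolve_in_group_algebra column_sum_in_group_algebra)

lemma row_sum_card_nz: "partition_of N \<alpha> \<Longrightarrow> of_nat (card (row_group N \<alpha>)) \<noteq> (0::complex)"
  using row_group_closed(3)[of N \<alpha>] by (auto simp: card_gt_0_iff)

text \<open>The coefficient at \<open>id\<close> is the sum of the squared absolute values of x:
  positivity of the standard inner product on the group algebra.\<close>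

lemma convolve_star_eq_0:
  assumes "x \<in> group_algebra N" and "convolve N x (\<lambda>g. cnj (x (inv g))) id = 0"
  shows "x = (\<lambda>g. 0)"
proof -
  have "(\<Sum>h\<in>sym_group N. x h * cnj (x h)) = 0"
    using assms(2) by (simp add: convolve_def)
  then have "(\<Sum>h\<in>sym_group N. of_real ((cmod (x h))\<^sup>2)) = (0::complex)"
    by (simp only: complex_norm_square)
  then have "(\<Sum>h\<in>sym_group N. (cmod (x h))\<^sup>2) = 0"
    unfolding of_real_sum[symmetric] of_real_eq_0_iff .
  then have "\<forall>h\<in>sym_group N. (cmod (x h))\<^sup>2 = 0"
    by (subst (asm) sum_nonneg_eq_0_iff) auto
  then show ?thesis using assms(1) by (auto simp: group_algebra_def fun_eq_iff)
qed

lemma convolve_0 [simp]: "convolve N (\<lambda>g. 0) y = (\<lambda>g. 0)" "convolve N x (\<lambda>g. 0) = (\<lambda>g. 0)"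
  by (simp_all add: convolve_def)

lemma convolve_scale:
  "convolve N (\<lambda>g. c * x g) y = (\<lambda>g. c * convolve N x y g)"
  "convolve N x (\<lambda>g. c * y g) = (\<lambda>g. c * convolve N x y g)"
  by (simp_all add: convolve_def sum_distrib_left mult_ac)

lemma cnj_row_sum [simp]: "cnj (row_sum N \<alpha> g) = row_sum N \<alpha> g"
  and cnj_column_sum [simp]: "cnj (column_sum N \<alpha> g) = column_sum N \<alpha> g"
  by (simp_all add: row_sum_def column_sum_def)

lemma young_symmetrizer_inv:
  assumes "partition_of N \<alpha>" "g \<in> sym_group N"
  shows "young_symmetrizer N \<alpha> (inv g) = convolve N (column_sum N \<alpha>) (row_sum N \<alpha>) g"
  unfolding young_symmetrizer_eq convolve_inv[OF assms(2)]
  by (intro convolve_cong) (use assms row_sum_inv column_sum_inv in auto)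

lemma cnj_young_symmetrizer [simp]: "cnj (young_symmetrizer N \<alpha> g) = young_symmetrizer N \<alpha> g"
  by (simp add: young_symmetrizer_eq convolve_def)

text \<open>
  If the square of \<open>c = ab\<close> vanished, then so would the square of the self-adjoint element \<open>aba\<close>,
  hence \<open>aba\<close> itself, hence \<open>c c\<^sup>* = a b b a\<close>, hence \<open>c\<close>.
\<close>
lemma young_symmetrizer_square:
  assumes \<alpha>: "partition_of N \<alpha>"
  obtains c where "c \<noteq> 0"
    "convolve N (young_symmetrizer N \<alpha>) (young_symmetrizer N \<alpha>) = (\<lambda>g. c * young_symmetrizer N \<alpha> g)"
proof -
  let ?a = "row_sum N \<alpha>" and ?b = "column_sum N \<alpha>" and ?y = "young_symmetrizer N \<alpha>"
  obtain c where c: "convolve N ?a (convolve N (convolve N ?b ?a) ?b) = (\<lambda>g. c * ?y g)"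
    using convolve_row_column_scalar[OF \<alpha>] by blast
  then have sq: "convolve N ?y ?y = (\<lambda>g. c * ?y g)"
    by (simp add: young_symmetrizer_eq convolve_assoc)
  have "c \<noteq> 0"
  proof
    assume "c = 0"
    then have yy: "convolve N ?y ?y = (\<lambda>g. 0)" using sq by simp
    define h where "h = convolve N ?y ?a"
    have inv_h: "h (inv g) = h g" if g: "g \<in> sym_group N" for g
    proof -
      have "h (inv g) = convolve N (\<lambda>w. ?a (inv w)) (\<lambda>w. ?y (inv w)) g"
        unfolding h_def by (rule convolve_inv[OF g])
      also have "\<dots> = convolve N ?a (convolve N ?b ?a) g"
        by (rule convolve_cong) (use g row_sum_inv[OF \<alpha>] young_symmetrizer_inv[OF \<alpha>] in auto)
      finally show ?thesis by (simp add: h_def young_symmetrizer_eq convolve_assoc)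
    qed
    have cnj_h: "cnj (h g) = h g" for g by (simp add: h_def convolve_def)
    \<comment> \<open>Here h = aba. Since aa is a multiple of a, hh is that multiple of the square
      of ab times a.\<close>
    have "convolve N h h = convolve N ?a (convolve N ?b (convolve N ?a (convolve N ?a (convolve N ?b ?a))))"
      by (simp add: h_def young_symmetrizer_eq convolve_assoc)
    also have "\<dots> = (\<lambda>g. of_nat (card (row_group N \<alpha>)) * convolve N (convolve N ?y ?y) ?a g)"
      by (simp add: convolve_row_row[OF \<alpha>] convolve_scale young_symmetrizer_eq convolve_assoc)
    finally have hh: "convolve N h h = (\<lambda>g. 0)" by (simp add: yy)
    have hG: "h \<in> group_algebra N" by (simp add: h_def convolve_in_group_algebra row_sum_in_group_algebra)
    have "convolve N h (\<lambda>g. cnj (h (inv g))) id = convolve N h h id"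
      by (rule convolve_cong) (simp_all add: inv_h cnj_h)
    then have h0: "h = (\<lambda>g. 0)" using convolve_star_eq_0[OF hG] hh by simp
    have "convolve N ?y (\<lambda>g. cnj (?y (inv g))) id = convolve N ?y (convolve N ?b ?a) id"
      by (rule convolve_cong) (simp_all add: young_symmetrizer_inv[OF \<alpha>] convolve_def)
    also have "convolve N ?y (convolve N ?b ?a) = convolve N (convolve N ?a (convolve N ?b ?b)) ?a"
      by (simp add: young_symmetrizer_eq convolve_assoc)
    also have "\<dots> = (\<lambda>g. of_nat (card (column_group N \<alpha>)) * h g)"
      by (simp add: convolve_column_column[OF \<alpha>] convolve_scale young_symmetrizer_eq h_def)
    finally have z: "convolve N ?y (\<lambda>g. cnj (?y (inv g))) id = 0"
      by (simp only: h0 mult_zero_right)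
    have "?y = (\<lambda>g. 0)"
      by (rule convolve_star_eq_0[OF young_symmetrizer_in_group_algebra z])
    then show False using young_symmetrizer_id[OF \<alpha>] by simp
  qed
  with sq show ?thesis using that by blast
qed

text \<open>Classically this is the product of the hook lengths, that is N! divided by the dimension
  of the Specht module. It enters only through the two properties named in the choice.\<close>

definition young_scalar :: "nat \<Rightarrow> (nat \<Rightarrow> nat) \<Rightarrow> complex" where
  "young_scalar N \<alpha> = (SOME c. c \<noteq> 0 \<and>
     convolve N (young_symmetrizer N \<alpha>) (young_symmetrizer N \<alpha>) = (\<lambda>g. c * young_symmetrizer N \<alpha> g))"

definition young_idem :: "nat \<Rightarrow> (nat \<Rightarrow> nat) \<Rightarrow> (nat \<Rightarrow> nat) \<Rightarrow> complex" where
  "young_idem N \<alpha> = (\<lambda>g. inverse (young_scalar N \<alpha>) * young_symmetrizer N \<alpha> g)"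

lemma young_scalar:
  assumes "partition_of N \<alpha>"
  shows "young_scalar N \<alpha> \<noteq> 0"
    "convolve N (young_symmetrizer N \<alpha>) (young_symmetrizer N \<alpha>) = (\<lambda>g. young_scalar N \<alpha> * young_symmetrizer N \<alpha> g)"
proof -
  have "\<exists>c. c \<noteq> 0 \<and> convolve N (young_symmetrizer N \<alpha>) (young_symmetrizer N \<alpha>) = (\<lambda>g. c * young_symmetrizer N \<alpha> g)"
    using young_symmetrizer_square[OF assms] by blast
  from someI_ex[OF this] show "young_scalar N \<alpha> \<noteq> 0"
    "convolve N (young_symmetrizer N \<alpha>) (young_symmetrizer N \<alpha>) = (\<lambda>g. young_scalar N \<alpha> * young_symmetrizer N \<alpha> g)"
    unfolding young_scalar_def by auto
qed

lemma young_idem_idempotent: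
  assumes "partition_of N \<alpha>"
  shows "convolve N (young_idem N \<alpha>) (young_idem N \<alpha>) = young_idem N \<alpha>"
    "convolve N (young_symmetrizer N \<alpha>) (young_idem N \<alpha>) = young_symmetrizer N \<alpha>"
  using young_scalar[OF assms] by (simp_all add: young_idem_def convolve_scale)

section \<open>Characters of Specht modules as class sums of idempotents\<close>

lemma left_mult_convolve:
  assumes "\<sigma> \<in> sym_group N"
  shows "left_mult \<sigma> (convolve N x y) = convolve N (left_mult \<sigma> x) y"
proof
  fix g
  have "left_mult \<sigma> (convolve N x y) g = (\<Sum>h\<in>sym_group N. x h * y (inv h \<circ> (inv \<sigma> \<circ> g)))"
    by (simp add: left_mult_def convolve_def)
  also have "\<dots> = (\<Sum>h\<in>sym_group N. x (inv \<sigma> \<circ> h) * y (inv (inv \<sigma> \<circ> h) \<circ> (inv \<sigma> \<circ> g)))"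
    by (rule sum_sym_group_left[symmetric]) (use assms in simp)
  also have "\<dots> = convolve N (left_mult \<sigma> x) y g"
    unfolding convolve_def left_mult_def by (rule sum.cong[OF refl]) (use assms in \<open>simp add: comp_assoc\<close>)
  finally show "left_mult \<sigma> (convolve N x y) g = convolve N (left_mult \<sigma> x) y g" .
qed

lemma left_mult_in_group_algebra:
  "\<sigma> \<in> sym_group N \<Longrightarrow> x \<in> group_algebra N \<Longrightarrow> left_mult \<sigma> x \<in> group_algebra N"
  by (auto simp: left_mult_def group_algebra_def)

lemma convolve_delta_left:
  assumes "h \<in> sym_group N"
  shows "convolve N (delta h) y = left_mult h y"
proof
  fix g
  have "convolve N (delta h) y g = (\<Sum>k\<in>sym_group N. if k = h then y (inv h \<circ> g) else 0)"
    unfolding convolve_def by (intro sum.cong) (auto simp: delta_def)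
  then show "convolve N (delta h) y g = left_mult h y g"
    using assms by (simp add: left_mult_def)
qed

text \<open>Right multiplication by the idempotent projects the group algebra onto the Specht
  module, so \<open>trace_on_projection\<close> makes the trace a sum over the group. The inverse
  arises because \<open>left_mult \<sigma>\<close> evaluates at
  \<open>inv \<sigma> \<circ> g\<close>.\<close>

lemma irr_character_eq_inv:
  assumes \<alpha>: "partition_of N \<alpha>" and \<sigma>: "\<sigma> \<in> sym_group N"
  shows "irr_character N \<alpha> \<sigma> = class_sum N (young_idem N \<alpha>) (inv \<sigma>)"
proof -
  let ?P = "\<lambda>x. convolve N x (young_idem N \<alpha>)" and ?V = "specht_module N \<alpha>"
  have P: "clinear ?P" by (rule clinear_convolve_left)
  have PV: "?P v = v" if "v \<in> ?V" for v
    using that young_idem_idempotent(2)[OF \<alpha>] by (auto simp: specht_module_def convolve_assoc)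
  have "?P x \<in> ?V" if "x \<in> group_algebra N" for x
  proof -
    have "?P x = convolve N (\<lambda>g. inverse (young_scalar N \<alpha>) * x g) (young_symmetrizer N \<alpha>)"
      by (simp add: young_idem_def convolve_scale)
    moreover have "(\<lambda>g. inverse (young_scalar N \<alpha>) * x g) \<in> group_algebra N"
      using that by (simp add: group_algebra_def)
    ultimately show ?thesis by (auto simp: specht_module_def)
  qed
  moreover have VG: "?V \<subseteq> group_algebra N"
    by (auto simp: specht_module_def convolve_in_group_algebra young_symmetrizer_in_group_algebra)
  ultimately have im: "?P ` group_algebra N = ?V" using PV by force
  have fV: "left_mult \<sigma> v \<in> ?V" if "v \<in> ?V" for v
    using that left_mult_in_group_algebra[OF \<sigma>] by (auto simp: specht_module_def left_mult_convolve[OF \<sigma>])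
  have "irr_character N \<alpha> \<sigma> = (\<Sum>g\<in>sym_group N. left_mult \<sigma> (?P (delta g)) g)"
    unfolding irr_character_def
    using trace_on_projection(1)[OF finite_sym_group P clinear_left_mult im[unfolded group_algebra_eq]
        VG[unfolded group_algebra_eq] PV fV] .
  also have "\<dots> = class_sum N (young_idem N \<alpha>) (inv \<sigma>)"
    unfolding class_sum_def by (rule sum.cong[OF refl]) (simp add: convolve_delta_left left_mult_def)
  finally show ?thesis .
qed

text \<open>Cyclicity of the trace: replacing g by \<open>g \<circ> k\<close> moves the factor
  \<open>inv k\<close> from one end of the conjugated permutation to the other.\<close>

lemma class_sum_convolve_commute:
  assumes \<sigma>: "\<sigma> \<in> sym_group N"
  shows "class_sum N (convolve N x y) \<sigma> = class_sum N (convolve N y x) \<sigma>"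
proof -
  have "class_sum N (convolve N x y) \<sigma>
      = (\<Sum>g\<in>sym_group N. \<Sum>k\<in>sym_group N. x (inv g \<circ> (\<sigma> \<circ> (g \<circ> inv k))) * y k)"
    unfolding class_sum_def convolve_def
  proof (rule sum.cong[OF refl])
    fix g assume g: "g \<in> sym_group N"
    let ?w = "inv g \<circ> (\<sigma> \<circ> g)"
    have w: "?w \<in> sym_group N" using g \<sigma> by simp
    have "(\<Sum>h\<in>sym_group N. x h * y (inv h \<circ> ?w)) = (\<Sum>h\<in>sym_group N. x (inv h) * y (h \<circ> ?w))"
      by (subst sum_sym_group_inv[symmetric]) simp
    also have "\<dots> = (\<Sum>k\<in>sym_group N. x (inv (k \<circ> inv ?w)) * y ((k \<circ> inv ?w) \<circ> ?w))"
      by (rule sum_sym_group_right[symmetric]) (use w in \<open>rule sym_group_inv\<close>)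
    also have "\<dots> = (\<Sum>k\<in>sym_group N. x (inv g \<circ> (\<sigma> \<circ> (g \<circ> inv k))) * y k)"
    proof (rule sum.cong[OF refl])
      fix k assume k: "k \<in> sym_group N"
      have "inv (k \<circ> inv ?w) = ?w \<circ> inv k" using w k by simp
      moreover have "(k \<circ> inv ?w) \<circ> ?w = k" using sym_group_cancel(2)[OF w] by (simp only: comp_assoc) simp
      ultimately show "x (inv (k \<circ> inv ?w)) * y ((k \<circ> inv ?w) \<circ> ?w) = x (inv g \<circ> (\<sigma> \<circ> (g \<circ> inv k))) * y k"
        by (simp only: comp_assoc)
    qed
    finally show "(\<Sum>h\<in>sym_group N. x h * y (inv h \<circ> ?w)) = (\<Sum>k\<in>sym_group N. x (inv g \<circ> (\<sigma> \<circ> (g \<circ> inv k))) * y k)" .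
  qed
  also have "\<dots> = (\<Sum>k\<in>sym_group N. \<Sum>g\<in>sym_group N. x (inv g \<circ> (\<sigma> \<circ> (g \<circ> inv k))) * y k)"
    by (rule sum.swap)
  also have "\<dots> = (\<Sum>k\<in>sym_group N. \<Sum>g\<in>sym_group N. y k * x (inv k \<circ> (inv g \<circ> (\<sigma> \<circ> g))))"
  proof (rule sum.cong[OF refl])
    fix k assume k: "k \<in> sym_group N"
    have "(\<Sum>g\<in>sym_group N. x (inv g \<circ> (\<sigma> \<circ> (g \<circ> inv k))) * y k)
        = (\<Sum>g\<in>sym_group N. x (inv (g \<circ> k) \<circ> (\<sigma> \<circ> ((g \<circ> k) \<circ> inv k))) * y k)"
      by (rule sum_sym_group_right[OF k, symmetric])
    also have "\<dots> = (\<Sum>g\<in>sym_group N. y k * x (inv k \<circ> (inv g \<circ> (\<sigma> \<circ> g))))"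
      by (rule sum.cong[OF refl]) (use k in \<open>simp add: comp_assoc\<close>)
    finally show "(\<Sum>g\<in>sym_group N. x (inv g \<circ> (\<sigma> \<circ> (g \<circ> inv k))) * y k)
      = (\<Sum>g\<in>sym_group N. y k * x (inv k \<circ> (inv g \<circ> (\<sigma> \<circ> g))))" .
  qed
  also have "\<dots> = class_sum N (convolve N y x) \<sigma>"
    unfolding class_sum_def convolve_def by (rule sum.swap)
  finally show ?thesis .
qed

lemma class_sum_scale: "class_sum N (\<lambda>g. c * x g) \<sigma> = c * class_sum N x \<sigma>"
  by (simp add: class_sum_def sum_distrib_left)

text \<open>Inversion reverses the product of row sum and column sum, and class sums do not see the
  order of two factors. Consequently the orthogonality relations can be stated without inverses or
  complex conjugates.\<close>

lemma class_sum_young_idem_inv: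
  assumes \<alpha>: "partition_of N \<alpha>" and \<sigma>: "\<sigma> \<in> sym_group N"
  shows "class_sum N (young_idem N \<alpha>) (inv \<sigma>) = class_sum N (young_idem N \<alpha>) \<sigma>"
proof -
  have "class_sum N (young_symmetrizer N \<alpha>) (inv \<sigma>)
      = class_sum N (convolve N (column_sum N \<alpha>) (row_sum N \<alpha>)) \<sigma>"
    unfolding class_sum_def
  proof (rule sum.cong[OF refl])
    fix g assume g: "g \<in> sym_group N"
    have "inv g \<circ> (inv \<sigma> \<circ> g) = inv (inv g \<circ> (\<sigma> \<circ> g))" using g \<sigma> by (simp add: comp_assoc)
    then show "young_symmetrizer N \<alpha> (inv g \<circ> (inv \<sigma> \<circ> g))
        = convolve N (column_sum N \<alpha>) (row_sum N \<alpha>) (inv g \<circ> (\<sigma> \<circ> g))"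
      using young_symmetrizer_inv[OF \<alpha>, of "inv g \<circ> (\<sigma> \<circ> g)"] g \<sigma> by simp
  qed
  also have "\<dots> = class_sum N (young_symmetrizer N \<alpha>) \<sigma>"
    using class_sum_convolve_commute[OF \<sigma>] by (simp add: young_symmetrizer_eq)
  finally show ?thesis by (simp add: young_idem_def class_sum_scale)
qed

lemma irr_character_eq:
  assumes "partition_of N \<alpha>" and "\<sigma> \<in> sym_group N"
  shows "irr_character N \<alpha> \<sigma> = class_sum N (young_idem N \<alpha>) \<sigma>"
  by (simp add: assms irr_character_eq_inv class_sum_young_idem_inv)

section \<open>Orthogonality of the characters\<close>

lemma class_sum_conj:
  assumes "h \<in> sym_group N" "\<sigma> \<in> sym_group N"
  shows "class_sum N x (inv h \<circ> (\<sigma> \<circ> h)) = class_sum N x \<sigma>"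
proof -
  have "class_sum N x \<sigma> = (\<Sum>g\<in>sym_group N. x (inv (h \<circ> g) \<circ> (\<sigma> \<circ> (h \<circ> g))))"
    unfolding class_sum_def by (rule sum_sym_group_left[OF assms(1), symmetric])
  also have "\<dots> = class_sum N x (inv h \<circ> (\<sigma> \<circ> h))"
    unfolding class_sum_def by (rule sum.cong[OF refl]) (use assms in \<open>simp add: comp_assoc\<close>)
  finally show ?thesis by simp
qed

text \<open>Dominance is antisymmetric, so it fails in one of the two directions. If \<alpha> is not
  dominated by \<beta>, the outer row sum of \<alpha> and column sum of \<beta> already give 0.
  Otherwise the inner product of the column sum of \<alpha> and the row sum of \<beta> gives 0,
  which inversion reduces to the same lemma with the shapes exchanged.\<close>

lemma young_symmetrizer_orthogonal:
  assumes \<alpha>: "partition_of N \<alpha>" and \<beta>: "partition_of N \<beta>" and ne: "\<alpha> \<noteq> \<beta>"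
  shows "convolve N (young_symmetrizer N \<alpha>) (convolve N x (young_symmetrizer N \<beta>)) = (\<lambda>w. 0)"
proof (cases "\<forall>i. (\<Sum>r<i. \<alpha> r) \<le> (\<Sum>r<i. \<beta> r)")
  case False
  have "convolve N (young_symmetrizer N \<alpha>) (convolve N x (young_symmetrizer N \<beta>))
      = convolve N (row_sum N \<alpha>) (convolve N (convolve N (column_sum N \<alpha>) (convolve N x (row_sum N \<beta>))) (column_sum N \<beta>))"
    by (simp add: young_symmetrizer_eq convolve_assoc)
  then show ?thesis using convolve_row_column_zero[OF \<alpha> \<beta> False] by auto
next
  case True
  have dom: "\<not> (\<forall>i. (\<Sum>r<i. \<beta> r) \<le> (\<Sum>r<i. \<alpha> r))"
  proof
    assume "\<forall>i. (\<Sum>r<i. \<beta> r) \<le> (\<Sum>r<i. \<alpha> r)"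
    with True have eq: "(\<Sum>r<i. \<alpha> r) = (\<Sum>r<i. \<beta> r)" for i by (meson le_antisym)
    have "\<alpha> i = \<beta> i" for i using eq[of i] eq[of "Suc i"] by simp
    then show False using ne by auto
  qed
  have GA: "convolve N (column_sum N \<alpha>) (convolve N x (row_sum N \<beta>)) \<in> group_algebra N"
    by (intro convolve_in_group_algebra row_sum_in_group_algebra)
  have "convolve N (column_sum N \<alpha>) (convolve N x (row_sum N \<beta>)) w = 0" for w
  proof (cases "w \<in> sym_group N")
    case w: True
    have "convolve N (column_sum N \<alpha>) (convolve N x (row_sum N \<beta>)) (inv (inv w))
      = convolve N (\<lambda>v. convolve N x (row_sum N \<beta>) (inv v)) (\<lambda>v. column_sum N \<alpha> (inv v)) (inv w)"
      by (rule convolve_inv) (use w in simp)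
    also have "\<dots> = convolve N (convolve N (row_sum N \<beta>) (\<lambda>v. x (inv v))) (column_sum N \<alpha>) (inv w)"
    proof (rule convolve_cong)
      fix h assume h: "h \<in> sym_group N"
      show "convolve N x (row_sum N \<beta>) (inv h) = convolve N (row_sum N \<beta>) (\<lambda>v. x (inv v)) h"
        unfolding convolve_inv[OF h] by (rule convolve_cong) (use h row_sum_inv[OF \<beta>] in auto)
      show "column_sum N \<alpha> (inv h) = column_sum N \<alpha> h" by (rule column_sum_inv[OF \<alpha> h])
    qed (use w in simp)
    also have "\<dots> = 0"
      using convolve_row_column_zero[OF \<beta> \<alpha> dom] by (simp add: convolve_assoc)
    finally show ?thesis using w by simp
  qed (use GA in \<open>simp add: group_algebra_def\<close>)
  then have 0: "convolve N (column_sum N \<alpha>) (convolve N x (row_sum N \<beta>)) = (\<lambda>w. 0)" by auto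
  have "convolve N (young_symmetrizer N \<alpha>) (convolve N x (young_symmetrizer N \<beta>))
      = convolve N (row_sum N \<alpha>) (convolve N (convolve N (column_sum N \<alpha>) (convolve N x (row_sum N \<beta>))) (column_sum N \<beta>))"
    by (simp add: young_symmetrizer_eq convolve_assoc)
  then show ?thesis by (simp add: 0)
qed

text \<open>For each g in the first class sum, conjugating \<sigma> by g and translating h by g
  removes g from the summand, whence the factor. What remains are coefficients of products x k y,
  which the relations between symmetrizers control.\<close>

lemma sum_class_sums:
  "(\<Sum>\<sigma>\<in>sym_group N. class_sum N x \<sigma> * class_sum N y (inv \<sigma>))
    = of_nat (card (sym_group N)) * (\<Sum>k\<in>sym_group N. convolve N x (left_mult k y) k)"
proof -
  let ?G = "sym_group N"
  have "(\<Sum>\<sigma>\<in>?G. class_sum N x \<sigma> * class_sum N y (inv \<sigma>))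
      = (\<Sum>\<sigma>\<in>?G. \<Sum>g\<in>?G. \<Sum>h\<in>?G. x (inv g \<circ> (\<sigma> \<circ> g)) * y (inv h \<circ> (inv \<sigma> \<circ> h)))"
    by (simp add: class_sum_def sum_product)
  also have "\<dots> = (\<Sum>g\<in>?G. \<Sum>\<sigma>\<in>?G. \<Sum>h\<in>?G. x (inv g \<circ> (\<sigma> \<circ> g)) * y (inv h \<circ> (inv \<sigma> \<circ> h)))"
    by (rule sum.swap)
  also have "\<dots> = (\<Sum>g\<in>?G. \<Sum>k\<in>?G. convolve N x (left_mult k y) k)"
  proof (rule sum.cong[OF refl])
    fix g assume g: "g \<in> ?G"
    have "(\<Sum>\<sigma>\<in>?G. \<Sum>h\<in>?G. x (inv g \<circ> (\<sigma> \<circ> g)) * y (inv h \<circ> (inv \<sigma> \<circ> h)))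
       = (\<Sum>\<sigma>\<in>?G. \<Sum>h\<in>?G. x (inv g \<circ> ((g \<circ> \<sigma>) \<circ> g)) * y (inv h \<circ> (inv (g \<circ> \<sigma>) \<circ> h)))"
      by (rule sum_sym_group_left[OF g, symmetric])
    also have "\<dots> = (\<Sum>\<sigma>\<in>?G. \<Sum>h\<in>?G. x (\<sigma> \<circ> g) * y (inv h \<circ> (inv \<sigma> \<circ> (inv g \<circ> h))))"
      by (intro sum.cong refl) (use g in \<open>simp add: comp_assoc\<close>)
    also have "\<dots> = (\<Sum>\<sigma>\<in>?G. \<Sum>h\<in>?G. x ((\<sigma> \<circ> inv g) \<circ> g) * y (inv h \<circ> (inv (\<sigma> \<circ> inv g) \<circ> (inv g \<circ> h))))"
      by (rule sum_sym_group_right[symmetric]) (use g in simp)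
    also have "\<dots> = (\<Sum>\<sigma>\<in>?G. \<Sum>h\<in>?G. x \<sigma> * y (inv h \<circ> (g \<circ> (inv \<sigma> \<circ> (inv g \<circ> h)))))"
      by (intro sum.cong refl) (use g in \<open>simp add: comp_assoc\<close>)
    also have "\<dots> = (\<Sum>\<sigma>\<in>?G. \<Sum>k\<in>?G. x \<sigma> * y (inv k \<circ> (inv \<sigma> \<circ> k)))"
    proof (rule sum.cong[OF refl])
      fix \<sigma> assume "\<sigma> \<in> ?G"
      have "(\<Sum>h\<in>?G. x \<sigma> * y (inv h \<circ> (g \<circ> (inv \<sigma> \<circ> (inv g \<circ> h)))))
        = (\<Sum>k\<in>?G. x \<sigma> * y (inv (g \<circ> k) \<circ> (g \<circ> (inv \<sigma> \<circ> (inv g \<circ> (g \<circ> k))))))"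
        by (rule sum_sym_group_left[OF g, symmetric])
      also have "\<dots> = (\<Sum>k\<in>?G. x \<sigma> * y (inv k \<circ> (inv \<sigma> \<circ> k)))"
        by (intro sum.cong refl) (use g in \<open>simp add: comp_assoc\<close>)
      finally show "(\<Sum>h\<in>?G. x \<sigma> * y (inv h \<circ> (g \<circ> (inv \<sigma> \<circ> (inv g \<circ> h)))))
        = (\<Sum>k\<in>?G. x \<sigma> * y (inv k \<circ> (inv \<sigma> \<circ> k)))" .
    qed
    also have "\<dots> = (\<Sum>k\<in>?G. convolve N x (left_mult k y) k)"
      unfolding convolve_def left_mult_def by (rule sum.swap)
    finally show "(\<Sum>\<sigma>\<in>?G. \<Sum>h\<in>?G. x (inv g \<circ> (\<sigma> \<circ> g)) * y (inv h \<circ> (inv \<sigma> \<circ> h)))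
      = (\<Sum>k\<in>?G. convolve N x (left_mult k y) k)" .
  qed
  finally show ?thesis by simp
qed

text \<open>Let e and e' be the two idempotents. The products e k e' vanish for different shapes and
  are multiples c k of e for equal ones. In the latter case, expanding the middle factor of e e e =
  e and comparing coefficients at \<open>id\<close> shows that the sum of c k times the coefficient
  of e at k is 1.\<close>

lemma irr_character_orthogonal:
  assumes \<alpha>: "partition_of N \<alpha>" and \<beta>: "partition_of N \<beta>"
  shows "(\<Sum>\<sigma>\<in>sym_group N. irr_character N \<alpha> \<sigma> * irr_character N \<beta> \<sigma>)
    = (if \<alpha> = \<beta> then of_nat (card (sym_group N)) else 0)"
proof -
  let ?e = "young_idem N"
  have "(\<Sum>\<sigma>\<in>sym_group N. irr_character N \<alpha> \<sigma> * irr_character N \<beta> \<sigma>)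
     = (\<Sum>\<sigma>\<in>sym_group N. class_sum N (?e \<alpha>) \<sigma> * class_sum N (?e \<beta>) (inv \<sigma>))"
    by (intro sum.cong refl) (simp add: irr_character_eq \<alpha> \<beta> class_sum_young_idem_inv)
  also have "\<dots> = of_nat (card (sym_group N)) * (\<Sum>k\<in>sym_group N. convolve N (?e \<alpha>) (left_mult k (?e \<beta>)) k)"
    by (rule sum_class_sums)
  also have "(\<Sum>k\<in>sym_group N. convolve N (?e \<alpha>) (left_mult k (?e \<beta>)) k) = (if \<alpha> = \<beta> then 1 else 0)"
  proof (cases "\<alpha> = \<beta>")
    case False
    have "convolve N (?e \<alpha>) (left_mult k (?e \<beta>)) k = 0" if "k \<in> sym_group N" for k
      unfolding convolve_delta_left[OF that, symmetric] young_idem_def convolve_scale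
      by (simp add: young_symmetrizer_orthogonal[OF \<alpha> \<beta> False])
    then show ?thesis using False by simp
  next
    case True
    have "\<exists>c. convolve N (?e \<alpha>) (left_mult k (?e \<alpha>)) = (\<lambda>w. c * ?e \<alpha> w)" if k: "k \<in> sym_group N" for k
    proof -
      obtain c where c: "convolve N (row_sum N \<alpha>)
          (convolve N (convolve N (column_sum N \<alpha>) (convolve N (delta k) (row_sum N \<alpha>))) (column_sum N \<alpha>))
          = (\<lambda>w. c * young_symmetrizer N \<alpha> w)"
        using convolve_row_column_scalar[OF \<alpha>] by blast
      then have "convolve N (young_symmetrizer N \<alpha>) (convolve N (delta k) (young_symmetrizer N \<alpha>))
          = (\<lambda>w. c * young_symmetrizer N \<alpha> w)"
        by (simp add: young_symmetrizer_eq convolve_assoc)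
      then have "convolve N (?e \<alpha>) (left_mult k (?e \<alpha>)) = (\<lambda>w. (inverse (young_scalar N \<alpha>) * c) * ?e \<alpha> w)"
        unfolding convolve_delta_left[OF that, symmetric] young_idem_def convolve_scale by (simp add: mult_ac)
      then show ?thesis by blast
    qed
    then obtain c where c: "\<And>k. k \<in> sym_group N \<Longrightarrow> convolve N (?e \<alpha>) (left_mult k (?e \<alpha>)) = (\<lambda>w. c k * ?e \<alpha> w)"
      by metis
    have "?e \<alpha> id = convolve N (?e \<alpha>) (convolve N (?e \<alpha>) (?e \<alpha>)) id"
      by (simp add: young_idem_idempotent[OF \<alpha>])
    also have "\<dots> = (\<Sum>k\<in>sym_group N. c k * ?e \<alpha> k) * ?e \<alpha> id"
      unfolding convolve_left_mult_expansion by (simp add: c sum_distrib_left mult_ac)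
    finally have "(\<Sum>k\<in>sym_group N. c k * ?e \<alpha> k) = 1"
      using young_scalar(1)[OF \<alpha>] young_symmetrizer_id[OF \<alpha>] by (simp add: young_idem_def)
    then show ?thesis using True c by simp
  qed
  finally show ?thesis by auto
qed

lemma irr_character_conj:
  assumes "partition_of N \<alpha>" "h \<in> sym_group N" "\<sigma> \<in> sym_group N"
  shows "irr_character N \<alpha> (inv h \<circ> (\<sigma> \<circ> h)) = irr_character N \<alpha> \<sigma>"
  using assms by (simp add: irr_character_eq class_sum_conj)

section \<open>Conjugacy classes\<close>

text \<open>
  The list of the cycle lengths of a permutation. In \<open>cycle_list_exists\<close> it is made canonical by
  splitting off a longest cycle first.
\<close>
inductive cycle_list :: "('a \<Rightarrow> 'a) \<Rightarrow> 'a set \<Rightarrow> nat list \<Rightarrow> bool" for p where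
  Nil: "cycle_list p {} []"
| Cons: "\<lbrakk>cycle_list p S ls; inj_on (\<lambda>i. (p ^^ i) x) {..<l}; (p ^^ l) x = x; l > 0;
    (\<lambda>i. (p ^^ i) x) ` {..<l} \<inter> S = {}\<rbrakk> \<Longrightarrow> cycle_list p ((\<lambda>i. (p ^^ i) x) ` {..<l} \<union> S) (l # ls)"

inductive_cases cycle_list_NilE: "cycle_list p S []"
inductive_cases cycle_list_ConsE: "cycle_list p S (l # ls)"

lemma cycle_closed:
  assumes "(p ^^ l) x = x" "l > 0" "s \<in> (\<lambda>i. (p ^^ i) x) ` {..<l}"
  shows "p s \<in> (\<lambda>i. (p ^^ i) x) ` {..<l}"
proof -
  obtain i where i: "i < l" "s = (p ^^ i) x" using assms by auto
  show ?thesis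
  proof (cases "Suc i < l")
    case True
    then show ?thesis using i by (intro image_eqI[of _ _ "Suc i"]) auto
  next
    case False
    then have "Suc i = l" using i by simp
    then have "p s = (p ^^ l) x" using i by auto
    then have "p s = (p ^^ 0) x" using assms(1) by simp
    then show ?thesis using assms(2) by blast
  qed
qed

lemma cycle_list_closed: "cycle_list p S ls \<Longrightarrow> s \<in> S \<Longrightarrow> p s \<in> S"
proof (induction arbitrary: s rule: cycle_list.induct)
  case (Cons S ls x l)
  then show ?case using cycle_closed[of l p x s] by blast
qed simp

text \<open>The i-th point of a cycle of p is sent to the i-th point of the corresponding cycle of
  q, whatever the starting points.\<close>

lemma cycle_list_conjugate:
  "cycle_list p S ls \<Longrightarrow> cycle_list q T ls \<Longrightarrow> \<exists>h. bij_betw h S T \<and> (\<forall>s\<in>S. h (p s) = q (h s))"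
proof (induction ls arbitrary: S T)
  case Nil
  then show ?case by (auto elim!: cycle_list_NilE simp: bij_betw_def)
next
  case (Cons l ls)
  from Cons.prems(1) obtain S' x where S: "S = (\<lambda>i. (p ^^ i) x) ` {..<l} \<union> S'"
    "cycle_list p S' ls" "inj_on (\<lambda>i. (p ^^ i) x) {..<l}" "(p ^^ l) x = x" "l > 0"
    "(\<lambda>i. (p ^^ i) x) ` {..<l} \<inter> S' = {}" by (auto elim!: cycle_list_ConsE)
  from Cons.prems(2) obtain T' y where T: "T = (\<lambda>i. (q ^^ i) y) ` {..<l} \<union> T'"
    "cycle_list q T' ls" "inj_on (\<lambda>i. (q ^^ i) y) {..<l}" "(q ^^ l) y = y"
    "(\<lambda>i. (q ^^ i) y) ` {..<l} \<inter> T' = {}" by (auto elim!: cycle_list_ConsE)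
  obtain h where h: "bij_betw h S' T'" "\<forall>s\<in>S'. h (p s) = q (h s)" using Cons.IH[OF S(2) T(2)] by blast
  let ?c = "\<lambda>i. (p ^^ i) x" and ?d = "\<lambda>i. (q ^^ i) y"
  let ?k = "?d \<circ> inv_into {..<l} ?c"
  define h' where "h' s = (if s \<in> ?c ` {..<l} then ?k s else h s)" for s
  have k: "?k (?c i) = ?d i" if "i < l" for i using inv_into_f_f[OF S(3), of i] that by simp
  have "bij_betw ?k (?c ` {..<l}) (?d ` {..<l})"
    by (rule bij_betw_trans[OF bij_betw_inv_into]) (use S(3) T(3) in \<open>auto intro: inj_on_imp_bij_betw\<close>)
  then have 1: "bij_betw h' (?c ` {..<l}) (?d ` {..<l})"
    by (subst bij_betw_cong[of _ _ ?k]) (auto simp: h'_def)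
  have 2: "bij_betw h' S' T'"
    using h(1) by (subst bij_betw_cong[of _ _ h]) (use S(6) in \<open>auto simp: h'_def\<close>)
  have "bij_betw h' S T"
    unfolding S(1) T(1) by (rule bij_betw_combine[OF 1 2 T(5)])
  moreover have "h' (p s) = q (h' s)" if s: "s \<in> S" for s
  proof (cases "s \<in> ?c ` {..<l}")
    case True
    then obtain i where i: "i < l" "s = ?c i" by auto
    have "h' (p s) = ?d (Suc i)"
    proof (cases "Suc i < l")
      case True
      then have "h' (?c (Suc i)) = ?d (Suc i)" using k[OF True] by (auto simp: h'_def simp del: funpow.simps)
      then show ?thesis using i by simp
    next
      case False
      then have "Suc i = l" using i by simp
      then have "p s = ?c l" "?d (Suc i) = ?d l" using i by auto
      then have "p s = ?c 0" "?d (Suc i) = ?d 0" using S(4) T(4) by simp_all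
      moreover have "h' (?c 0) = ?d 0" using k[OF S(5)] S(5) unfolding h'_def by (metis imageI lessThan_iff)
      ultimately show ?thesis by metis
    qed
    moreover have "h' s = ?d i" using True k[OF i(1)] i unfolding h'_def by simp
    ultimately show ?thesis by simp
  next
    case False
    then have "s \<in> S'" using s S(1) by auto
    moreover from this have "p s \<in> S'" by (rule cycle_list_closed[OF S(2)])
    moreover have "p s \<notin> ?c ` {..<l}" using calculation S(6) by blast
    ultimately show ?thesis using False h(2) unfolding h'_def by simp
  qed
  ultimately show ?case by blast
qed

definition period :: "('a \<Rightarrow> 'a) \<Rightarrow> 'a \<Rightarrow> nat" where
  "period p x = (LEAST l. l > 0 \<and> (p ^^ l) x = x)"

lemma period:
  assumes "permutation p"
  shows "period p x > 0" "(p ^^ period p x) x = x" "inj_on (\<lambda>i. (p ^^ i) x) {..<period p x}"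
proof -
  obtain n where "n > 0 \<and> (p ^^ n) x = x" using permutation_self[OF assms, of x] by auto
  then have *: "period p x > 0 \<and> (p ^^ period p x) x = x" unfolding period_def by (rule LeastI)
  then show "period p x > 0" "(p ^^ period p x) x = x" by auto
  have inj: "inj (p ^^ i)" for i using assms by (simp add: permutation_bijective bij_is_inj inj_fn)
  have False if ij: "i < j" "j < period p x" "(p ^^ i) x = (p ^^ j) x" for i j
  proof -
    have "(p ^^ j) x = (p ^^ i) ((p ^^ (j - i)) x)"
      using ij(1) by (metis comp_apply funpow_add le_add_diff_inverse less_imp_le)
    then have "(p ^^ (j - i)) x = x" using ij(3) inj[of i] by (metis injD)
    then have "j - i > 0 \<and> (p ^^ (j - i)) x = x" using ij by simp
    then have "period p x \<le> j - i" unfolding period_def by (rule Least_le)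
    then show False using ij by simp
  qed
  then show "inj_on (\<lambda>i. (p ^^ i) x) {..<period p x}"
    unfolding inj_on_def by (metis lessThan_iff linorder_neqE_nat)
qed

text \<open>That all lengths are periods of points of S is recorded for the induction: it bounds the
  remaining lengths by the length just split off, and so gives sortedness. It also excludes the
  length 0 later.\<close>

lemma cycle_list_exists:
  assumes p: "permutation p"
  shows "finite S \<Longrightarrow> p ` S \<subseteq> S \<Longrightarrow>
    \<exists>ls. cycle_list p S ls \<and> sorted_wrt (\<ge>) ls \<and> sum_list ls = card S \<and> set ls \<subseteq> period p ` S"
proof (induction "card S" arbitrary: S rule: less_induct)
  case less
  show ?case
  proof (cases "S = {}")
    case True
    then show ?thesis by (intro exI[of _ "[]"]) (auto intro: cycle_list.Nil)
  next
    case False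
    define l where "l = Max (period p ` S)"
    have "l \<in> period p ` S" unfolding l_def using False less.prems by (intro Max_in) auto
    then obtain x where x: "x \<in> S" "l = period p x" by auto
    have max: "period p y \<le> l" if "y \<in> S" for y
      unfolding l_def using that less.prems by (intro Max_ge) auto
    note l = period[OF p, of x, folded x(2)]
    let ?C = "(\<lambda>i. (p ^^ i) x) ` {..<l}"
    have "(p ^^ i) x \<in> S" for i using less.prems(2) x(1) by (induction i) auto
    then have CS: "?C \<subseteq> S" by auto
    have "p ` (S - ?C) \<subseteq> S - ?C"
    proof
      fix y assume "y \<in> p ` (S - ?C)"
      then obtain s where s: "s \<in> S" "s \<notin> ?C" "y = p s" by auto
      have "p s \<notin> ?C"
      proof
        assume "p s \<in> ?C"
        then obtain i where i: "i < l" "p s = (p ^^ i) x" by auto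
        \<comment> \<open>The predecessor on the cycle, which for i = 0 is the last point.
          Injectivity of p then puts s itself on the cycle.\<close>
        obtain j where j: "j < l" "(p ^^ i) x = p ((p ^^ j) x)"
        proof (cases i)
          case 0
          have "(p ^^ l) x = p ((p ^^ (l - 1)) x)" using l(1) by (cases l) auto
          then show ?thesis using that[of "l - 1"] l(1,2) 0 by simp
        next
          case (Suc j)
          then show ?thesis using that[of j] i by simp
        qed
        have "s = (p ^^ j) x" using i j p by (metis permutation_bijective bij_is_inj injD)
        then show False using s j by auto
      qed
      then show "y \<in> S - ?C" using s less.prems(2) by auto
    qed
    moreover have "card (S - ?C) < card S"
      by (rule psubset_card_mono) (use less.prems CS l(1) in \<open>force+\<close>)
    ultimately obtain ls where ls: "cycle_list p (S - ?C) ls" "sorted_wrt (\<ge>) ls"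
      "sum_list ls = card (S - ?C)" "set ls \<subseteq> period p ` (S - ?C)"
      using less.hyps[of "S - ?C"] less.prems by auto
    have "cycle_list p (?C \<union> (S - ?C)) (l # ls)"
      by (rule cycle_list.Cons) (use ls l in auto)
    moreover have "?C \<union> (S - ?C) = S" using CS by auto
    moreover have "card S = l + card (S - ?C)"
    proof -
      have "card ?C = l" using card_image[OF l(3)] by simp
      then show ?thesis using card_Diff_subset[OF _ CS] card_mono[OF less.prems(1) CS] by simp
    qed
    moreover have "sorted_wrt (\<ge>) (l # ls)" using ls(2,4) max by auto
    moreover have "set (l # ls) \<subseteq> period p ` S" using ls(4) x by auto
    ultimately show ?thesis using ls(3) by (intro exI[of _ "l # ls"]) auto
  qed
qed

definition list_partition :: "nat list \<Rightarrow> nat \<Rightarrow> nat" where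
  "list_partition ls = (\<lambda>i. if i < length ls then ls ! i else 0)"

lemma partition_of_list_partition:
  assumes "sorted_wrt (\<ge>) ls" "0 \<notin> set ls"
  shows "partition_of (sum_list ls) (list_partition ls)"
proof -
  have nz: "list_partition ls i \<noteq> 0 \<longleftrightarrow> i < length ls" for i
    using assms(2) by (auto simp: list_partition_def in_set_conv_nth)
  have "antimono (list_partition ls)"
  proof (rule antimonoI)
    fix i j :: nat assume "i \<le> j"
    then show "list_partition ls j \<le> list_partition ls i"
      using sorted_wrt_nth_less[OF assms(1), of i j] by (cases "i = j") (auto simp: list_partition_def)
  qed
  moreover have "{i. list_partition ls i \<noteq> 0} = {..<length ls}" using nz by auto
  moreover have "(\<Sum>i<length ls. list_partition ls i) = sum_list ls"
    by (simp add: list_partition_def sum_list_sum_nth atLeast0LessThan)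
  ultimately show ?thesis by (simp add: partition_of_def)
qed

lemma list_partition_inj:
  assumes "list_partition ls = list_partition ls'" "0 \<notin> set ls" "0 \<notin> set ls'"
  shows "ls = ls'"
proof -
  have le: "length ls \<le> length ls'"
    if "list_partition ls = list_partition ls'" "0 \<notin> set ls" for ls ls'
  proof (rule ccontr)
    assume "\<not> ?thesis"
    then have "length ls' < length ls" by simp
    moreover from this have "ls ! length ls' = 0"
      using fun_cong[OF that(1), of "length ls'"] by (simp add: list_partition_def)
    ultimately show False using that(2) nth_mem by metis
  qed
  have "length ls = length ls'" using le assms by (metis le_antisym)
  then show ?thesis
    using fun_cong[OF assms(1)] by (intro nth_equalityI) (auto simp: list_partition_def split: if_splits, metis)
qed

lemma finite_partitions: "finite {\<alpha>. partition_of N \<alpha>}"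
proof (rule finite_subset)
  show "{\<alpha>. partition_of N \<alpha>} \<subseteq> {f. \<forall>i. (i \<in> {..<N} \<longrightarrow> f i \<in> {..N}) \<and> (i \<notin> {..<N} \<longrightarrow> f i = 0)}"
  proof clarify
    fix \<alpha> i assume \<alpha>: "partition_of N \<alpha>"
    have "\<alpha> i \<le> (\<Sum>r<Suc i. \<alpha> r)" by simp
    also have "\<dots> \<le> N" by (rule partition_of_prefix_sum(1)[OF \<alpha>])
    finally have 1: "\<alpha> i \<le> N" .
    have 2: "\<alpha> i = 0" if "i \<ge> N"
    proof (rule ccontr)
      assume "\<alpha> i \<noteq> 0"
      then have "1 \<le> \<alpha> r" if "r < Suc i" for r
        using partition_of_antimono[OF \<alpha>, of r i] that by simp
      then have "(\<Sum>r<Suc i. 1) \<le> (\<Sum>r<Suc i. \<alpha> r)" by (intro sum_mono) auto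
      then show False using partition_of_prefix_sum(1)[OF \<alpha>, of "Suc i"] that by simp
    qed
    show "(i \<in> {..<N} \<longrightarrow> \<alpha> i \<in> {..N}) \<and> (i \<notin> {..<N} \<longrightarrow> \<alpha> i = 0)" using 1 2 by auto
  qed
  show "finite {f. \<forall>i. (i \<in> {..<N} \<longrightarrow> f i \<in> {..N}) \<and> (i \<notin> {..<N} \<longrightarrow> f i = (0::nat))}"
    by (rule finite_set_of_finite_funs) auto
qed

text \<open>The point is the upper bound: there are at most as many classes as partitions. So
  \<open>rep \<alpha>\<close> is any permutation of cycle type \<alpha> if there is one and
  unspecified otherwise, whence the condition \<open>rep \<alpha> \<in> sym_group N\<close>.\<close>

lemma conjugacy_representatives:
  obtains rep where "\<And>p. p \<in> sym_group N \<Longrightarrow>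
    \<exists>\<alpha> h. partition_of N \<alpha> \<and> rep \<alpha> \<in> sym_group N \<and> h \<in> sym_group N \<and> p = inv h \<circ> (rep \<alpha> \<circ> h)"
proof -
  define Q where "Q \<alpha> p \<longleftrightarrow> p \<in> sym_group N \<and> (\<exists>ls. list_partition ls = \<alpha> \<and> 0 \<notin> set ls \<and> cycle_list p {..<N} ls)" for \<alpha> p
  define rep where "rep \<alpha> = (SOME p. Q \<alpha> p)" for \<alpha>
  have "\<exists>\<alpha> h. partition_of N \<alpha> \<and> rep \<alpha> \<in> sym_group N \<and> h \<in> sym_group N \<and> p = inv h \<circ> (rep \<alpha> \<circ> h)"
    if p: "p \<in> sym_group N" for p
  proof -
    have perm: "permutation p" by (rule sym_group_permutation[OF p])
    have "p ` {..<N} \<subseteq> {..<N}" using p by (auto simp: sym_group_less)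
    from cycle_list_exists[OF perm _ this] obtain ls where
      ls: "cycle_list p {..<N} ls" "sorted_wrt (\<ge>) ls" "sum_list ls = N" "set ls \<subseteq> period p ` {..<N}"
      by auto
    have nz: "0 \<notin> set ls"
    proof
      assume "0 \<in> set ls"
      then obtain s where "period p s = 0" using ls(4) by auto
      then show False using period(1)[OF perm, of s] by simp
    qed
    define \<alpha> where "\<alpha> = list_partition ls"
    have \<alpha>: "partition_of N \<alpha>" using partition_of_list_partition[OF ls(2) nz] ls(3) by (simp add: \<alpha>_def)
    have "Q \<alpha> p" using p ls nz by (auto simp: Q_def \<alpha>_def)
    then have "Q \<alpha> (rep \<alpha>)" unfolding rep_def by (rule someI[of "Q \<alpha>"])
    then have r: "rep \<alpha> \<in> sym_group N" "cycle_list (rep \<alpha>) {..<N} ls"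
      using list_partition_inj nz by (auto simp: Q_def \<alpha>_def)
    obtain h where h: "bij_betw h {..<N} {..<N}" "\<And>s. s < N \<Longrightarrow> h (p s) = rep \<alpha> (h s)"
      using cycle_list_conjugate[OF ls(1) r(2)] by auto
    define h' where "h' s = (if s < N then h s else s)" for s
    have "bij_betw h' {..<N} {..<N}" using h(1) by (subst bij_betw_cong[of _ _ h]) (auto simp: h'_def)
    then have h'G: "h' \<in> sym_group N"
      unfolding sym_group_def by (auto intro!: bij_imp_permutes simp: h'_def split: if_splits)
    have "h' (p s) = rep \<alpha> (h' s)" for s
    proof (cases "s < N")
      case True
      then show ?thesis using h(2) sym_group_less[OF p] by (simp add: h'_def)
    next
      case False
      then have "p s = s" "rep \<alpha> s = s" using p r(1) by (auto simp: sym_group_def permutes_not_in)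
      then show ?thesis using False by (simp add: h'_def)
    qed
    then have "p = inv h' \<circ> (rep \<alpha> \<circ> h')" using sym_group_cancel(7)[OF h'G] by (metis comp_apply ext)
    then show ?thesis using \<alpha> r h'G by blast
  qed
  then show ?thesis using that by blast
qed

section \<open>Existence and uniqueness of Kronecker coefficients\<close>

text \<open>Multiply by the character of \<beta> and sum over the group: orthogonality leaves the
  order of the group times the coefficient of \<beta>.\<close>

lemma irr_characters_independent:
  assumes "\<And>\<sigma>. \<sigma> \<in> sym_group N \<Longrightarrow> (\<Sum>\<gamma> | partition_of N \<gamma>. c \<gamma> * irr_character N \<gamma> \<sigma>) = 0"
    and \<beta>: "partition_of N \<beta>"
  shows "c \<beta> = 0"
proof -
  let ?P = "{\<gamma>. partition_of N \<gamma>}" and ?G = "sym_group N"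
  have "0 = (\<Sum>\<sigma>\<in>?G. (\<Sum>\<gamma>\<in>?P. c \<gamma> * irr_character N \<gamma> \<sigma>) * irr_character N \<beta> \<sigma>)"
    using assms(1) by simp
  also have "\<dots> = (\<Sum>\<gamma>\<in>?P. c \<gamma> * (\<Sum>\<sigma>\<in>?G. irr_character N \<gamma> \<sigma> * irr_character N \<beta> \<sigma>))"
    by (simp add: sum_distrib_right sum_distrib_left mult.assoc) (rule sum.swap)
  also have "\<dots> = (\<Sum>\<gamma>\<in>?P. if \<gamma> = \<beta> then c \<beta> * of_nat (card ?G) else 0)"
    by (rule sum.cong[OF refl]) (use \<beta> in \<open>auto simp: irr_character_orthogonal\<close>)
  also have "\<dots> = c \<beta> * of_nat (card ?G)"
    using \<beta> finite_partitions by simp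
  finally show ?thesis by (auto simp: card_eq_0_iff intro: sym_group_id)
qed

text \<open>
  The characters are as many as the partitions, and a class function is determined by its values
  at representatives indexed by partitions, so independence implies spanning.
\<close>
lemma class_function_expansion:
  assumes f: "\<And>h \<sigma>. h \<in> sym_group N \<Longrightarrow> \<sigma> \<in> sym_group N \<Longrightarrow> f (inv h \<circ> (\<sigma> \<circ> h)) = f \<sigma>"
  obtains c where "\<And>\<sigma>. \<sigma> \<in> sym_group N \<Longrightarrow> f \<sigma> = (\<Sum>\<gamma> | partition_of N \<gamma>. c \<gamma> * irr_character N \<gamma> \<sigma>)"
proof -
  let ?P = "{\<gamma>. partition_of N \<gamma>}" and ?G = "sym_group N"
  obtain rep where rep: "\<And>p. p \<in> ?G \<Longrightarrow>
    \<exists>\<alpha> h. partition_of N \<alpha> \<and> rep \<alpha> \<in> ?G \<and> h \<in> ?G \<and> p = inv h \<circ> (rep \<alpha> \<circ> h)"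
    using conjugacy_representatives by blast
  define R where "R = {\<alpha>. partition_of N \<alpha> \<and> rep \<alpha> \<in> ?G}"
  \<comment> \<open>Evaluation at the representatives. The result is supported on partitions, so all
    these functions live in a space of dimension at most their number, and \<open>det\<close> says
    that \<open>ev\<close> is injective on class functions.\<close>
  define ev where "ev u = (\<lambda>\<alpha>. if \<alpha> \<in> R then u (rep \<alpha>) else 0)" for u :: "(nat \<Rightarrow> nat) \<Rightarrow> complex"
  define v where "v \<gamma> = ev (irr_character N \<gamma>)" for \<gamma>
  have det: "u \<sigma> = w \<sigma>" if eq: "ev u = ev w" and \<sigma>: "\<sigma> \<in> ?G"
    and cf: "\<And>h \<sigma>. h \<in> ?G \<Longrightarrow> \<sigma> \<in> ?G \<Longrightarrow> u (inv h \<circ> (\<sigma> \<circ> h)) = u \<sigma>"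
    "\<And>h \<sigma>. h \<in> ?G \<Longrightarrow> \<sigma> \<in> ?G \<Longrightarrow> w (inv h \<circ> (\<sigma> \<circ> h)) = w \<sigma>" for u w \<sigma>
  proof -
    obtain \<alpha> h where "\<alpha> \<in> R" "h \<in> ?G" "\<sigma> = inv h \<circ> (rep \<alpha> \<circ> h)" using rep[OF \<sigma>] by (auto simp: R_def)
    then show ?thesis using cf[of h "rep \<alpha>"] fun_cong[OF eq, of \<alpha>] by (auto simp: ev_def R_def)
  qed
  define S where "S c \<sigma> = (\<Sum>\<gamma>\<in>?P. c \<gamma> * irr_character N \<gamma> \<sigma>)" for c \<sigma>
  have comb: "ev (S c) = (\<Sum>\<gamma>\<in>?P. (\<lambda>\<alpha>. c \<gamma> * v \<gamma> \<alpha>))" for c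
    by (auto simp: fun_eq_iff ev_def v_def sum_fun_apply S_def)
  have conj_sum: "S c (inv h \<circ> (\<sigma> \<circ> h)) = S c \<sigma>" if "h \<in> ?G" "\<sigma> \<in> ?G" for c h \<sigma>
    using that unfolding S_def by (intro sum.cong refl) (simp add: irr_character_conj)
  have indep: "c \<beta> = 0" if c: "(\<Sum>\<gamma>\<in>?P. (\<lambda>\<alpha>. c \<gamma> * v \<gamma> \<alpha>)) = 0" and \<beta>: "partition_of N \<beta>" for c \<beta>
  proof (rule irr_characters_independent[OF _ \<beta>])
    fix \<sigma> assume \<sigma>: "\<sigma> \<in> ?G"
    have "ev (S c) = ev (\<lambda>\<sigma>. 0)"
      unfolding comb c by (auto simp: ev_def fun_eq_iff)
    then have "S c \<sigma> = (\<lambda>\<sigma>. 0) \<sigma>" using \<sigma> conj_sum by (rule det) auto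
    then show "(\<Sum>\<gamma>\<in>?P. c \<gamma> * irr_character N \<gamma> \<sigma>) = 0" by (simp add: S_def)
  qed
  have inj: "inj_on v ?P"
  proof (rule inj_onI, rule ccontr)
    fix \<gamma> \<gamma>' assume *: "\<gamma> \<in> ?P" "\<gamma>' \<in> ?P" "v \<gamma> = v \<gamma>'" "\<gamma> \<noteq> \<gamma>'"
    define c where "c = (\<lambda>x. if x = \<gamma> then 1 else if x = \<gamma>' then -1 else (0::complex))"
    have "(\<Sum>x\<in>?P. (\<lambda>\<alpha>. c x * v x \<alpha>)) = (\<Sum>x\<in>{\<gamma>, \<gamma>'}. (\<lambda>\<alpha>. c x * v x \<alpha>))"
      by (rule sum.mono_neutral_right[OF finite_partitions]) (use * in \<open>auto simp: c_def fun_eq_iff\<close>)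
    also have "\<dots> = 0" using * by (auto simp: c_def fun_eq_iff)
    finally show False using indep[of c \<gamma>] * by (simp add: c_def)
  qed
  have fin: "finite (v ` ?P)" using finite_partitions by simp
  have scal: "u w = 0" if u: "(\<Sum>w\<in>v ` ?P. (\<lambda>x. u w * w x)) = 0" and w: "w \<in> v ` ?P" for u w
  proof -
    obtain \<beta> where \<beta>: "partition_of N \<beta>" "w = v \<beta>" using w by auto
    have "(\<Sum>\<gamma>\<in>?P. (\<lambda>x. u (v \<gamma>) * v \<gamma> x)) = 0"
      using u by (subst (asm) sum.reindex[OF inj]) (simp add: o_def)
    from indep[of "\<lambda>\<gamma>. u (v \<gamma>)", OF this \<beta>(1)] show "u w = 0" by (simp add: \<beta>)
  qed
  have ind: "cfun.independent (v ` ?P)"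
    by (rule cfun.independent_if_scalars_zero[OF fin]) (fact scal)
  have ev_supp: "ev u \<in> cfun.span (delta ` ?P)" for u
    using supported_on_subset_span[OF finite_partitions[of N]] by (auto simp: ev_def R_def supported_on_def)
  \<comment> \<open>Otherwise there would be one more independent vector than there are
    partitions.\<close>
  have "ev f \<in> cfun.span (v ` ?P)"
  proof (rule ccontr)
    assume nin: "ev f \<notin> cfun.span (v ` ?P)"
    then have "cfun.independent (insert (ev f) (v ` ?P))" using ind by (rule cfun.independent_insertI)
    then have "card (insert (ev f) (v ` ?P)) \<le> card (delta ` ?P)"
      using cfun.independent_span_bound[of "delta ` ?P"] finite_partitions[of N] ev_supp by (auto simp: v_def)
    also have "\<dots> \<le> card ?P" by (rule card_image_le[OF finite_partitions])
    also have "\<dots> = card (v ` ?P)" by (rule card_image[OF inj, symmetric])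
    finally have "card (insert (ev f) (v ` ?P)) \<le> card (v ` ?P)" .
    moreover have "ev f \<notin> v ` ?P" using nin cfun.span_base by metis
    ultimately show False using fin by simp
  qed
  then obtain u where "ev f = (\<Sum>w\<in>v ` ?P. (\<lambda>x. u w * w x))"
    unfolding cfun.span_finite[OF fin] by auto
  then have "ev f = (\<Sum>\<gamma>\<in>?P. (\<lambda>x. u (v \<gamma>) * v \<gamma> x))"
    by (subst (asm) sum.reindex[OF inj]) (simp add: o_def)
  then have "ev f = ev (S (\<lambda>\<gamma>. u (v \<gamma>)))" by (simp add: comb)
  then have "f \<sigma> = S (\<lambda>\<gamma>. u (v \<gamma>)) \<sigma>" if "\<sigma> \<in> ?G" for \<sigma>
    using that f conj_sum by (rule det)
  then show ?thesis using that[of "\<lambda>\<gamma>. u (v \<gamma>)"] by (simp add: S_def)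
qed

text \<open>The product of two characters has an expansion with complex coefficients, and
  orthogonality forces these to solve the equation assumed for m. That a natural solution m exists
  is thus an input; it will be a dimension.\<close>

lemma kronecker_eqI:
  assumes \<alpha>: "partition_of N \<alpha>" and \<beta>: "partition_of N \<beta>"
    and m: "\<And>\<gamma>. partition_of N \<gamma> \<Longrightarrow> of_nat (m \<gamma>) * of_nat (card (sym_group N))
      = (\<Sum>\<sigma>\<in>sym_group N. irr_character N \<alpha> \<sigma> * irr_character N \<beta> \<sigma> * irr_character N \<gamma> \<sigma>)"
    and m0: "\<And>\<gamma>. \<not> partition_of N \<gamma> \<Longrightarrow> m \<gamma> = 0"
  shows "kronecker N \<alpha> \<beta> = m"
proof -
  let ?P = "{\<gamma>. partition_of N \<gamma>}" and ?G = "sym_group N"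
  define f where "f = (\<lambda>\<sigma>. irr_character N \<alpha> \<sigma> * irr_character N \<beta> \<sigma>)"
  have card: "of_nat (card ?G) \<noteq> (0::complex)" by (auto simp: card_eq_0_iff intro: sym_group_id)
  obtain c where c: "\<And>\<sigma>. \<sigma> \<in> ?G \<Longrightarrow> f \<sigma> = (\<Sum>\<gamma>\<in>?P. c \<gamma> * irr_character N \<gamma> \<sigma>)"
    by (rule class_function_expansion[of N f]) (use \<alpha> \<beta> in \<open>auto simp: f_def irr_character_conj\<close>)
  have "c \<gamma> = of_nat (m \<gamma>)" if \<gamma>: "partition_of N \<gamma>" for \<gamma>
  proof -
    have "of_nat (m \<gamma>) * of_nat (card ?G) = (\<Sum>\<sigma>\<in>?G. (\<Sum>\<delta>\<in>?P. c \<delta> * irr_character N \<delta> \<sigma>) * irr_character N \<gamma> \<sigma>)"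
      unfolding m[OF \<gamma>] by (rule sum.cong[OF refl]) (simp add: c[symmetric] f_def)
    also have "\<dots> = (\<Sum>\<delta>\<in>?P. c \<delta> * (\<Sum>\<sigma>\<in>?G. irr_character N \<delta> \<sigma> * irr_character N \<gamma> \<sigma>))"
      by (simp add: sum_distrib_right sum_distrib_left mult.assoc) (rule sum.swap)
    also have "\<dots> = (\<Sum>\<delta>\<in>?P. if \<delta> = \<gamma> then c \<gamma> * of_nat (card ?G) else 0)"
      by (rule sum.cong[OF refl]) (use \<gamma> in \<open>auto simp: irr_character_orthogonal\<close>)
    also have "\<dots> = c \<gamma> * of_nat (card ?G)"
      using \<gamma> finite_partitions by simp
    finally show ?thesis using card by simp
  qed
  then have ex: "f \<sigma> = (\<Sum>\<gamma>\<in>?P. of_nat (m \<gamma>) * irr_character N \<gamma> \<sigma>)" if "\<sigma> \<in> ?G" for \<sigma>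
    unfolding c[OF that] by (intro sum.cong) auto
  show ?thesis
    unfolding kronecker_def
  proof (rule the_equality, intro conjI)
    show "\<forall>\<gamma>. \<not> partition_of N \<gamma> \<longrightarrow> m \<gamma> = 0" using m0 by blast
    show "\<forall>\<sigma>\<in>?G. irr_character N \<alpha> \<sigma> * irr_character N \<beta> \<sigma> = (\<Sum>\<gamma>\<in>?P. of_nat (m \<gamma>) * irr_character N \<gamma> \<sigma>)"
      using ex by (simp add: f_def)
    fix g assume g: "(\<forall>\<gamma>. \<not> partition_of N \<gamma> \<longrightarrow> g \<gamma> = 0) \<and>
      (\<forall>\<sigma>\<in>?G. irr_character N \<alpha> \<sigma> * irr_character N \<beta> \<sigma> = (\<Sum>\<gamma>\<in>?P. of_nat (g \<gamma>) * irr_character N \<gamma> \<sigma>))"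
    show "g = m"
    proof
      fix \<gamma>
      show "g \<gamma> = m \<gamma>"
      proof (cases "partition_of N \<gamma>")
        case True
        have "of_nat (g \<gamma>) - of_nat (m \<gamma>) = (0::complex)"
        proof (rule irr_characters_independent[OF _ True])
          fix \<sigma> assume "\<sigma> \<in> ?G"
          then have "(\<Sum>\<gamma>\<in>?P. of_nat (g \<gamma>) * irr_character N \<gamma> \<sigma>) = (\<Sum>\<gamma>\<in>?P. of_nat (m \<gamma>) * irr_character N \<gamma> \<sigma>)"
            using g ex by (simp add: f_def)
          then show "(\<Sum>\<gamma>\<in>?P. (of_nat (g \<gamma>) - of_nat (m \<gamma>)) * irr_character N \<gamma> \<sigma>) = 0"
            by (simp add: algebra_simps sum_subtractf)
        qed
        then show ?thesis by simp
      qed (use g m0 in simp)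
    qed
  qed
qed

section \<open>Kronecker coefficients as ranks\<close>

type_synonym perm3 = "(nat \<Rightarrow> nat) \<times> (nat \<Rightarrow> nat) \<times> (nat \<Rightarrow> nat)"

definition sym_group3 :: "nat \<Rightarrow> perm3 set" where
  "sym_group3 N = sym_group N \<times> sym_group N \<times> sym_group N"

definition act1 :: "nat \<Rightarrow> ((nat \<Rightarrow> nat) \<Rightarrow> complex) \<Rightarrow> (perm3 \<Rightarrow> complex) \<Rightarrow> perm3 \<Rightarrow> complex" where
  "act1 N x u = (\<lambda>(g1, g2, g3). convolve N x (\<lambda>w. u (w, g2, g3)) g1)"

definition act2 :: "nat \<Rightarrow> ((nat \<Rightarrow> nat) \<Rightarrow> complex) \<Rightarrow> (perm3 \<Rightarrow> complex) \<Rightarrow> perm3 \<Rightarrow> complex" where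
  "act2 N x u = (\<lambda>(g1, g2, g3). convolve N x (\<lambda>w. u (g1, w, g3)) g2)"

definition act3 :: "nat \<Rightarrow> ((nat \<Rightarrow> nat) \<Rightarrow> complex) \<Rightarrow> (perm3 \<Rightarrow> complex) \<Rightarrow> perm3 \<Rightarrow> complex" where
  "act3 N x u = (\<lambda>(g1, g2, g3). convolve N x (\<lambda>w. u (g1, g2, w)) g3)"

definition diag_avg :: "nat \<Rightarrow> (perm3 \<Rightarrow> complex) \<Rightarrow> perm3 \<Rightarrow> complex" where
  "diag_avg N u = (\<lambda>(g1, g2, g3).
     inverse (of_nat (card (sym_group N))) * (\<Sum>\<sigma>\<in>sym_group N. u (g1 \<circ> \<sigma>, g2 \<circ> \<sigma>, g3 \<circ> \<sigma>)))"

text \<open>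
  The action of \<open>e\<^sub>\<alpha> \<otimes> e\<^sub>\<beta> \<otimes> e\<^sub>\<gamma>\<close> from the left, combined with the projection onto the functions invariant
  under the diagonal from the right.
\<close>
definition kron_proj :: "nat \<Rightarrow> (nat \<Rightarrow> nat) \<Rightarrow> (nat \<Rightarrow> nat) \<Rightarrow> (nat \<Rightarrow> nat) \<Rightarrow> (perm3 \<Rightarrow> complex) \<Rightarrow> perm3 \<Rightarrow> complex" where
  "kron_proj N \<alpha> \<beta> \<gamma> u
     = act1 N (young_idem N \<alpha>) (act2 N (young_idem N \<beta>) (act3 N (young_idem N \<gamma>) (diag_avg N u)))"

lemma card_sym_group_nz: "of_nat (card (sym_group N)) \<noteq> (0::complex)"
  by (auto simp: card_eq_0_iff intro: sym_group_id)

lemma act_comp: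
  "act1 N x (act1 N y u) = act1 N (convolve N x y) u"
  "act2 N x (act2 N y u) = act2 N (convolve N x y) u"
  "act3 N x (act3 N y u) = act3 N (convolve N x y) u"
  unfolding act1_def act2_def act3_def prod.case convolve_assoc by (rule refl)+

lemma convolve_swap:
  "convolve N x (\<lambda>w. convolve N y (\<lambda>v. f w v) h) g = convolve N y (\<lambda>v. convolve N x (\<lambda>w. f w v) g) h"
  unfolding convolve_def sum_distrib_left
  by (rule trans[OF sum.swap], rule sum.cong[OF refl], rule sum.cong[OF refl], rule mult.left_commute)

lemma act_commute:
  "act1 N x (act2 N y u) = act2 N y (act1 N x u)"
  "act1 N x (act3 N y u) = act3 N y (act1 N x u)"
  "act2 N x (act3 N y u) = act3 N y (act2 N x u)"
  unfolding act1_def act2_def act3_def prod.case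
  by (subst convolve_swap, rule refl)+

lemma convolve_avg:
  "a * (\<Sum>\<sigma>\<in>A. convolve N x (\<lambda>w. f w \<sigma>) (g \<circ> \<sigma>)) = convolve N x (\<lambda>w. a * (\<Sum>\<sigma>\<in>A. f (w \<circ> \<sigma>) \<sigma>)) g"
  unfolding convolve_def sum_distrib_left comp_assoc
  by (rule trans[OF sum.swap], rule sum.cong[OF refl], rule sum.cong[OF refl], rule mult.left_commute)

lemma diag_avg_act:
  "diag_avg N (act1 N x u) = act1 N x (diag_avg N u)"
  "diag_avg N (act2 N x u) = act2 N x (diag_avg N u)"
  "diag_avg N (act3 N x u) = act3 N x (diag_avg N u)"
  unfolding act1_def act2_def act3_def diag_avg_def prod.case
  by (subst convolve_avg, rule refl)+

lemma diag_avg_invariant: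
  assumes "\<sigma> \<in> sym_group N"
  shows "diag_avg N u (g1 \<circ> \<sigma>, g2 \<circ> \<sigma>, g3 \<circ> \<sigma>) = diag_avg N u (g1, g2, g3)"
  using sum_sym_group_left[OF assms, of "\<lambda>\<sigma>. u (g1 \<circ> \<sigma>, g2 \<circ> \<sigma>, g3 \<circ> \<sigma>)"]
  by (simp add: diag_avg_def comp_assoc)

lemma diag_avg_idem: "diag_avg N (diag_avg N u) = diag_avg N u"
proof (rule ext, clarify)
  fix g1 g2 g3
  have "diag_avg N (diag_avg N u) (g1, g2, g3)
      = inverse (of_nat (card (sym_group N))) * (\<Sum>\<sigma>\<in>sym_group N. diag_avg N u (g1, g2, g3))"
    by (subst diag_avg_def) (simp add: diag_avg_invariant)
  then show "diag_avg N (diag_avg N u) (g1, g2, g3) = diag_avg N u (g1, g2, g3)"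
    using card_sym_group_nz[of N] by simp
qed

text \<open>The averaging acts from the right and the other factors act from the left in different
  positions, so this is a product of commuting idempotents.\<close>

lemma kron_proj_idem:
  assumes "partition_of N \<alpha>" "partition_of N \<beta>" "partition_of N \<gamma>"
  shows "kron_proj N \<alpha> \<beta> \<gamma> (kron_proj N \<alpha> \<beta> \<gamma> u) = kron_proj N \<alpha> \<beta> \<gamma> u"
proof -
  let ?a = "act1 N (young_idem N \<alpha>)" and ?b = "act2 N (young_idem N \<beta>)" and ?c = "act3 N (young_idem N \<gamma>)"
  have "kron_proj N \<alpha> \<beta> \<gamma> (kron_proj N \<alpha> \<beta> \<gamma> u) = ?a (?b (?c (?a (?b (?c (diag_avg N u))))))"
    by (simp add: kron_proj_def diag_avg_act diag_avg_idem)
  also have "\<dots> = ?a (?a (?b (?b (?c (?c (diag_avg N u))))))"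
    by (simp only: act_commute)
  finally show ?thesis
    using assms by (simp add: act_comp young_idem_idempotent kron_proj_def)
qed

lemma clinear_act: "clinear (act1 N x)" "clinear (act2 N x)" "clinear (act3 N x)" "clinear (diag_avg N)"
  by (rule clinearI; auto simp: act1_def act2_def act3_def diag_avg_def convolve_def
      algebra_simps sum.distrib sum_distrib_left)+

lemma clinear_comp: "clinear f \<Longrightarrow> clinear g \<Longrightarrow> clinear (\<lambda>u. f (g u))"
  using Vector_Spaces.linear_compose[of _ _ g _ f] by (simp add: o_def)

lemma clinear_kron_proj: "clinear (kron_proj N \<alpha> \<beta> \<gamma>)"
  unfolding kron_proj_def[abs_def]
  by (rule clinear_comp[OF clinear_act(1) clinear_comp[OF clinear_act(2)
        clinear_comp[OF clinear_act(3) clinear_act(4)]]])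

lemma act_supported:
  assumes "u \<in> supported_on (sym_group3 N)"
  shows "act1 N x u \<in> supported_on (sym_group3 N)" "act2 N x u \<in> supported_on (sym_group3 N)"
    "act3 N x u \<in> supported_on (sym_group3 N)" "diag_avg N u \<in> supported_on (sym_group3 N)"
  using assms
  by (auto simp: supported_on_def sym_group3_def act1_def act2_def act3_def diag_avg_def convolve_def
      intro!: sum.neutral)

lemma finite_sym_group3 [simp]: "finite (sym_group3 N)"
  by (simp add: sym_group3_def)

lemma convolve_delta_diag:
  assumes "g \<in> sym_group N" "\<sigma> \<in> sym_group N"
  shows "(\<Sum>h\<in>sym_group N. x h * delta g (inv h \<circ> (g \<circ> \<sigma>))) = x (g \<circ> (\<sigma> \<circ> inv g))"
proof -
  have "inv h \<circ> (g \<circ> \<sigma>) = g \<longleftrightarrow> h = g \<circ> (\<sigma> \<circ> inv g)" if h: "h \<in> sym_group N" for h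
  proof
    assume *: "inv h \<circ> (g \<circ> \<sigma>) = g"
    have "h = h \<circ> (g \<circ> inv g)" using assms by simp
    also have "\<dots> = h \<circ> ((inv h \<circ> (g \<circ> \<sigma>)) \<circ> inv g)" by (simp only: *)
    also have "\<dots> = g \<circ> (\<sigma> \<circ> inv g)" using h by (simp add: comp_assoc)
    finally show "h = g \<circ> (\<sigma> \<circ> inv g)" .
  next
    assume *: "h = g \<circ> (\<sigma> \<circ> inv g)"
    have "inv h \<circ> (g \<circ> \<sigma>) = inv h \<circ> (h \<circ> g)" using assms by (simp add: * comp_assoc)
    then show "inv h \<circ> (g \<circ> \<sigma>) = g" using h by simp
  qed
  then have "(\<Sum>h\<in>sym_group N. x h * delta g (inv h \<circ> (g \<circ> \<sigma>)))
      = (\<Sum>h\<in>sym_group N. if h = g \<circ> (\<sigma> \<circ> inv g) then x h else 0)"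
    by (intro sum.cong refl) (simp add: delta_def)
  then show ?thesis using assms by simp
qed

lemma delta_triple: "delta (a, b, c) (a', b', c') = delta a a' * delta b b' * delta c c'"
  by (simp add: delta_def)

lemma sum_prod3:
  fixes f :: "_ \<Rightarrow> 'a::comm_ring_1"
  shows "(\<Sum>a\<in>A. f a) * (\<Sum>b\<in>B. g b) * (\<Sum>c\<in>C. h c) = (\<Sum>a\<in>A. \<Sum>b\<in>B. \<Sum>c\<in>C. f a * g b * h c)"
proof -
  have "(\<Sum>a\<in>A. f a) * (\<Sum>b\<in>B. g b) * (\<Sum>c\<in>C. h c) = (\<Sum>a\<in>A. \<Sum>b\<in>B. f a * g b) * (\<Sum>c\<in>C. h c)"
    by (simp only: sum_product)
  also have "\<dots> = (\<Sum>a\<in>A. \<Sum>b\<in>B. f a * g b * (\<Sum>c\<in>C. h c))" by (simp only: sum_distrib_right)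
  finally show ?thesis by (simp only: sum_distrib_left)
qed

lemma kron_proj_delta:
  assumes "g1 \<in> sym_group N" "g2 \<in> sym_group N" "g3 \<in> sym_group N"
  shows "kron_proj N \<alpha> \<beta> \<gamma> (delta (g1, g2, g3)) (g1, g2, g3) = inverse (of_nat (card (sym_group N))) *
    (\<Sum>\<sigma>\<in>sym_group N. young_idem N \<alpha> (g1 \<circ> (\<sigma> \<circ> inv g1)) * young_idem N \<beta> (g2 \<circ> (\<sigma> \<circ> inv g2))
       * young_idem N \<gamma> (g3 \<circ> (\<sigma> \<circ> inv g3)))"
proof -
  let ?x = "young_idem N \<alpha>" and ?y = "young_idem N \<beta>" and ?z = "young_idem N \<gamma>"
  have "kron_proj N \<alpha> \<beta> \<gamma> u = diag_avg N (act1 N ?x (act2 N ?y (act3 N ?z u)))" for u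
    by (simp add: kron_proj_def diag_avg_act)
  then have "kron_proj N \<alpha> \<beta> \<gamma> (delta (g1, g2, g3)) (g1, g2, g3) = inverse (of_nat (card (sym_group N))) *
    (\<Sum>\<sigma>\<in>sym_group N. act1 N ?x (act2 N ?y (act3 N ?z (delta (g1, g2, g3)))) (g1 \<circ> \<sigma>, g2 \<circ> \<sigma>, g3 \<circ> \<sigma>))"
    by (simp add: diag_avg_def)
  also have "(\<Sum>\<sigma>\<in>sym_group N. act1 N ?x (act2 N ?y (act3 N ?z (delta (g1, g2, g3)))) (g1 \<circ> \<sigma>, g2 \<circ> \<sigma>, g3 \<circ> \<sigma>))
     = (\<Sum>\<sigma>\<in>sym_group N. ?x (g1 \<circ> (\<sigma> \<circ> inv g1)) * ?y (g2 \<circ> (\<sigma> \<circ> inv g2)) * ?z (g3 \<circ> (\<sigma> \<circ> inv g3)))"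
  proof (rule sum.cong[OF refl])
    fix \<sigma> assume \<sigma>: "\<sigma> \<in> sym_group N"
    have "act1 N ?x (act2 N ?y (act3 N ?z (delta (g1, g2, g3)))) (g1 \<circ> \<sigma>, g2 \<circ> \<sigma>, g3 \<circ> \<sigma>)
      = (\<Sum>h1\<in>sym_group N. ?x h1 * delta g1 (inv h1 \<circ> (g1 \<circ> \<sigma>)))
        * (\<Sum>h2\<in>sym_group N. ?y h2 * delta g2 (inv h2 \<circ> (g2 \<circ> \<sigma>)))
        * (\<Sum>h3\<in>sym_group N. ?z h3 * delta g3 (inv h3 \<circ> (g3 \<circ> \<sigma>)))"
      unfolding act1_def act2_def act3_def convolve_def prod.case delta_triple sum_prod3
      unfolding sum_distrib_left
      by (intro sum.cong refl) (simp add: mult_ac)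
    then show "act1 N ?x (act2 N ?y (act3 N ?z (delta (g1, g2, g3)))) (g1 \<circ> \<sigma>, g2 \<circ> \<sigma>, g3 \<circ> \<sigma>)
      = ?x (g1 \<circ> (\<sigma> \<circ> inv g1)) * ?y (g2 \<circ> (\<sigma> \<circ> inv g2)) * ?z (g3 \<circ> (\<sigma> \<circ> inv g3))"
      using assms \<sigma> by (simp only: convolve_delta_diag)
  qed
  finally show ?thesis .
qed

lemma class_sum_inv_conj: "(\<Sum>g\<in>sym_group N. x (g \<circ> (\<sigma> \<circ> inv g))) = class_sum N x \<sigma>"
  unfolding class_sum_def by (subst sum_sym_group_inv[symmetric]) simp

lemma sum_rotate4:
  "(\<Sum>a\<in>A. \<Sum>b\<in>B. \<Sum>c\<in>C. \<Sum>d\<in>D. f a b c d) = (\<Sum>d\<in>D. \<Sum>a\<in>A. \<Sum>b\<in>B. \<Sum>c\<in>C. f a b c d)"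
proof -
  have "(\<Sum>a\<in>A. \<Sum>b\<in>B. \<Sum>c\<in>C. \<Sum>d\<in>D. f a b c d) = (\<Sum>a\<in>A. \<Sum>b\<in>B. \<Sum>d\<in>D. \<Sum>c\<in>C. f a b c d)"
    by (rule sum.cong[OF refl], rule sum.cong[OF refl], rule sum.swap)
  also have "\<dots> = (\<Sum>a\<in>A. \<Sum>d\<in>D. \<Sum>b\<in>B. \<Sum>c\<in>C. f a b c d)"
    by (rule sum.cong[OF refl], rule sum.swap)
  also have "\<dots> = (\<Sum>d\<in>D. \<Sum>a\<in>A. \<Sum>b\<in>B. \<Sum>c\<in>C. f a b c d)"
    by (rule sum.swap)
  finally show ?thesis .
qed

text \<open>The rank of an idempotent is its trace. In the diagonal entry at (g1, g2, g3) the three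
  Young idempotents are evaluated at conjugates of one \<sigma>, and summing over g1, g2, g3
  independently turns them into class sums, that is characters.\<close>

lemma dim_kron_proj:
  assumes \<alpha>: "partition_of N \<alpha>" and \<beta>: "partition_of N \<beta>" and \<gamma>: "partition_of N \<gamma>"
  shows "of_nat (cfun.dim (kron_proj N \<alpha> \<beta> \<gamma> ` supported_on (sym_group3 N))) * of_nat (card (sym_group N))
    = (\<Sum>\<sigma>\<in>sym_group N. irr_character N \<alpha> \<sigma> * irr_character N \<beta> \<sigma> * irr_character N \<gamma> \<sigma>)"
proof -
  let ?T = "kron_proj N \<alpha> \<beta> \<gamma>" and ?X = "sym_group3 N" and ?G = "sym_group N"
  let ?x = "young_idem N \<alpha>" and ?y = "young_idem N \<beta>" and ?z = "young_idem N \<gamma>"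
  have id: "clinear (\<lambda>u::perm3 \<Rightarrow> complex. u)" by (rule clinearI) auto
  have "of_nat (cfun.dim (?T ` supported_on ?X)) = (\<Sum>x\<in>?X. ?T (delta x) x)"
    by (rule trace_on_projection(2)[OF finite_sym_group3 clinear_kron_proj id refl])
      (auto simp: kron_proj_def[of N \<alpha> \<beta> \<gamma>] intro!: act_supported,
       auto simp: kron_proj_def[symmetric] kron_proj_idem \<alpha> \<beta> \<gamma>)
  also have "\<dots> = (\<Sum>g1\<in>?G. \<Sum>g2\<in>?G. \<Sum>g3\<in>?G. ?T (delta (g1, g2, g3)) (g1, g2, g3))"
    by (simp add: sym_group3_def sum.cartesian_product case_prod_beta)
  also have "\<dots> = (\<Sum>g1\<in>?G. \<Sum>g2\<in>?G. \<Sum>g3\<in>?G. inverse (of_nat (card ?G)) *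
      (\<Sum>\<sigma>\<in>?G. ?x (g1 \<circ> (\<sigma> \<circ> inv g1)) * ?y (g2 \<circ> (\<sigma> \<circ> inv g2)) * ?z (g3 \<circ> (\<sigma> \<circ> inv g3))))"
    by (intro sum.cong refl) (simp add: kron_proj_delta)
  also have "\<dots> = inverse (of_nat (card ?G)) * (\<Sum>g1\<in>?G. \<Sum>g2\<in>?G. \<Sum>g3\<in>?G.
      \<Sum>\<sigma>\<in>?G. ?x (g1 \<circ> (\<sigma> \<circ> inv g1)) * ?y (g2 \<circ> (\<sigma> \<circ> inv g2)) * ?z (g3 \<circ> (\<sigma> \<circ> inv g3)))"
    by (simp add: sum_distrib_left)
  also have "(\<Sum>g1\<in>?G. \<Sum>g2\<in>?G. \<Sum>g3\<in>?G.
      \<Sum>\<sigma>\<in>?G. ?x (g1 \<circ> (\<sigma> \<circ> inv g1)) * ?y (g2 \<circ> (\<sigma> \<circ> inv g2)) * ?z (g3 \<circ> (\<sigma> \<circ> inv g3)))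
     = (\<Sum>\<sigma>\<in>?G. \<Sum>g1\<in>?G. \<Sum>g2\<in>?G. \<Sum>g3\<in>?G.
         ?x (g1 \<circ> (\<sigma> \<circ> inv g1)) * ?y (g2 \<circ> (\<sigma> \<circ> inv g2)) * ?z (g3 \<circ> (\<sigma> \<circ> inv g3)))"
    by (rule sum_rotate4)
  also have "\<dots> = (\<Sum>\<sigma>\<in>?G. class_sum N ?x \<sigma> * class_sum N ?y \<sigma> * class_sum N ?z \<sigma>)"
    unfolding class_sum_inv_conj[symmetric] sum_prod3 by (rule refl)
  also have "\<dots> = (\<Sum>\<sigma>\<in>?G. irr_character N \<alpha> \<sigma> * irr_character N \<beta> \<sigma> * irr_character N \<gamma> \<sigma>)"
    by (intro sum.cong refl) (simp add: irr_character_eq \<alpha> \<beta> \<gamma>)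
  finally show ?thesis using card_sym_group_nz[of N] by simp
qed

lemma kronecker_eq_dim:
  assumes \<alpha>: "partition_of N \<alpha>" and \<beta>: "partition_of N \<beta>" and \<gamma>: "partition_of N \<gamma>"
  shows "kronecker N \<alpha> \<beta> \<gamma> = cfun.dim (kron_proj N \<alpha> \<beta> \<gamma> ` supported_on (sym_group3 N))"
proof -
  have "kronecker N \<alpha> \<beta> = (\<lambda>\<gamma>. if partition_of N \<gamma>
      then cfun.dim (kron_proj N \<alpha> \<beta> \<gamma> ` supported_on (sym_group3 N)) else 0)"
    by (rule kronecker_eqI[OF \<alpha> \<beta>]) (simp_all add: dim_kron_proj \<alpha> \<beta>)
  then show ?thesis using \<gamma> by simp
qed

section \<open>Highest weight polynomials\<close>

type_synonym point = "nat \<times> nat \<times> nat \<Rightarrow> complex"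

definition column_perms :: "'s set \<Rightarrow> ('s \<Rightarrow> nat) \<Rightarrow> ('s \<Rightarrow> 's) set" where
  "column_perms S \<kappa> = {q. q permutes S \<and> (\<forall>s\<in>S. \<kappa> (q s) = \<kappa> s)}"

definition alt_sum :: "'s set \<Rightarrow> ('s \<Rightarrow> nat) \<Rightarrow> (('s \<Rightarrow> 's) \<Rightarrow> complex) \<Rightarrow> complex" where
  "alt_sum S \<kappa> F = (\<Sum>q\<in>column_perms S \<kappa>. of_int (sign q) * F q)"

text \<open>A monomial with one coordinate per entry, antisymmetrised along the columns of each of
  three fillings. The set S is a parameter because a filling will be split into the old entries and
  those of a new column.\<close>

definition alt_poly :: "'s set \<Rightarrow> ('s \<Rightarrow> nat) \<Rightarrow> ('s \<Rightarrow> nat) \<Rightarrow> ('s \<Rightarrow> nat) \<Rightarrow> ('s \<Rightarrow> nat)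
    \<Rightarrow> ('s \<Rightarrow> nat) \<Rightarrow> ('s \<Rightarrow> nat) \<Rightarrow> point \<Rightarrow> complex" where
  "alt_poly S \<rho>1 \<kappa>1 \<rho>2 \<kappa>2 \<rho>3 \<kappa>3 = (\<lambda>x.
     alt_sum S \<kappa>1 (\<lambda>q1. alt_sum S \<kappa>2 (\<lambda>q2. alt_sum S \<kappa>3 (\<lambda>q3.
       \<Prod>s\<in>S. x (\<rho>1 (q1 s), \<rho>2 (q2 s), \<rho>3 (q3 s))))))"

text \<open>
  These polynomials span the highest weight vectors of weight \<open>(\<alpha>, \<beta>, \<gamma>)\<close>.
\<close>
definition hw_polys :: "nat \<Rightarrow> (nat \<Rightarrow> nat) \<Rightarrow> (nat \<Rightarrow> nat) \<Rightarrow> (nat \<Rightarrow> nat) \<Rightarrow> (point \<Rightarrow> complex) set" where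
  "hw_polys N \<alpha> \<beta> \<gamma> = {alt_poly {..<N} \<rho>1 \<kappa>1 \<rho>2 \<kappa>2 \<rho>3 \<kappa>3 | \<rho>1 \<kappa>1 \<rho>2 \<kappa>2 \<rho>3 \<kappa>3.
     labelling {..<N} \<alpha> \<rho>1 \<kappa>1 \<and> labelling {..<N} \<beta> \<rho>2 \<kappa>2 \<and> labelling {..<N} \<gamma> \<rho>3 \<kappa>3}"

text \<open>Bilinear, without complex conjugation, so that left multiplications can be moved over to
  the monomials.\<close>

definition pairing :: "nat \<Rightarrow> (perm3 \<Rightarrow> complex) \<Rightarrow> (perm3 \<Rightarrow> complex) \<Rightarrow> complex" where
  "pairing N u w = (\<Sum>g1\<in>sym_group N. \<Sum>g2\<in>sym_group N. \<Sum>g3\<in>sym_group N. u (g1, g2, g3) * w (g1, g2, g3))"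

text \<open>Forgetting the columns identifies triples that differ by row permutations on the left:
  symmetrisation over rows is built in.\<close>

definition row_monomial :: "nat \<Rightarrow> (nat \<Rightarrow> nat) \<Rightarrow> (nat \<Rightarrow> nat) \<Rightarrow> (nat \<Rightarrow> nat) \<Rightarrow> perm3 \<Rightarrow> point \<Rightarrow> complex" where
  "row_monomial N \<alpha> \<beta> \<gamma> = (\<lambda>(g1, g2, g3) x. \<Prod>s<N. x (trow \<alpha> (g1 s), trow \<beta> (g2 s), trow \<gamma> (g3 s)))"

definition to_poly :: "nat \<Rightarrow> (nat \<Rightarrow> nat) \<Rightarrow> (nat \<Rightarrow> nat) \<Rightarrow> (nat \<Rightarrow> nat) \<Rightarrow> (perm3 \<Rightarrow> complex) \<Rightarrow> point \<Rightarrow> complex" where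
  "to_poly N \<alpha> \<beta> \<gamma> u = (\<lambda>x. pairing N u (\<lambda>g. row_monomial N \<alpha> \<beta> \<gamma> g x))"

section \<open>Effect of the factors of \<open>kron_proj\<close> on the associated
  polynomials\<close>

lemma convolve_adjoint:
  "(\<Sum>g\<in>sym_group N. convolve N x z g * w g) = (\<Sum>g\<in>sym_group N. z g * (\<Sum>h\<in>sym_group N. x h * w (h \<circ> g)))"
proof -
  have "(\<Sum>g\<in>sym_group N. convolve N x z g * w g)
      = (\<Sum>h\<in>sym_group N. \<Sum>g\<in>sym_group N. x h * z (inv h \<circ> g) * w g)"
    unfolding convolve_def sum_distrib_right by (rule sum.swap)
  also have "\<dots> = (\<Sum>h\<in>sym_group N. \<Sum>g\<in>sym_group N. x h * z g * w (h \<circ> g))"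
  proof (rule sum.cong[OF refl])
    fix h assume h: "h \<in> sym_group N"
    have "(\<Sum>g\<in>sym_group N. x h * z (inv h \<circ> g) * w g) = (\<Sum>g\<in>sym_group N. x h * z (inv h \<circ> (h \<circ> g)) * w (h \<circ> g))"
      by (rule sum_sym_group_left[OF h, symmetric])
    then show "(\<Sum>g\<in>sym_group N. x h * z (inv h \<circ> g) * w g) = (\<Sum>g\<in>sym_group N. x h * z g * w (h \<circ> g))"
      using h by simp
  qed
  also have "\<dots> = (\<Sum>g\<in>sym_group N. \<Sum>h\<in>sym_group N. z g * (x h * w (h \<circ> g)))"
    by (subst sum.swap) (simp add: mult_ac)
  finally show ?thesis by (simp add: sum_distrib_left)
qed

lemma pairing_act3:
  "pairing N (act3 N x u) w = pairing N u (\<lambda>(g1, g2, g3). \<Sum>h\<in>sym_group N. x h * w (g1, g2, h \<circ> g3))"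
  unfolding pairing_def act3_def prod.case convolve_adjoint by (rule refl)

lemma pairing_act2:
  "pairing N (act2 N x u) w = pairing N u (\<lambda>(g1, g2, g3). \<Sum>h\<in>sym_group N. x h * w (g1, h \<circ> g2, g3))"
proof -
  have *: "(\<Sum>b\<in>sym_group N. \<Sum>c\<in>sym_group N. act2 N x u (a, b, c) * w (a, b, c))
     = (\<Sum>b\<in>sym_group N. \<Sum>c\<in>sym_group N. u (a, b, c) * (\<Sum>h\<in>sym_group N. x h * w (a, h \<circ> b, c)))" for a
    unfolding act2_def prod.case
    by (rule trans[OF sum.swap], rule trans[OF _ sum.swap], rule sum.cong[OF refl], rule convolve_adjoint)
  show ?thesis unfolding pairing_def prod.case * by (rule refl)
qed

lemma pairing_act1:
  "pairing N (act1 N x u) w = pairing N u (\<lambda>(g1, g2, g3). \<Sum>h\<in>sym_group N. x h * w (h \<circ> g1, g2, g3))"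
proof -
  have rot: "(\<Sum>a\<in>sym_group N. \<Sum>b\<in>sym_group N. \<Sum>c\<in>sym_group N. f a b c)
     = (\<Sum>b\<in>sym_group N. \<Sum>c\<in>sym_group N. \<Sum>a\<in>sym_group N. f a b c)"
    for f :: "(nat \<Rightarrow> nat) \<Rightarrow> (nat \<Rightarrow> nat) \<Rightarrow> (nat \<Rightarrow> nat) \<Rightarrow> complex"
    by (rule trans[OF sum.swap], rule sum.cong[OF refl], rule sum.swap)
  show ?thesis
    unfolding pairing_def act1_def prod.case
    by (rule trans[OF rot], rule trans[OF _ rot[symmetric]], rule sum.cong[OF refl], rule sum.cong[OF refl], rule convolve_adjoint)
qed

lemma pairing_cong:
  "(\<And>g1 g2 g3. g1 \<in> sym_group N \<Longrightarrow> g2 \<in> sym_group N \<Longrightarrow> g3 \<in> sym_group N \<Longrightarrow> w (g1, g2, g3) = w' (g1, g2, g3))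
    \<Longrightarrow> pairing N u w = pairing N u w'"
  unfolding pairing_def by (intro sum.cong refl) simp

lemma pairing_scale: "pairing N u (\<lambda>g. c * w g) = c * pairing N u w"
  unfolding pairing_def sum_distrib_left by (simp only: mult.left_commute)

lemma pairing_scale_left: "pairing N (\<lambda>g. c * u g) w = c * pairing N u w"
  unfolding pairing_def sum_distrib_left by (simp only: mult.assoc)

lemma clinear_to_poly: "clinear (to_poly N \<alpha> \<beta> \<gamma>)"
  by (rule clinearI) (simp_all add: to_poly_def pairing_def algebra_simps sum.distrib sum_distrib_left)

lemma row_monomial_row_group:
  assumes "partition_of N \<alpha>" "partition_of N \<beta>" "partition_of N \<gamma>"
    and "g1 \<in> sym_group N" "g2 \<in> sym_group N" "g3 \<in> sym_group N"
  shows "h \<in> row_group N \<alpha> \<Longrightarrow> row_monomial N \<alpha> \<beta> \<gamma> (h \<circ> g1, g2, g3) = row_monomial N \<alpha> \<beta> \<gamma> (g1, g2, g3)"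
    "h \<in> row_group N \<beta> \<Longrightarrow> row_monomial N \<alpha> \<beta> \<gamma> (g1, h \<circ> g2, g3) = row_monomial N \<alpha> \<beta> \<gamma> (g1, g2, g3)"
    "h \<in> row_group N \<gamma> \<Longrightarrow> row_monomial N \<alpha> \<beta> \<gamma> (g1, g2, h \<circ> g3) = row_monomial N \<alpha> \<beta> \<gamma> (g1, g2, g3)"
  using assms by (auto simp: row_monomial_def row_group_eq fun_eq_iff sym_group_less intro!: prod.cong)

lemma sum_row_sum:
  assumes "\<And>h. h \<in> row_group N \<alpha> \<Longrightarrow> f h = c"
  shows "(\<Sum>h\<in>sym_group N. row_sum N \<alpha> h * f h) = of_nat (card (row_group N \<alpha>)) * c"
proof -
  have "(\<Sum>h\<in>sym_group N. row_sum N \<alpha> h * f h) = (\<Sum>h\<in>sym_group N. if h \<in> row_group N \<alpha> then c else 0)"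
    by (intro sum.cong refl) (use assms in \<open>auto simp: row_sum_def\<close>)
  then show ?thesis using row_group_subset[of N \<alpha>] by (simp add: sum.If_cases Int_absorb1)
qed

lemma act_scale:
  "act1 N (\<lambda>g. c * x g) u = (\<lambda>g. c * act1 N x u g)"
  "act2 N (\<lambda>g. c * x g) u = (\<lambda>g. c * act2 N x u g)"
  "act3 N (\<lambda>g. c * x g) u = (\<lambda>g. c * act3 N x u g)"
  by (simp_all add: act1_def act2_def act3_def convolve_scale fun_eq_iff)

lemma to_poly_scale: "to_poly N \<alpha> \<beta> \<gamma> (\<lambda>g. c * u g) = (\<lambda>x. c * to_poly N \<alpha> \<beta> \<gamma> u x)"
  by (simp add: to_poly_def pairing_scale_left)

lemma sum_sym_group_right3:
  assumes "\<sigma> \<in> sym_group N"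
  shows "(\<Sum>a\<in>sym_group N. \<Sum>b\<in>sym_group N. \<Sum>c\<in>sym_group N. f (a \<circ> \<sigma>) (b \<circ> \<sigma>) (c \<circ> \<sigma>))
    = (\<Sum>a\<in>sym_group N. \<Sum>b\<in>sym_group N. \<Sum>c\<in>sym_group N. f a b c)"
proof -
  have "(\<Sum>a\<in>sym_group N. \<Sum>b\<in>sym_group N. \<Sum>c\<in>sym_group N. f (a \<circ> \<sigma>) (b \<circ> \<sigma>) (c \<circ> \<sigma>))
    = (\<Sum>a\<in>sym_group N. \<Sum>b\<in>sym_group N. \<Sum>c\<in>sym_group N. f (a \<circ> \<sigma>) (b \<circ> \<sigma>) c)"
    by (rule sum.cong[OF refl], rule sum.cong[OF refl], rule sum_sym_group_right[OF assms])
  also have "\<dots> = (\<Sum>a\<in>sym_group N. \<Sum>b\<in>sym_group N. \<Sum>c\<in>sym_group N. f (a \<circ> \<sigma>) b c)"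
    by (rule sum.cong[OF refl], rule sum_sym_group_right[OF assms])
  also have "\<dots> = (\<Sum>a\<in>sym_group N. \<Sum>b\<in>sym_group N. \<Sum>c\<in>sym_group N. f a b c)"
    by (rule sum_sym_group_right[OF assms])
  finally show ?thesis .
qed

context
  fixes N \<alpha> \<beta> \<gamma>
  assumes \<alpha>: "partition_of N \<alpha>" and \<beta>: "partition_of N \<beta>" and \<gamma>: "partition_of N \<gamma>"
begin

text \<open>Once moved over to the monomials, each row permutation acts trivially, so the row sum
  acts as the order of its group.\<close>

lemma to_poly_row_sum:
  "to_poly N \<alpha> \<beta> \<gamma> (act1 N (row_sum N \<alpha>) u) = (\<lambda>x. of_nat (card (row_group N \<alpha>)) * to_poly N \<alpha> \<beta> \<gamma> u x)"
  "to_poly N \<alpha> \<beta> \<gamma> (act2 N (row_sum N \<beta>) u) = (\<lambda>x. of_nat (card (row_group N \<beta>)) * to_poly N \<alpha> \<beta> \<gamma> u x)"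
  "to_poly N \<alpha> \<beta> \<gamma> (act3 N (row_sum N \<gamma>) u) = (\<lambda>x. of_nat (card (row_group N \<gamma>)) * to_poly N \<alpha> \<beta> \<gamma> u x)"
  unfolding to_poly_def pairing_act1 pairing_act2 pairing_act3 pairing_scale[symmetric]
  by (rule ext, rule pairing_cong, simp only: prod.case, rule sum_row_sum,
      simp add: row_monomial_row_group[OF \<alpha> \<beta> \<gamma>])+

text \<open>The row factor of the symmetrizer collapses to the order of the row group and only the
  column sum is left. The constant is that order divided by \<open>young_scalar\<close>.\<close>

lemma to_poly_young_idem:
  "\<exists>c\<noteq>0. \<forall>u. to_poly N \<alpha> \<beta> \<gamma> (act1 N (young_idem N \<alpha>) u) = (\<lambda>x. c * to_poly N \<alpha> \<beta> \<gamma> (act1 N (column_sum N \<alpha>) u) x)"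
  "\<exists>c\<noteq>0. \<forall>u. to_poly N \<alpha> \<beta> \<gamma> (act2 N (young_idem N \<beta>) u) = (\<lambda>x. c * to_poly N \<alpha> \<beta> \<gamma> (act2 N (column_sum N \<beta>) u) x)"
  "\<exists>c\<noteq>0. \<forall>u. to_poly N \<alpha> \<beta> \<gamma> (act3 N (young_idem N \<gamma>) u) = (\<lambda>x. c * to_poly N \<alpha> \<beta> \<gamma> (act3 N (column_sum N \<gamma>) u) x)"
proof -
  have "inverse (young_scalar N \<alpha>) * of_nat (card (row_group N \<alpha>)) \<noteq> 0"
    using young_scalar(1)[OF \<alpha>] row_sum_card_nz[OF \<alpha>] by simp
  then show "\<exists>c\<noteq>0. \<forall>u. to_poly N \<alpha> \<beta> \<gamma> (act1 N (young_idem N \<alpha>) u) = (\<lambda>x. c * to_poly N \<alpha> \<beta> \<gamma> (act1 N (column_sum N \<alpha>) u) x)"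
    unfolding young_idem_def young_symmetrizer_eq act_scale to_poly_scale act_comp[symmetric] to_poly_row_sum
      mult.assoc[symmetric] by blast
  have "inverse (young_scalar N \<beta>) * of_nat (card (row_group N \<beta>)) \<noteq> 0"
    using young_scalar(1)[OF \<beta>] row_sum_card_nz[OF \<beta>] by simp
  then show "\<exists>c\<noteq>0. \<forall>u. to_poly N \<alpha> \<beta> \<gamma> (act2 N (young_idem N \<beta>) u) = (\<lambda>x. c * to_poly N \<alpha> \<beta> \<gamma> (act2 N (column_sum N \<beta>) u) x)"
    unfolding young_idem_def young_symmetrizer_eq act_scale to_poly_scale act_comp[symmetric] to_poly_row_sum
      mult.assoc[symmetric] by blast
  have "inverse (young_scalar N \<gamma>) * of_nat (card (row_group N \<gamma>)) \<noteq> 0"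
    using young_scalar(1)[OF \<gamma>] row_sum_card_nz[OF \<gamma>] by simp
  then show "\<exists>c\<noteq>0. \<forall>u. to_poly N \<alpha> \<beta> \<gamma> (act3 N (young_idem N \<gamma>) u) = (\<lambda>x. c * to_poly N \<alpha> \<beta> \<gamma> (act3 N (column_sum N \<gamma>) u) x)"
    unfolding young_idem_def young_symmetrizer_eq act_scale to_poly_scale act_comp[symmetric] to_poly_row_sum
      mult.assoc[symmetric] by blast
qed

lemma row_monomial_diag:
  assumes "\<sigma> \<in> sym_group N"
  shows "row_monomial N \<alpha> \<beta> \<gamma> (g1 \<circ> \<sigma>, g2 \<circ> \<sigma>, g3 \<circ> \<sigma>) = row_monomial N \<alpha> \<beta> \<gamma> (g1, g2, g3)"
proof
  fix x
  have "\<sigma> permutes {..<N}" using assms by (simp add: sym_group_def)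
  from prod.permute[OF this, of "\<lambda>s. x (trow \<alpha> (g1 s), trow \<beta> (g2 s), trow \<gamma> (g3 s))", symmetric]
  show "row_monomial N \<alpha> \<beta> \<gamma> (g1 \<circ> \<sigma>, g2 \<circ> \<sigma>, g3 \<circ> \<sigma>) x = row_monomial N \<alpha> \<beta> \<gamma> (g1, g2, g3) x"
    by (simp add: row_monomial_def o_def)
qed

text \<open>A common right translation of the three permutations merely permutes the factors of the
  monomial.\<close>

lemma to_poly_diag_avg: "to_poly N \<alpha> \<beta> \<gamma> (diag_avg N u) = to_poly N \<alpha> \<beta> \<gamma> u"
proof
  fix x
  let ?w = "\<lambda>g. row_monomial N \<alpha> \<beta> \<gamma> g x" and ?G = "sym_group N"
  have shift: "(\<Sum>a\<in>?G. \<Sum>b\<in>?G. \<Sum>c\<in>?G. u (a \<circ> \<sigma>, b \<circ> \<sigma>, c \<circ> \<sigma>) * ?w (a, b, c)) = pairing N u ?w"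
    if \<sigma>: "\<sigma> \<in> ?G" for \<sigma>
  proof -
    have "(\<Sum>a\<in>?G. \<Sum>b\<in>?G. \<Sum>c\<in>?G. u (a \<circ> \<sigma>, b \<circ> \<sigma>, c \<circ> \<sigma>) * ?w (a, b, c))
      = (\<Sum>a\<in>?G. \<Sum>b\<in>?G. \<Sum>c\<in>?G. u (a \<circ> \<sigma>, b \<circ> \<sigma>, c \<circ> \<sigma>) * ?w (a \<circ> \<sigma>, b \<circ> \<sigma>, c \<circ> \<sigma>))"
      by (simp only: row_monomial_diag[OF \<sigma>])
    also have "\<dots> = (\<Sum>a\<in>?G. \<Sum>b\<in>?G. \<Sum>c\<in>?G. u (a, b, c) * ?w (a, b, c))"
      by (rule sum_sym_group_right3[OF \<sigma>])
    finally show ?thesis by (simp add: pairing_def)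
  qed
  have "pairing N (diag_avg N u) ?w = inverse (of_nat (card ?G)) *
      (\<Sum>a\<in>?G. \<Sum>b\<in>?G. \<Sum>c\<in>?G. \<Sum>\<sigma>\<in>?G. u (a \<circ> \<sigma>, b \<circ> \<sigma>, c \<circ> \<sigma>) * ?w (a, b, c))"
    unfolding pairing_def diag_avg_def prod.case sum_distrib_left sum_distrib_right by (simp only: mult.assoc)
  also have "\<dots> = inverse (of_nat (card ?G)) *
      (\<Sum>\<sigma>\<in>?G. \<Sum>a\<in>?G. \<Sum>b\<in>?G. \<Sum>c\<in>?G. u (a \<circ> \<sigma>, b \<circ> \<sigma>, c \<circ> \<sigma>) * ?w (a, b, c))"
    by (subst sum_rotate4) (rule refl)
  also have "\<dots> = pairing N u ?w"
    using card_sym_group_nz[of N] by (simp add: shift)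
  finally show "to_poly N \<alpha> \<beta> \<gamma> (diag_avg N u) x = to_poly N \<alpha> \<beta> \<gamma> u x" by (simp add: to_poly_def)
qed

text \<open>An idempotent can be traded for a column sum only when it is the outermost operator. As
  the operators commute, each is brought there in turn.\<close>

lemma to_poly_kron_proj:
  "\<exists>c\<noteq>0. \<forall>u. to_poly N \<alpha> \<beta> \<gamma> (kron_proj N \<alpha> \<beta> \<gamma> u) = (\<lambda>x. c *
     to_poly N \<alpha> \<beta> \<gamma> (act1 N (column_sum N \<alpha>) (act2 N (column_sum N \<beta>) (act3 N (column_sum N \<gamma>) u))) x)"
proof -
  let ?F = "to_poly N \<alpha> \<beta> \<gamma>"
  let ?a = "act1 N (young_idem N \<alpha>)" and ?b = "act2 N (young_idem N \<beta>)" and ?c = "act3 N (young_idem N \<gamma>)"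
  let ?a' = "act1 N (column_sum N \<alpha>)" and ?b' = "act2 N (column_sum N \<beta>)" and ?c' = "act3 N (column_sum N \<gamma>)"
  obtain c1 where c1: "c1 \<noteq> 0" "\<And>u. ?F (?a u) = (\<lambda>x. c1 * ?F (?a' u) x)" using to_poly_young_idem(1) by blast
  obtain c2 where c2: "c2 \<noteq> 0" "\<And>u. ?F (?b u) = (\<lambda>x. c2 * ?F (?b' u) x)" using to_poly_young_idem(2) by blast
  obtain c3 where c3: "c3 \<noteq> 0" "\<And>u. ?F (?c u) = (\<lambda>x. c3 * ?F (?c' u) x)" using to_poly_young_idem(3) by blast
  have "?F (kron_proj N \<alpha> \<beta> \<gamma> u) = (\<lambda>x. (c1 * c2 * c3) * ?F (?a' (?b' (?c' u))) x)" for u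
  proof -
    have "?F (kron_proj N \<alpha> \<beta> \<gamma> u) = ?F (diag_avg N (?a (?b (?c u))))"
      by (simp add: kron_proj_def diag_avg_act)
    also have "\<dots> = (\<lambda>x. c1 * ?F (?a' (?b (?c u))) x)" unfolding to_poly_diag_avg by (rule c1)
    also have "?a' (?b (?c u)) = ?b (?a' (?c u))" by (simp only: act_commute)
    also have "?F \<dots> = (\<lambda>x. c2 * ?F (?b' (?a' (?c u))) x)" by (rule c2)
    also have "?b' (?a' (?c u)) = ?c (?a' (?b' u))" by (simp only: act_commute)
    also have "?F \<dots> = (\<lambda>x. c3 * ?F (?c' (?a' (?b' u))) x)" by (rule c3)
    also have "?c' (?a' (?b' u)) = ?a' (?b' (?c' u))" by (simp only: act_commute)
    finally show ?thesis by (simp only: mult.assoc)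
  qed
  moreover have "c1 * c2 * c3 \<noteq> 0" using c1(1) c2(1) c3(1) by simp
  ultimately show ?thesis by blast
qed

end

section \<open>Column sums applied to point masses\<close>

lemma alt_sum_cong:
  "(\<And>q. q \<in> column_perms S \<kappa> \<Longrightarrow> F q = F' q) \<Longrightarrow> alt_sum S \<kappa> F = alt_sum S \<kappa> F'"
  by (simp add: alt_sum_def)

text \<open>Conjugation by m carries the column group of the canonical tableau to the column
  permutations of the filling translated by m, and it preserves signs.\<close>

lemma sum_column_sum:
  assumes \<alpha>: "partition_of N \<alpha>" and m: "m \<in> sym_group N"
  shows "(\<Sum>h\<in>sym_group N. column_sum N \<alpha> h * F (h \<circ> m)) = alt_sum {..<N} (\<lambda>s. tcol \<alpha> (m s)) (\<lambda>q. F (m \<circ> q))"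
proof -
  have "(\<Sum>h\<in>sym_group N. column_sum N \<alpha> h * F (h \<circ> m))
      = (\<Sum>h\<in>column_group N \<alpha>. of_int (sign h) * F (h \<circ> m))"
    by (rule sum.mono_neutral_cong_right) (use column_group_subset in \<open>auto simp: column_sum_def\<close>)
  also have "\<dots> = (\<Sum>q\<in>column_perms {..<N} (\<lambda>s. tcol \<alpha> (m s)). of_int (sign q) * F (m \<circ> q))"
  proof (rule sum.reindex_bij_witness[of _ "\<lambda>q. m \<circ> (q \<circ> inv m)" "\<lambda>h. inv m \<circ> (h \<circ> m)"])
    fix h assume h: "h \<in> column_group N \<alpha>"
    then have hG: "h \<in> sym_group N" using column_group_subset by auto
    show "m \<circ> ((inv m \<circ> (h \<circ> m)) \<circ> inv m) = h" using m by (simp add: comp_assoc)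
    have "inv m \<circ> (h \<circ> m) \<in> sym_group N" using hG m by simp
    then have "inv m \<circ> (h \<circ> m) permutes {..<N}" by (simp add: sym_group_def)
    moreover have "tcol \<alpha> (m ((inv m \<circ> (h \<circ> m)) s)) = tcol \<alpha> (m s)" if "s < N" for s
      using that h m sym_group_less[OF m, of s] by (simp add: column_group_eq[OF \<alpha>])
    ultimately show "inv m \<circ> (h \<circ> m) \<in> column_perms {..<N} (\<lambda>s. tcol \<alpha> (m s))"
      by (simp add: column_perms_def)
    note perm = sym_group_permutation[OF m] sym_group_permutation[OF hG]
    have "sign (inv m \<circ> (h \<circ> m)) = sign m * (sign h * sign m)"
      using perm by (simp only: sign_compose permutation_compose permutation_inverse sign_inverse)
    then have "sign (inv m \<circ> (h \<circ> m)) = sign h" by (simp add: mult.left_commute)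
    then show "of_int (sign (inv m \<circ> (h \<circ> m))) * F (m \<circ> (inv m \<circ> (h \<circ> m))) = of_int (sign h) * F (h \<circ> m)"
      using m by simp
  next
    fix q assume q: "q \<in> column_perms {..<N} (\<lambda>s. tcol \<alpha> (m s))"
    then have qG: "q \<in> sym_group N" by (simp add: column_perms_def sym_group_def)
    show "inv m \<circ> ((m \<circ> (q \<circ> inv m)) \<circ> m) = q" using m by (simp add: comp_assoc)
    have "tcol \<alpha> (m (q (inv m s))) = tcol \<alpha> s" if "s < N" for s
    proof -
      have "inv m s < N" using m that sym_group_less[of "inv m" N s] by simp
      then have "tcol \<alpha> (m (q (inv m s))) = tcol \<alpha> (m (inv m s))" using q by (auto simp: column_perms_def)
      then show ?thesis using m by simp
    qed
    then show "m \<circ> (q \<circ> inv m) \<in> column_group N \<alpha>" using m qG by (simp add: column_group_eq[OF \<alpha>])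
  qed
  finally show ?thesis by (simp add: alt_sum_def)
qed

lemma pairing_delta:
  assumes "m1 \<in> sym_group N" "m2 \<in> sym_group N" "m3 \<in> sym_group N"
  shows "pairing N (delta (m1, m2, m3)) w = w (m1, m2, m3)"
proof -
  have "pairing N (delta (m1, m2, m3)) w = (\<Sum>g\<in>sym_group3 N. if g = (m1, m2, m3) then w g else 0)"
    unfolding pairing_def sum.cartesian_product sym_group3_def
    by (intro sum.cong refl) (auto simp: delta_def split: if_splits)
  then show ?thesis using assms by (simp add: sym_group3_def)
qed

lemma to_poly_column_delta:
  assumes \<alpha>: "partition_of N \<alpha>" and \<beta>: "partition_of N \<beta>" and \<gamma>: "partition_of N \<gamma>"
    and m: "m1 \<in> sym_group N" "m2 \<in> sym_group N" "m3 \<in> sym_group N"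
  shows "to_poly N \<alpha> \<beta> \<gamma> (act1 N (column_sum N \<alpha>) (act2 N (column_sum N \<beta>) (act3 N (column_sum N \<gamma>) (delta (m1, m2, m3)))))
    = alt_poly {..<N} (\<lambda>s. trow \<alpha> (m1 s)) (\<lambda>s. tcol \<alpha> (m1 s)) (\<lambda>s. trow \<beta> (m2 s)) (\<lambda>s. tcol \<beta> (m2 s))
        (\<lambda>s. trow \<gamma> (m3 s)) (\<lambda>s. tcol \<gamma> (m3 s))"
proof
  fix x
  let ?u = "delta (m1, m2, m3)" and ?a = "column_sum N \<alpha>" and ?b = "column_sum N \<beta>" and ?c = "column_sum N \<gamma>"
  let ?w = "\<lambda>g. row_monomial N \<alpha> \<beta> \<gamma> g x"
  have "act1 N ?a (act2 N ?b (act3 N ?c ?u)) = act3 N ?c (act2 N ?b (act1 N ?a ?u))"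
    by (simp only: act_commute)
  then have "to_poly N \<alpha> \<beta> \<gamma> (act1 N ?a (act2 N ?b (act3 N ?c ?u))) x
     = (\<Sum>h1\<in>sym_group N. ?a h1 * (\<Sum>h2\<in>sym_group N. ?b h2 * (\<Sum>h3\<in>sym_group N. ?c h3 * ?w (h1 \<circ> m1, h2 \<circ> m2, h3 \<circ> m3))))"
    by (simp only: to_poly_def pairing_act1 pairing_act2 pairing_act3 pairing_delta[OF m] prod.case)
  also have "\<dots> = alt_sum {..<N} (\<lambda>s. tcol \<alpha> (m1 s)) (\<lambda>q1. alt_sum {..<N} (\<lambda>s. tcol \<beta> (m2 s))
      (\<lambda>q2. alt_sum {..<N} (\<lambda>s. tcol \<gamma> (m3 s)) (\<lambda>q3. ?w (m1 \<circ> q1, m2 \<circ> q2, m3 \<circ> q3))))"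
    by (rule trans[OF sum_column_sum[OF \<alpha> m(1), where F = "\<lambda>g1. (\<Sum>h2\<in>sym_group N. ?b h2 *
            (\<Sum>h3\<in>sym_group N. ?c h3 * ?w (g1, h2 \<circ> m2, h3 \<circ> m3)))"]], rule alt_sum_cong,
        rule trans[OF sum_column_sum[OF \<beta> m(2), where F = "\<lambda>g2.
            (\<Sum>h3\<in>sym_group N. ?c h3 * ?w (m1 \<circ> _, g2, h3 \<circ> m3))"]], rule alt_sum_cong,
        rule sum_column_sum[OF \<gamma> m(3)])
  finally show "to_poly N \<alpha> \<beta> \<gamma> (act1 N ?a (act2 N ?b (act3 N ?c ?u))) x
    = alt_poly {..<N} (\<lambda>s. trow \<alpha> (m1 s)) (\<lambda>s. tcol \<alpha> (m1 s)) (\<lambda>s. trow \<beta> (m2 s)) (\<lambda>s. tcol \<beta> (m2 s))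
        (\<lambda>s. trow \<gamma> (m3 s)) (\<lambda>s. tcol \<gamma> (m3 s)) x"
    by (simp add: alt_poly_def row_monomial_def)
qed

text \<open>
  Dedekind's independence of multiplicative functions; \<open>mul\<close> and \<open>e\<close> need not satisfy any axioms.
\<close>
lemma characters_independent:
  fixes \<chi> :: "'i \<Rightarrow> 'x \<Rightarrow> complex" and e :: 'x and mul :: "'x \<Rightarrow> 'x \<Rightarrow> 'x"
  assumes "finite C"
    and mult: "\<And>i x y. i \<in> C \<Longrightarrow> \<chi> i (mul x y) = \<chi> i x * \<chi> i y" and one: "\<And>i. i \<in> C \<Longrightarrow> \<chi> i e = 1"
    and sep: "\<And>i j. i \<in> C \<Longrightarrow> j \<in> C \<Longrightarrow> i \<noteq> j \<Longrightarrow> \<exists>y. \<chi> i y \<noteq> \<chi> j y"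
    and zero: "\<And>x. (\<Sum>i\<in>C. a i * \<chi> i x) = 0" and "i \<in> C"
  shows "a i = 0"
  using assms
proof (induction C arbitrary: a i rule: finite_induct)
  case (insert k C)
  have aC: "a j = 0" if j: "j \<in> C" for j
  proof -
    obtain y where y: "\<chi> j y \<noteq> \<chi> k y" using insert.prems(3)[of j k] j insert.hyps(2) by auto
    have "a j * (\<chi> j y - \<chi> k y) = 0"
    proof (rule insert.IH[where a = "\<lambda>j. a j * (\<chi> j y - \<chi> k y)"])
      fix x
      \<comment> \<open>Subtracting \<open>\<chi> k y\<close> times the relation at x from the
        relation at \<open>mul y x\<close> cancels the term of k and leaves a relation over
        C.\<close>
      have "(\<Sum>i\<in>insert k C. a i * \<chi> i (mul y x)) - \<chi> k y * (\<Sum>i\<in>insert k C. a i * \<chi> i x) = 0"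
        by (simp only: insert.prems(4)) simp
      moreover have "(\<Sum>i\<in>insert k C. a i * \<chi> i (mul y x)) = (\<Sum>i\<in>insert k C. a i * (\<chi> i y * \<chi> i x))"
        by (intro sum.cong refl) (simp add: insert.prems(1))
      ultimately have "(\<Sum>i\<in>insert k C. a i * (\<chi> i y - \<chi> k y) * \<chi> i x) = 0"
        by (simp add: sum_distrib_left sum_subtractf[symmetric] algebra_simps del: sum.insert)
      then show "(\<Sum>i\<in>C. a i * (\<chi> i y - \<chi> k y) * \<chi> i x) = 0" using insert.hyps by simp
    qed (use insert.prems j in auto)
    then show ?thesis using y by simp
  qed
  have "a k * \<chi> k e = 0" using insert.prems(4)[of e] insert.hyps aC by simp
  then have "a k = 0" using insert.prems(2)[of k] by simp
  then show ?case using insert.prems(5) aC by auto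
qed simp

section \<open>Monomials as multisets of coordinates\<close>

definition row_mset :: "nat \<Rightarrow> (nat \<Rightarrow> nat) \<Rightarrow> (nat \<Rightarrow> nat) \<Rightarrow> (nat \<Rightarrow> nat) \<Rightarrow> perm3 \<Rightarrow> (nat \<times> nat \<times> nat) multiset" where
  "row_mset N \<alpha> \<beta> \<gamma> = (\<lambda>(g1, g2, g3). image_mset (\<lambda>s. (trow \<alpha> (g1 s), trow \<beta> (g2 s), trow \<gamma> (g3 s))) (mset_set {..<N}))"

lemma row_monomial_mset:
  "row_monomial N \<alpha> \<beta> \<gamma> g x = prod_mset (image_mset x (row_mset N \<alpha> \<beta> \<gamma> g))"
  by (cases g) (simp add: row_monomial_def row_mset_def prod_unfold_prod_mset multiset.map_comp o_def)

text \<open>For fixed M the value is multiplicative in the point, so Dedekind's lemma applies. Two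
  multisets with different counts of k are separated by the point that is 2 at k and 1
  elsewhere.\<close>

lemma mset_monomials_independent:
  fixes C :: "'k multiset set"
  assumes "finite C" and "\<And>x::'k \<Rightarrow> complex. (\<Sum>M\<in>C. a M * prod_mset (image_mset x M)) = 0" and "M \<in> C"
  shows "a M = 0"
proof (rule characters_independent[where \<chi> = "\<lambda>M x. prod_mset (image_mset x M)" and C = C and a = a
      and mul = "\<lambda>x y k. x k * y k" and e = "\<lambda>_. 1", OF assms(1) _ _ _ assms(2,3)])
  fix M :: "'k multiset" and x y :: "'k \<Rightarrow> complex"
  show "prod_mset (image_mset (\<lambda>k. x k * y k) M) = prod_mset (image_mset x M) * prod_mset (image_mset y M)"
    by (induction M) (auto simp: mult_ac)
  show "prod_mset (image_mset (\<lambda>k. 1::complex) M) = 1" by (induction M) auto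
next
  fix M M' :: "'k multiset" assume "M \<noteq> M'"
  then obtain k where k: "count M k \<noteq> count M' k" by (meson multiset_eqI)
  have "prod_mset (image_mset (\<lambda>l. if l = k then 2 else 1::complex) M) = 2 ^ count M k" for M :: "'k multiset"
    by (induction M) auto
  moreover have "(2::complex) ^ a \<noteq> 2 ^ b" if "a \<noteq> b" for a b :: nat
  proof
    assume "(2::complex) ^ a = 2 ^ b"
    then have "of_nat (2 ^ a) = (of_nat (2 ^ b) :: complex)" by simp
    then have "(2::nat) ^ a = 2 ^ b" by (simp only: of_nat_eq_iff)
    then show False using that by simp
  qed
  ultimately show "\<exists>y::'k \<Rightarrow> complex. prod_mset (image_mset y M) \<noteq> prod_mset (image_mset y M')"
    using k by metis
qed

lemma cfun_dim_image:
  assumes f: "clinear f" and V: "cfun.subspace V" and inj: "\<And>v. v \<in> V \<Longrightarrow> f v = 0 \<Longrightarrow> v = 0"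
  shows "cfun.dim (f ` V) = cfun.dim V"
proof -
  interpret f: Vector_Spaces.linear "\<lambda>c f x. c * f x" "\<lambda>c f x. c * f x" f by fact
  obtain B where B: "B \<subseteq> V" "cfun.independent B" "V \<subseteq> cfun.span B" "card B = cfun.dim V"
    using cfun.basis_exists[of V] by metis
  have span: "cfun.span B = V" using cfun.span_subspace[OF B(1,3) V] .
  have i: "inj_on f V"
    using f.inj_on_iff_eq_0[OF V] inj by simp
  have ind: "cfun.independent (f ` B)"
    by (rule f.independent_injective_image) (use B span i in auto)
  have "f ` V = cfun.span (f ` B)" using f.span_image[of B] span by simp
  then have "cfun.dim (f ` V) = card (f ` B)" using cfun.dim_span_eq_card_independent[OF ind] by simp
  also have "\<dots> = card B" by (rule card_image) (use i B(1) inj_on_subset in blast)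
  finally show ?thesis using B(4) by simp
qed

section \<open>Injectivity of \<open>to_poly\<close> on the image of
  \<open>kron_proj\<close>\<close>

lemma convolve_left_invariant:
  assumes "partition_of N \<alpha>" "p \<in> row_group N \<alpha>"
  shows "convolve N (young_idem N \<alpha>) z (p \<circ> g) = convolve N (young_idem N \<alpha>) z g"
proof -
  have pG: "p \<in> sym_group N" using assms(2) row_group_subset by auto
  have ip: "inv p \<in> sym_group N" using pG by simp
  have "left_mult (inv p) (row_sum N \<alpha>) = row_sum N \<alpha>"
    using row_sum_mult(1)[OF assms] pG by (simp add: left_mult_def)
  then have "left_mult (inv p) (young_symmetrizer N \<alpha>) = young_symmetrizer N \<alpha>"
    unfolding young_symmetrizer_eq left_mult_convolve[OF ip] by simp
  then have "left_mult (inv p) (young_idem N \<alpha>) = young_idem N \<alpha>"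
    by (simp add: young_idem_def left_mult_def fun_eq_iff)
  then have "left_mult (inv p) (convolve N (young_idem N \<alpha>) z) = convolve N (young_idem N \<alpha>) z"
    unfolding left_mult_convolve[OF ip] by simp
  from fun_cong[OF this, of g] show ?thesis using pG by (simp add: left_mult_def)
qed

lemma kron_proj_invariant:
  assumes \<alpha>: "partition_of N \<alpha>" and \<beta>: "partition_of N \<beta>" and \<gamma>: "partition_of N \<gamma>"
  shows "p \<in> row_group N \<alpha> \<Longrightarrow> kron_proj N \<alpha> \<beta> \<gamma> u (p \<circ> g1, g2, g3) = kron_proj N \<alpha> \<beta> \<gamma> u (g1, g2, g3)"
    "p \<in> row_group N \<beta> \<Longrightarrow> kron_proj N \<alpha> \<beta> \<gamma> u (g1, p \<circ> g2, g3) = kron_proj N \<alpha> \<beta> \<gamma> u (g1, g2, g3)"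
    "p \<in> row_group N \<gamma> \<Longrightarrow> kron_proj N \<alpha> \<beta> \<gamma> u (g1, g2, p \<circ> g3) = kron_proj N \<alpha> \<beta> \<gamma> u (g1, g2, g3)"
    "\<sigma> \<in> sym_group N \<Longrightarrow> kron_proj N \<alpha> \<beta> \<gamma> u (g1 \<circ> \<sigma>, g2 \<circ> \<sigma>, g3 \<circ> \<sigma>) = kron_proj N \<alpha> \<beta> \<gamma> u (g1, g2, g3)"
proof -
  let ?T = "kron_proj N \<alpha> \<beta> \<gamma> u"
  let ?a = "act1 N (young_idem N \<alpha>)" and ?b = "act2 N (young_idem N \<beta>)" and ?c = "act3 N (young_idem N \<gamma>)"
  have T: "?T = ?a (?b (?c (diag_avg N u)))" "?T = ?b (?a (?c (diag_avg N u)))"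
    "?T = ?c (?a (?b (diag_avg N u)))" "?T = diag_avg N (?a (?b (?c u)))"
    unfolding kron_proj_def diag_avg_act by (simp_all only: act_commute)
  show "?T (p \<circ> g1, g2, g3) = ?T (g1, g2, g3)" if "p \<in> row_group N \<alpha>"
    unfolding T(1) by (simp only: act1_def prod.case convolve_left_invariant[OF \<alpha> that])
  show "?T (g1, p \<circ> g2, g3) = ?T (g1, g2, g3)" if "p \<in> row_group N \<beta>"
    unfolding T(2) by (simp only: act2_def prod.case convolve_left_invariant[OF \<beta> that])
  show "?T (g1, g2, p \<circ> g3) = ?T (g1, g2, g3)" if "p \<in> row_group N \<gamma>"
    unfolding T(3) by (simp only: act3_def prod.case convolve_left_invariant[OF \<gamma> that])
  show "?T (g1 \<circ> \<sigma>, g2 \<circ> \<sigma>, g3 \<circ> \<sigma>) = ?T (g1, g2, g3)" if "\<sigma> \<in> sym_group N"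
    unfolding T(4) by (rule diag_avg_invariant[OF that])
qed

lemma row_group_quotient:
  assumes \<alpha>: "partition_of N \<alpha>" and g: "g \<in> sym_group N" "g' \<in> sym_group N"
    and eq: "\<And>s. s < N \<Longrightarrow> trow \<alpha> (g s) = trow \<alpha> (g' s)"
  shows "g \<circ> inv g' \<in> row_group N \<alpha>"
proof -
  have "trow \<alpha> (g (inv g' s)) = trow \<alpha> s" if "s < N" for s
    using eq[of "inv g' s"] that g sym_group_less[of "inv g'" N s] by simp
  then show ?thesis using g by (simp add: row_group_eq[OF \<alpha>])
qed

text \<open>Equal monomials mean that one permutation \<sigma> of the entries matches the row
  indices in all three positions. The triples then differ by \<sigma> on the right and by row
  permutations on the left, and functions in the image are invariant under both.\<close>

lemma kron_proj_row_mset: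
  assumes \<alpha>: "partition_of N \<alpha>" and \<beta>: "partition_of N \<beta>" and \<gamma>: "partition_of N \<gamma>"
    and g: "g \<in> sym_group3 N" "g' \<in> sym_group3 N" and eq: "row_mset N \<alpha> \<beta> \<gamma> g = row_mset N \<alpha> \<beta> \<gamma> g'"
  shows "kron_proj N \<alpha> \<beta> \<gamma> u g = kron_proj N \<alpha> \<beta> \<gamma> u g'"
proof -
  obtain g1 g2 g3 where g1: "g = (g1, g2, g3)" "g1 \<in> sym_group N" "g2 \<in> sym_group N" "g3 \<in> sym_group N"
    using g(1) by (auto simp: sym_group3_def)
  obtain h1 h2 h3 where h1: "g' = (h1, h2, h3)" "h1 \<in> sym_group N" "h2 \<in> sym_group N" "h3 \<in> sym_group N"
    using g(2) by (auto simp: sym_group3_def)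
  have "image_mset (\<lambda>s. (trow \<alpha> (g1 s), trow \<beta> (g2 s), trow \<gamma> (g3 s))) (mset_set {..<N})
    = image_mset (\<lambda>s. (trow \<alpha> (h1 s), trow \<beta> (h2 s), trow \<gamma> (h3 s))) (mset_set {..<N})"
    using eq by (simp add: row_mset_def g1(1) h1(1))
  then obtain \<sigma> where \<sigma>: "\<sigma> permutes {..<N}" and \<sigma>_eq:
    "\<forall>s\<in>{..<N}. (trow \<alpha> (g1 s), trow \<beta> (g2 s), trow \<gamma> (g3 s)) = (trow \<alpha> (h1 (\<sigma> s)), trow \<beta> (h2 (\<sigma> s)), trow \<gamma> (h3 (\<sigma> s)))"
    by (rule image_mset_eq_implies_permutes[OF finite_lessThan])
  have \<sigma>G: "\<sigma> \<in> sym_group N" using \<sigma> by (simp add: sym_group_def)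
  define p1 where "p1 = g1 \<circ> inv (h1 \<circ> \<sigma>)"
  define p2 where "p2 = g2 \<circ> inv (h2 \<circ> \<sigma>)"
  define p3 where "p3 = g3 \<circ> inv (h3 \<circ> \<sigma>)"
  have p: "p1 \<in> row_group N \<alpha>" "p2 \<in> row_group N \<beta>" "p3 \<in> row_group N \<gamma>"
    unfolding p1_def p2_def p3_def
    by (rule row_group_quotient; use \<alpha> \<beta> \<gamma> g1 h1 \<sigma>_eq \<sigma>G in simp)+
  have e: "(g \<circ> inv (h \<circ> \<sigma>)) \<circ> (h \<circ> \<sigma>) = g" if "h \<in> sym_group N" for g h
    using that \<sigma>G sym_group_cancel(2)[of "h \<circ> \<sigma>" N] by (simp only: comp_assoc sym_group_comp) simp
  have "kron_proj N \<alpha> \<beta> \<gamma> u g = kron_proj N \<alpha> \<beta> \<gamma> u (p1 \<circ> (h1 \<circ> \<sigma>), p2 \<circ> (h2 \<circ> \<sigma>), p3 \<circ> (h3 \<circ> \<sigma>))"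
    unfolding p1_def p2_def p3_def by (simp only: e h1 g1)
  also have "\<dots> = kron_proj N \<alpha> \<beta> \<gamma> u (h1 \<circ> \<sigma>, h2 \<circ> \<sigma>, h3 \<circ> \<sigma>)"
    by (simp only: kron_proj_invariant[OF \<alpha> \<beta> \<gamma>] p)
  also have "\<dots> = kron_proj N \<alpha> \<beta> \<gamma> u g'"
    by (simp only: kron_proj_invariant[OF \<alpha> \<beta> \<gamma>] \<sigma>G h1(1))
  finally show ?thesis .
qed

lemma pairing_eq_sum: "pairing N u w = (\<Sum>g\<in>sym_group3 N. u g * w g)"
  unfolding pairing_def sym_group3_def by (simp add: sum.cartesian_product case_prod_beta)

text \<open>A function in the image is constant on the triples with a given monomial, so the
  coefficient of that monomial is its value there times the positive number of these
  triples.\<close>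

lemma to_poly_injective:
  assumes \<alpha>: "partition_of N \<alpha>" and \<beta>: "partition_of N \<beta>" and \<gamma>: "partition_of N \<gamma>"
    and v: "v \<in> kron_proj N \<alpha> \<beta> \<gamma> ` supported_on (sym_group3 N)"
    and zero: "to_poly N \<alpha> \<beta> \<gamma> v = 0"
  shows "v = 0"
proof -
  let ?X = "sym_group3 N" and ?e = "row_mset N \<alpha> \<beta> \<gamma>"
  obtain u where u: "u \<in> supported_on ?X" "v = kron_proj N \<alpha> \<beta> \<gamma> u" using v by blast
  have supp: "v \<in> supported_on ?X" unfolding u(2) kron_proj_def by (intro act_supported u(1))
  have const: "v g = v g'" if "g \<in> ?X" "g' \<in> ?X" "?e g = ?e g'" for g g'
    unfolding u(2) by (rule kron_proj_row_mset[OF \<alpha> \<beta> \<gamma> that])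
  have z: "(\<Sum>M\<in>?e ` ?X. (\<Sum>g\<in>{g\<in>?X. ?e g = M}. v g) * prod_mset (image_mset x M)) = 0" for x
  proof -
    have "0 = to_poly N \<alpha> \<beta> \<gamma> v x" using zero by simp
    also have "\<dots> = (\<Sum>g\<in>?X. v g * prod_mset (image_mset x (?e g)))"
      by (simp add: to_poly_def pairing_eq_sum row_monomial_mset)
    also have "\<dots> = (\<Sum>M\<in>?e ` ?X. \<Sum>g\<in>{g\<in>?X. ?e g = M}. v g * prod_mset (image_mset x (?e g)))"
      by (rule sum.image_gen[OF finite_sym_group3])
    also have "\<dots> = (\<Sum>M\<in>?e ` ?X. (\<Sum>g\<in>{g\<in>?X. ?e g = M}. v g) * prod_mset (image_mset x M))"
      unfolding sum_distrib_right by (intro sum.cong refl) simp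
    finally show ?thesis by simp
  qed
  have "v g = 0" if g: "g \<in> ?X" for g
  proof -
    have "?e g \<in> ?e ` ?X" using g by (rule imageI)
    then have "(\<Sum>h\<in>{h\<in>?X. ?e h = ?e g}. v h) = 0"
      by (rule mset_monomials_independent[where a = "\<lambda>M. \<Sum>h\<in>{h\<in>?X. ?e h = M}. v h", OF _ z, rotated])
        (rule finite_imageI, rule finite_sym_group3)
    moreover have "(\<Sum>h\<in>{h\<in>?X. ?e h = ?e g}. v h) = (\<Sum>h\<in>{h\<in>?X. ?e h = ?e g}. v g)"
    proof (rule sum.cong[OF refl])
      fix h assume "h \<in> {h\<in>?X. ?e h = ?e g}"
      then show "v h = v g" using g by (intro const) auto
    qed
    ultimately have "of_nat (card {h\<in>?X. ?e h = ?e g}) * v g = 0" by simp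
    moreover have "card {h\<in>?X. ?e h = ?e g} \<noteq> 0"
    proof -
      have "g \<in> {h\<in>?X. ?e h = ?e g}" and "finite {h\<in>?X. ?e h = ?e g}" using g by simp_all
      then show ?thesis unfolding card_eq_0_iff by blast
    qed
    ultimately show ?thesis by simp
  qed
  moreover have "v g = 0" if "g \<notin> ?X" for g using supp that unfolding supported_on_def by blast
  ultimately have "v g = 0" for g by blast
  then show ?thesis by (intro ext) simp
qed

lemma column_permsD:
  assumes "q \<in> column_perms S \<kappa>"
  shows "q permutes S" "s \<in> S \<Longrightarrow> \<kappa> (q s) = \<kappa> s" "s \<in> S \<Longrightarrow> q s \<in> S" "s \<notin> S \<Longrightarrow> q s = s"
  using assms permutes_in_image[of q S s] permutes_not_in[of q S s] by (auto simp: column_perms_def)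

text \<open>Only the division of S into columns matters, not their names. This absorbs the shift of
  columns when a new one is inserted.\<close>

lemma column_perms_eqI:
  assumes "\<And>s t. s \<in> S \<Longrightarrow> t \<in> S \<Longrightarrow> \<kappa> s = \<kappa> t \<longleftrightarrow> \<kappa>' s = \<kappa>' t"
  shows "column_perms S \<kappa> = column_perms S \<kappa>'"
  using assms unfolding column_perms_def by (auto simp: permutes_in_image)

lemma alt_poly_cong:
  assumes "\<And>s. s \<in> S \<Longrightarrow> \<rho>1 s = \<rho>1' s" "\<And>s. s \<in> S \<Longrightarrow> \<rho>2 s = \<rho>2' s" "\<And>s. s \<in> S \<Longrightarrow> \<rho>3 s = \<rho>3' s"
    and eq: "column_perms S \<kappa>1 = column_perms S \<kappa>1'" "column_perms S \<kappa>2 = column_perms S \<kappa>2'" "column_perms S \<kappa>3 = column_perms S \<kappa>3'"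
  shows "alt_poly S \<rho>1 \<kappa>1 \<rho>2 \<kappa>2 \<rho>3 \<kappa>3 = alt_poly S \<rho>1' \<kappa>1' \<rho>2' \<kappa>2' \<rho>3' \<kappa>3'"
proof -
  have e: "alt_sum S \<kappa>1 = alt_sum S \<kappa>1'" "alt_sum S \<kappa>2 = alt_sum S \<kappa>2'" "alt_sum S \<kappa>3 = alt_sum S \<kappa>3'"
    using eq by (simp_all add: alt_sum_def fun_eq_iff)
  show ?thesis
    unfolding alt_poly_def e
    by (rule ext, rule alt_sum_cong, rule alt_sum_cong, rule alt_sum_cong, rule prod.cong[OF refl])
      (simp add: assms(1-3) column_permsD(3))
qed

text \<open>Every filling is the canonical one composed with a permutation, so the generators are
  the images of the point masses; in particular there are finitely many.\<close>

lemma hw_polys_eq: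
  assumes \<alpha>: "partition_of N \<alpha>" and \<beta>: "partition_of N \<beta>" and \<gamma>: "partition_of N \<gamma>"
  shows "hw_polys N \<alpha> \<beta> \<gamma> = (\<lambda>m. to_poly N \<alpha> \<beta> \<gamma> (act1 N (column_sum N \<alpha>) (act2 N (column_sum N \<beta>)
     (act3 N (column_sum N \<gamma>) (delta m))))) ` sym_group3 N" (is "?H = ?Q ` _")
proof (intro equalityI subsetI)
  fix F assume "F \<in> ?H"
  then obtain \<rho>1 \<kappa>1 \<rho>2 \<kappa>2 \<rho>3 \<kappa>3 where F: "F = alt_poly {..<N} \<rho>1 \<kappa>1 \<rho>2 \<kappa>2 \<rho>3 \<kappa>3"
    and lab: "labelling {..<N} \<alpha> \<rho>1 \<kappa>1" "labelling {..<N} \<beta> \<rho>2 \<kappa>2" "labelling {..<N} \<gamma> \<rho>3 \<kappa>3"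
    by (auto simp: hw_polys_def)
  obtain m1 where m1: "m1 permutes {..<N}" "\<And>s. s \<in> {..<N} \<Longrightarrow> trow \<alpha> (m1 s) = \<rho>1 s" "\<And>s. s \<in> {..<N} \<Longrightarrow> tcol \<alpha> (m1 s) = \<kappa>1 s"
    using labelling_transport[OF lab(1) labelling_canonical[OF \<alpha>]] by metis
  obtain m2 where m2: "m2 permutes {..<N}" "\<And>s. s \<in> {..<N} \<Longrightarrow> trow \<beta> (m2 s) = \<rho>2 s" "\<And>s. s \<in> {..<N} \<Longrightarrow> tcol \<beta> (m2 s) = \<kappa>2 s"
    using labelling_transport[OF lab(2) labelling_canonical[OF \<beta>]] by metis
  obtain m3 where m3: "m3 permutes {..<N}" "\<And>s. s \<in> {..<N} \<Longrightarrow> trow \<gamma> (m3 s) = \<rho>3 s" "\<And>s. s \<in> {..<N} \<Longrightarrow> tcol \<gamma> (m3 s) = \<kappa>3 s"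
    using labelling_transport[OF lab(3) labelling_canonical[OF \<gamma>]] by metis
  have m: "m1 \<in> sym_group N" "m2 \<in> sym_group N" "m3 \<in> sym_group N" using m1 m2 m3 by (simp_all add: sym_group_def)
  have "?Q (m1, m2, m3) = F"
    unfolding F to_poly_column_delta[OF \<alpha> \<beta> \<gamma> m] by (rule alt_poly_cong; (rule column_perms_eqI)?) (use m1 m2 m3 in auto)
  then show "F \<in> ?Q ` sym_group3 N" using m by (auto simp: sym_group3_def)
next
  fix F assume "F \<in> ?Q ` sym_group3 N"
  then obtain m1 m2 m3 where m: "m1 \<in> sym_group N" "m2 \<in> sym_group N" "m3 \<in> sym_group N" "F = ?Q (m1, m2, m3)"
    by (auto simp: sym_group3_def)
  show "F \<in> ?H"
    unfolding m(4) to_poly_column_delta[OF \<alpha> \<beta> \<gamma> m(1-3)] hw_polys_def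
    using labelling_translate[OF \<alpha> m(1)] labelling_translate[OF \<beta> m(2)] labelling_translate[OF \<gamma> m(3)] by blast
qed

text \<open>\<open>to_poly\<close> is injective on the image of \<open>kron_proj\<close> and so
  preserves its dimension. By \<open>to_poly_kron_proj\<close> it maps that image onto the range of
  Q, the nonzero constant being absorbed into the argument, and Q sends the point masses to the
  generators.\<close>

lemma kronecker_eq_dim_hw_polys:
  assumes \<alpha>: "partition_of N \<alpha>" and \<beta>: "partition_of N \<beta>" and \<gamma>: "partition_of N \<gamma>"
  shows "kronecker N \<alpha> \<beta> \<gamma> = cfun.dim (cfun.span (hw_polys N \<alpha> \<beta> \<gamma>))"
proof -
  let ?F = "to_poly N \<alpha> \<beta> \<gamma>" and ?X = "sym_group3 N"
  let ?V = "kron_proj N \<alpha> \<beta> \<gamma> ` supported_on ?X"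
  define Q where "Q u = ?F (act1 N (column_sum N \<alpha>) (act2 N (column_sum N \<beta>) (act3 N (column_sum N \<gamma>) u)))" for u
  have Q: "clinear Q"
    unfolding Q_def[abs_def]
    by (rule clinear_comp[OF clinear_to_poly clinear_comp[OF clinear_act(1)
          clinear_comp[OF clinear_act(2) clinear_act(3)]]])
  interpret Q: Vector_Spaces.linear "\<lambda>c f x. c * f x" "\<lambda>c f x. c * f x" Q by (rule Q)
  interpret P: Vector_Spaces.linear "\<lambda>c f x. c * f x" "\<lambda>c f x. c * f x" "kron_proj N \<alpha> \<beta> \<gamma>" by (rule clinear_kron_proj)
  obtain c where c: "c \<noteq> 0" "\<And>u. ?F (kron_proj N \<alpha> \<beta> \<gamma> u) = (\<lambda>x. c * Q u x)"
    using to_poly_kron_proj[OF \<alpha> \<beta> \<gamma>] unfolding Q_def by blast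
  have supp: "supported_on ?X = cfun.span (delta ` ?X)"
  proof (rule equalityI)
    show "supported_on ?X \<subseteq> cfun.span (delta ` ?X)" by (rule supported_on_subset_span) simp
    show "cfun.span (delta ` ?X) \<subseteq> supported_on ?X"
      by (rule cfun.span_minimal[OF _ subspace_supported_on]) (auto simp: supported_on_def delta_def)
  qed
  have "?F ` ?V = Q ` supported_on ?X"
  proof (intro equalityI subsetI)
    fix y assume "y \<in> ?F ` ?V"
    then obtain u where u: "u \<in> supported_on ?X" "y = (\<lambda>x. c * Q u x)" using c(2) by auto
    have "y = Q (\<lambda>g. c * u g)" unfolding u(2) by (rule clinear_scale[OF Q, symmetric])
    moreover have "(\<lambda>g. c * u g) \<in> supported_on ?X" using u(1) by (simp add: supported_on_def)
    ultimately show "y \<in> Q ` supported_on ?X" by blast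
  next
    fix y assume "y \<in> Q ` supported_on ?X"
    then obtain u where u: "u \<in> supported_on ?X" "y = Q u" by auto
    have "?F (kron_proj N \<alpha> \<beta> \<gamma> (\<lambda>g. inverse c * u g)) = (\<lambda>x. c * (inverse c * Q u x))"
      unfolding c(2) clinear_scale[OF Q] by (rule refl)
    also have "\<dots> = y" using c(1) u(2) by (simp add: mult.assoc[symmetric])
    finally have "y = ?F (kron_proj N \<alpha> \<beta> \<gamma> (\<lambda>g. inverse c * u g))" by simp
    moreover have "(\<lambda>g. inverse c * u g) \<in> supported_on ?X" using u(1) by (simp add: supported_on_def)
    ultimately show "y \<in> ?F ` ?V" by blast
  qed
  also have "\<dots> = cfun.span (Q ` delta ` ?X)" unfolding supp by (rule Q.span_image[symmetric])
  also have "Q ` delta ` ?X = hw_polys N \<alpha> \<beta> \<gamma>"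
    unfolding hw_polys_eq[OF \<alpha> \<beta> \<gamma>] Q_def image_image by (rule refl)
  finally have "cfun.span (hw_polys N \<alpha> \<beta> \<gamma>) = ?F ` ?V" by simp
  moreover have "cfun.dim (?F ` ?V) = cfun.dim ?V"
    by (rule cfun_dim_image[OF clinear_to_poly])
      (use to_poly_injective[OF \<alpha> \<beta> \<gamma>] P.subspace_image[OF subspace_supported_on] in auto)
  ultimately show ?thesis using kronecker_eq_dim[OF \<alpha> \<beta> \<gamma>] by simp
qed

section \<open>Monotonicity\<close>

lemma cfun_dim_span_le:
  assumes f: "clinear f" and inj: "\<And>v. v \<in> cfun.span A \<Longrightarrow> f v = 0 \<Longrightarrow> v = 0"
    and sub: "\<And>a. a \<in> A \<Longrightarrow> f a \<in> cfun.span B" and fin: "finite B"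
  shows "cfun.dim (cfun.span A) \<le> cfun.dim (cfun.span B)" "cfun.dim (cfun.span A) \<le> card B"
proof -
  interpret f: Vector_Spaces.linear "\<lambda>c f x. c * f x" "\<lambda>c f x. c * f x" f by fact
  obtain C where C: "C \<subseteq> cfun.span A" "cfun.independent C" "cfun.span A \<subseteq> cfun.span C" "card C = cfun.dim (cfun.span A)"
    using cfun.basis_exists[of "cfun.span A"] by metis
  obtain B' where B': "B' \<subseteq> cfun.span B" "cfun.independent B'" "cfun.span B \<subseteq> cfun.span B'" "card B' = cfun.dim (cfun.span B)"
    using cfun.basis_exists[of "cfun.span B"] by metis
  have finB': "finite B'" and card_B': "card B' \<le> card B" using cfun.independent_span_bound[OF fin B'(2) B'(1)] by auto
  have spanC: "cfun.span C = cfun.span A" by (rule cfun.span_subspace[OF C(1,3)]) simp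
  have i: "inj_on f (cfun.span A)"
    using f.inj_on_iff_eq_0[OF cfun.subspace_span] inj by simp
  have ind: "cfun.independent (f ` C)"
    by (rule f.independent_injective_image[OF C(2)]) (use i spanC in simp)
  have "f ` cfun.span A = cfun.span (f ` A)" by (rule f.span_image[symmetric])
  also have "\<dots> \<subseteq> cfun.span B" by (rule cfun.span_minimal) (use sub in auto)
  finally have "f ` C \<subseteq> cfun.span B'" using C(1) B'(3) by blast
  from cfun.independent_span_bound[OF finB' ind this] have "card (f ` C) \<le> card B'" by simp
  moreover have "card (f ` C) = card C" by (rule card_image) (use i C(1) inj_on_subset in blast)
  ultimately show "cfun.dim (cfun.span A) \<le> cfun.dim (cfun.span B)" using C(4) B'(4) by simp
  then show "cfun.dim (cfun.span A) \<le> card B" using card_B' B'(4) by simp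
qed

text \<open>
  All that is needed of polynomials is that their restrictions to lines are polynomials in one variable.
\<close>
definition poly_on_lines :: "(('k \<Rightarrow> complex) \<Rightarrow> complex) \<Rightarrow> bool" where
  "poly_on_lines F \<longleftrightarrow> (\<forall>x d. \<exists>p. \<forall>t. F (\<lambda>k. x k + t * d k) = poly p t)"

lemma poly_on_lines_coord: "poly_on_lines (\<lambda>x. x k)"
  unfolding poly_on_lines_def
proof (intro allI)
  fix x d :: "'a \<Rightarrow> complex"
  show "\<exists>p. \<forall>t. x k + t * d k = poly p t"
    by (rule exI[of _ "[:x k, d k:]"]) simp
qed

lemma poly_on_lines_const: "poly_on_lines (\<lambda>x. c)"
  unfolding poly_on_lines_def by (intro allI exI[of _ "[:c:]"]) simp

lemma poly_on_lines_add:
  assumes "poly_on_lines F" "poly_on_lines G"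
  shows "poly_on_lines (\<lambda>x. F x + G x)"
  unfolding poly_on_lines_def
proof (intro allI)
  fix x d
  obtain p q where "\<And>t. F (\<lambda>k. x k + t * d k) = poly p t" "\<And>t. G (\<lambda>k. x k + t * d k) = poly q t"
    using assms unfolding poly_on_lines_def by metis
  then show "\<exists>p. \<forall>t. F (\<lambda>k. x k + t * d k) + G (\<lambda>k. x k + t * d k) = poly p t"
    by (intro exI[of _ "p + q"]) simp
qed

lemma poly_on_lines_mult:
  assumes "poly_on_lines F" "poly_on_lines G"
  shows "poly_on_lines (\<lambda>x. F x * G x)"
  unfolding poly_on_lines_def
proof (intro allI)
  fix x d
  obtain p q where "\<And>t. F (\<lambda>k. x k + t * d k) = poly p t" "\<And>t. G (\<lambda>k. x k + t * d k) = poly q t"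
    using assms unfolding poly_on_lines_def by metis
  then show "\<exists>p. \<forall>t. F (\<lambda>k. x k + t * d k) * G (\<lambda>k. x k + t * d k) = poly p t"
    by (intro exI[of _ "p * q"]) simp
qed

lemma poly_on_lines_sum: "(\<And>i. i \<in> I \<Longrightarrow> poly_on_lines (F i)) \<Longrightarrow> poly_on_lines (\<lambda>x. \<Sum>i\<in>I. F i x)"
  by (induction I rule: infinite_finite_induct) (auto intro: poly_on_lines_const poly_on_lines_add)

lemma poly_on_lines_prod: "(\<And>i. i \<in> I \<Longrightarrow> poly_on_lines (F i)) \<Longrightarrow> poly_on_lines (\<lambda>x. \<Prod>i\<in>I. F i x)"
  by (induction I rule: infinite_finite_induct) (auto intro: poly_on_lines_const poly_on_lines_mult)

lemma poly_on_lines_alt_sum: "(\<And>q. poly_on_lines (F q)) \<Longrightarrow> poly_on_lines (\<lambda>x. alt_sum S \<kappa> (\<lambda>q. F q x))"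
  unfolding alt_sum_def by (intro poly_on_lines_sum poly_on_lines_mult poly_on_lines_const)

lemma poly_on_lines_alt_poly: "poly_on_lines (alt_poly S \<rho>1 \<kappa>1 \<rho>2 \<kappa>2 \<rho>3 \<kappa>3)"
  unfolding alt_poly_def by (intro poly_on_lines_alt_sum poly_on_lines_prod poly_on_lines_coord)

lemma poly_on_lines_span:
  assumes "F \<in> cfun.span A" "\<And>a. a \<in> A \<Longrightarrow> poly_on_lines a"
  shows "poly_on_lines F"
proof -
  have "cfun.subspace {F. poly_on_lines F}"
    by (rule cfun.subspaceI)
      (auto simp: zero_fun_def plus_fun_def intro: poly_on_lines_const poly_on_lines_add poly_on_lines_mult)
  from cfun.span_minimal[OF _ this, of A] assms show ?thesis by auto
qed

text \<open>Restrict to the line from x at t = 0 to y at t = 1. Polynomials in one variable have no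
  zero divisors, and D does not vanish identically on this line.\<close>

lemma poly_on_lines_mult_eq_0:
  assumes F: "poly_on_lines F" and D: "poly_on_lines D" and y: "D y \<noteq> 0" and FD: "\<And>x. F x * D x = 0"
  shows "F x = 0"
proof -
  obtain p where p: "\<And>t. F (\<lambda>k. x k + t * (y k - x k)) = poly p t"
    using F unfolding poly_on_lines_def by (elim allE[of _ x] allE[of _ "\<lambda>k. y k - x k"]) blast
  obtain q where q: "\<And>t. D (\<lambda>k. x k + t * (y k - x k)) = poly q t"
    using D unfolding poly_on_lines_def by (elim allE[of _ x] allE[of _ "\<lambda>k. y k - x k"]) blast
  have "poly (p * q) t = 0" for t using FD p q by (metis poly_mult)
  then have "p * q = 0" using poly_all_0_iff_0 by blast
  moreover have "poly q 1 \<noteq> 0" using q[of 1] y by simp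
  ultimately have "p = 0" by auto
  then show ?thesis using p[of 0] by simp
qed

section \<open>Splitting an alternation along disjoint sets of columns\<close>

lemma finite_column_perms [simp]: "finite S \<Longrightarrow> finite (column_perms S \<kappa>)"
  by (rule finite_subset[OF _ finite_permutations[of S]]) (auto simp: column_perms_def)

lemma column_perms_restrict:
  assumes p: "p \<in> column_perms (S \<union> T) \<kappa>" and fin: "finite S" and disj: "\<kappa> ` S \<inter> \<kappa> ` T = {}"
  shows "restrict_id p S \<in> column_perms S \<kappa>"
proof -
  have "p ` S \<subseteq> S"
  proof
    fix y assume "y \<in> p ` S"
    then obtain s where s: "s \<in> S" "y = p s" by auto
    then have "p s \<in> S \<union> T" "\<kappa> (p s) = \<kappa> s" using column_permsD(2,3)[OF p, of s] by auto
    then have "p s \<notin> T" using disj s(1) by (metis IntI empty_iff imageI)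
    then show "y \<in> S" using \<open>p s \<in> S \<union> T\<close> s by auto
  qed
  moreover have "inj_on p S" using column_permsD(1)[OF p] permutes_inj_on by blast
  ultimately have "bij_betw p S S" unfolding bij_betw_def using endo_inj_surj[OF fin] by blast
  then have "restrict_id p S permutes S" by (rule permutes_restrict_id)
  then show ?thesis using column_permsD(2)[OF p] by (auto simp: column_perms_def restrict_id_def)
qed

lemma column_perms_comp:
  assumes q: "q \<in> column_perms S \<kappa>" and q': "q' \<in> column_perms T \<kappa>" and disj: "S \<inter> T = {}"
  shows "q \<circ> q' \<in> column_perms (S \<union> T) \<kappa>"
    "s \<in> S \<Longrightarrow> (q \<circ> q') s = q s" "s \<in> T \<Longrightarrow> (q \<circ> q') s = q' s"
proof -
  show 1: "(q \<circ> q') s = q s" if "s \<in> S" for s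
  proof -
    have "s \<notin> T" using that disj by auto
    then show ?thesis using column_permsD(4)[OF q', of s] by simp
  qed
  show 2: "(q \<circ> q') s = q' s" if "s \<in> T" for s
  proof -
    have "q' s \<notin> S" using column_permsD(3)[OF q' that] disj by auto
    then show ?thesis using column_permsD(4)[OF q, of "q' s"] by simp
  qed
  have "q permutes S \<union> T" "q' permutes S \<union> T"
    using column_permsD(1)[OF q] column_permsD(1)[OF q'] permutes_subset by blast+
  then have "q \<circ> q' permutes S \<union> T" by (simp add: permutes_compose)
  moreover have "\<kappa> ((q \<circ> q') s) = \<kappa> s" if "s \<in> S \<union> T" for s
    using that 1 2 column_permsD(2)[OF q] column_permsD(2)[OF q'] by auto
  ultimately show "q \<circ> q' \<in> column_perms (S \<union> T) \<kappa>" by (auto simp: column_perms_def)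
qed

text \<open>S and T share no column, so a column permutation of the union is uniquely a product of
  one on S and one on T, and the signs multiply.\<close>

lemma alt_sum_union:
  assumes fin: "finite S" "finite T" and disj: "\<kappa> ` S \<inter> \<kappa> ` T = {}"
    and F: "\<And>q q'. q \<in> column_perms S \<kappa> \<Longrightarrow> q' \<in> column_perms T \<kappa> \<Longrightarrow> F (q \<circ> q') = A q * B q'"
  shows "alt_sum (S \<union> T) \<kappa> F = alt_sum S \<kappa> A * alt_sum T \<kappa> B"
proof -
  have ST: "S \<inter> T = {}" using disj by auto
  let ?P = "column_perms S \<kappa> \<times> column_perms T \<kappa>"
  have "alt_sum S \<kappa> A * alt_sum T \<kappa> B
      = (\<Sum>(q, q')\<in>?P. (of_int (sign q) * A q) * (of_int (sign q') * B q'))"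
    by (simp add: alt_sum_def sum_product sum.cartesian_product)
  also have "\<dots> = (\<Sum>p\<in>column_perms (S \<union> T) \<kappa>. of_int (sign p) * F p)"
  proof (rule sum.reindex_bij_witness[of _ "\<lambda>p. (restrict_id p S, restrict_id p T)" "\<lambda>(q, q'). q \<circ> q'"])
    fix pr assume "pr \<in> ?P"
    then obtain q q' where pr: "pr = (q, q')" and q: "q \<in> column_perms S \<kappa>" and q': "q' \<in> column_perms T \<kappa>" by auto
    note c = column_perms_comp[OF q q' ST]
    have "restrict_id (q \<circ> q') S = q"
      using c(2) column_permsD(4)[OF q] by (auto simp: restrict_id_def fun_eq_iff)
    moreover have "restrict_id (q \<circ> q') T = q'"
      using c(3) column_permsD(4)[OF q'] by (auto simp: restrict_id_def fun_eq_iff)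
    ultimately show "(restrict_id (case pr of (q, q') \<Rightarrow> q \<circ> q') S, restrict_id (case pr of (q, q') \<Rightarrow> q \<circ> q') T) = pr"
      by (simp add: pr)
    show "(case pr of (q, q') \<Rightarrow> q \<circ> q') \<in> column_perms (S \<union> T) \<kappa>" using c(1) by (simp add: pr)
    have "permutation q" "permutation q'"
      using column_permsD(1)[OF q] column_permsD(1)[OF q'] fin permutation_permutes by blast+
    then have "sign (q \<circ> q') = sign q * sign q'" by (rule sign_compose)
    then show "of_int (sign (case pr of (q, q') \<Rightarrow> q \<circ> q')) * F (case pr of (q, q') \<Rightarrow> q \<circ> q')
       = (case pr of (q, q') \<Rightarrow> (of_int (sign q) * A q) * (of_int (sign q') * B q'))"
      using F[OF q q'] by (simp add: pr mult_ac)
  next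
    fix p assume p: "p \<in> column_perms (S \<union> T) \<kappa>"
    have r: "restrict_id p S \<in> column_perms S \<kappa>" by (rule column_perms_restrict[OF p fin(1) disj])
    have r': "restrict_id p T \<in> column_perms T \<kappa>"
      by (rule column_perms_restrict[of p T S]) (use p fin disj in \<open>auto simp: Un_commute\<close>)
    show "(restrict_id p S, restrict_id p T) \<in> ?P" using r r' by simp
    have "restrict_id p S (restrict_id p T s) = p s" for s
    proof -
      consider "s \<in> S" | "s \<in> T" | "s \<notin> S \<union> T" by auto
      then show ?thesis
      proof cases
        case 1
        then show ?thesis using ST by (auto simp: restrict_id_def)
      next
        case 2
        then have "restrict_id p T s = p s" "p s \<in> T" using column_permsD(3)[OF r', of s] by (auto simp: restrict_id_def)
        then show ?thesis using ST by (auto simp: restrict_id_def)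
      next
        case 3
        then show ?thesis using column_permsD(4)[OF p, of s] by (auto simp: restrict_id_def)
      qed
    qed
    then show "(case (restrict_id p S, restrict_id p T) of (q, q') \<Rightarrow> q \<circ> q') = p" by (simp add: fun_eq_iff)
  qed
  finally show ?thesis by (simp add: alt_sum_def)
qed

lemma alt_poly_union:
  assumes fin: "finite S" "finite T"
    and disj: "\<kappa>1 ` S \<inter> \<kappa>1 ` T = {}" "\<kappa>2 ` S \<inter> \<kappa>2 ` T = {}" "\<kappa>3 ` S \<inter> \<kappa>3 ` T = {}"
  shows "alt_poly (S \<union> T) \<rho>1 \<kappa>1 \<rho>2 \<kappa>2 \<rho>3 \<kappa>3 x = alt_poly S \<rho>1 \<kappa>1 \<rho>2 \<kappa>2 \<rho>3 \<kappa>3 x * alt_poly T \<rho>1 \<kappa>1 \<rho>2 \<kappa>2 \<rho>3 \<kappa>3 x"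
  unfolding alt_poly_def
proof (rule alt_sum_union[OF fin disj(1)], rule alt_sum_union[OF fin disj(2)], rule alt_sum_union[OF fin disj(3)])
  fix q1 q1' q2 q2' q3 q3'
  assume q: "q1 \<in> column_perms S \<kappa>1" "q1' \<in> column_perms T \<kappa>1" "q2 \<in> column_perms S \<kappa>2" "q2' \<in> column_perms T \<kappa>2"
    "q3 \<in> column_perms S \<kappa>3" "q3' \<in> column_perms T \<kappa>3"
  have ST: "S \<inter> T = {}" using disj by auto
  note c = column_perms_comp(2,3)[OF q(1,2) ST] column_perms_comp(2,3)[OF q(3,4) ST] column_perms_comp(2,3)[OF q(5,6) ST]
  have "(\<Prod>s\<in>S \<union> T. x (\<rho>1 ((q1 \<circ> q1') s), \<rho>2 ((q2 \<circ> q2') s), \<rho>3 ((q3 \<circ> q3') s)))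
     = (\<Prod>s\<in>S. x (\<rho>1 ((q1 \<circ> q1') s), \<rho>2 ((q2 \<circ> q2') s), \<rho>3 ((q3 \<circ> q3') s)))
     * (\<Prod>s\<in>T. x (\<rho>1 ((q1 \<circ> q1') s), \<rho>2 ((q2 \<circ> q2') s), \<rho>3 ((q3 \<circ> q3') s)))"
    by (rule prod.union_disjoint[OF fin ST])
  also have "\<dots> = (\<Prod>s\<in>S. x (\<rho>1 (q1 s), \<rho>2 (q2 s), \<rho>3 (q3 s))) * (\<Prod>s\<in>T. x (\<rho>1 (q1' s), \<rho>2 (q2' s), \<rho>3 (q3' s)))"
    by (intro arg_cong2[of _ _ _ _ "(*)"] prod.cong refl) (simp_all only: c)
  finally show "(\<Prod>s\<in>S \<union> T. x (\<rho>1 ((q1 \<circ> q1') s), \<rho>2 ((q2 \<circ> q2') s), \<rho>3 ((q3 \<circ> q3') s)))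
    = (\<Prod>s\<in>S. x (\<rho>1 (q1 s), \<rho>2 (q2 s), \<rho>3 (q3 s))) * (\<Prod>s\<in>T. x (\<rho>1 (q1' s), \<rho>2 (q2' s), \<rho>3 (q3' s)))" .
qed

text \<open>
  The new column of length \<open>k\<close> is inserted at position \<open>\<alpha> (k - 1)\<close>, the first one whose column in
  \<open>\<alpha>\<close> is shorter than \<open>k\<close>.
\<close>
lemma labelling_add_column:
  assumes lab: "labelling {..<N} \<alpha> \<rho> \<kappa>" and anti: "antimono \<alpha>" and k: "k \<ge> 1"
  shows "labelling {..<N + k} (\<alpha> + rect_partition 1 k) (\<lambda>s. if s < N then \<rho> s else s - N)
    (\<lambda>s. if s < N then (if \<kappa> s < \<alpha> (k - 1) then \<kappa> s else Suc (\<kappa> s)) else \<alpha> (k - 1))"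
    (is "labelling _ ?\<alpha> ?\<rho> ?\<kappa>")
proof -
  let ?c = "\<alpha> (k - 1)"
  \<comment> \<open>Columns from \<open>\<alpha> (k - 1)\<close> on move one step to the right,
    which frees that position for the k new boxes; row k in the usual counting has index k -
    1.\<close>
  define sh where "sh = (\<lambda>(i::nat, j). (i, if j < ?c then j else Suc j))"
  have le: "\<alpha> i \<le> ?c" if "i \<ge> k - 1" for i using anti that by (auto simp: antimono_def)
  have ge: "?c \<le> \<alpha> i" if "i < k" for i using anti that by (auto simp: antimono_def)
  have "inj_on sh (diagram \<alpha>)" by (auto simp: inj_on_def sh_def split: if_splits)
  moreover have "sh ` diagram \<alpha> = diagram ?\<alpha> - {(i, ?c) | i. i < k}"
  proof (intro equalityI subsetI)
    fix b assume "b \<in> sh ` diagram \<alpha>"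
    then obtain i j where ij: "j < \<alpha> i" "b = sh (i, j)" by (auto simp: diagram_def)
    show "b \<in> diagram ?\<alpha> - {(i, ?c) | i. i < k}"
    proof (cases "j < ?c")
      case True
      then show ?thesis using ij by (auto simp: sh_def diagram_def)
    next
      case False
      then have "i < k" using le[of i] ij(1) by (metis diff_le_self le_trans linorder_not_less not_less)
      then show ?thesis using ij False by (auto simp: sh_def diagram_def rect_partition_def)
    qed
  next
    fix b assume b: "b \<in> diagram ?\<alpha> - {(i, ?c) | i. i < k}"
    then obtain i j where ij: "b = (i, j)" "j < ?\<alpha> i" "\<not> (i < k \<and> j = ?c)" by (auto simp: diagram_def)
    consider "j < ?c" | "j = ?c" | "j > ?c" by linarith
    then show "b \<in> sh ` diagram \<alpha>"
    proof cases
      case 1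
      then have "j < \<alpha> i" using ij(2) ge[of i] by (cases "i < k") (auto simp: rect_partition_def)
      then show ?thesis using 1 ij by (intro image_eqI[of _ _ "(i, j)"]) (auto simp: sh_def diagram_def)
    next
      case 2
      then have "\<not> i < k" using ij by auto
      then have "\<alpha> i \<le> ?c" by (intro le) simp
      then show ?thesis using ij 2 \<open>\<not> i < k\<close> by (auto simp: rect_partition_def)
    next
      case 3
      have "i < k"
      proof (rule ccontr)
        assume "\<not> i < k"
        moreover from this have "\<alpha> i \<le> ?c" by (intro le) simp
        ultimately show False using 3 ij(2) by (simp add: rect_partition_def)
      qed
      then show ?thesis using 3 ij by (intro image_eqI[of _ _ "(i, j - 1)"]) (auto simp: sh_def diagram_def rect_partition_def)
    qed
  qed
  ultimately have "bij_betw sh (diagram \<alpha>) (diagram ?\<alpha> - {(i, ?c) | i. i < k})" by (simp add: bij_betw_def)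
  from bij_betw_trans[OF lab[unfolded labelling_def] this]
  have "bij_betw (\<lambda>s. (?\<rho> s, ?\<kappa> s)) {..<N} (diagram ?\<alpha> - {(i, ?c) | i. i < k})"
    by (rule bij_betw_cong[THEN iffD1, rotated]) (simp add: sh_def)
  moreover have "bij_betw (\<lambda>s. (?\<rho> s, ?\<kappa> s)) {N..<N + k} {(i, ?c) | i. i < k}"
  proof (rule bij_betwI[where g = "\<lambda>(i, j). N + i"])
  qed auto
  ultimately have "bij_betw (\<lambda>s. (?\<rho> s, ?\<kappa> s)) ({..<N} \<union> {N..<N + k}) (diagram ?\<alpha> - {(i, ?c) | i. i < k} \<union> {(i, ?c) | i. i < k})"
    by (rule bij_betw_combine) auto
  moreover have "{..<N} \<union> {N..<N + k} = {..<N + k}" by auto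
  moreover have "diagram ?\<alpha> - {(i, ?c) | i. i < k} \<union> {(i, ?c) | i. i < k} = diagram ?\<alpha>"
  proof -
    have "?c < ?\<alpha> i" if "i < k" for i using ge[OF that] that by (simp add: rect_partition_def)
    then show ?thesis by (auto simp: diagram_def)
  qed
  ultimately show ?thesis by (simp add: labelling_def)
qed

text \<open>For a partition \<gamma> the columns \<gamma> 0, \<gamma> 0 + 1, ... are new, so each
  added box is alone in its column and the third alternation does not move it.\<close>

lemma labelling_add_row:
  assumes lab: "labelling {..<N} \<gamma> \<rho> \<kappa>"
  shows "labelling {..<N + k} (\<gamma> + row_partition k) (\<lambda>s. if s < N then \<rho> s else 0)
    (\<lambda>s. if s < N then \<kappa> s else \<gamma> 0 + (s - N))" (is "labelling _ ?\<gamma> ?\<rho> ?\<kappa>")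
proof -
  have "bij_betw (\<lambda>s. (?\<rho> s, ?\<kappa> s)) {..<N} (diagram \<gamma>)"
    using lab unfolding labelling_def by (rule bij_betw_cong[THEN iffD1, rotated]) simp
  moreover have "bij_betw (\<lambda>s. (?\<rho> s, ?\<kappa> s)) {N..<N + k} ({0} \<times> {\<gamma> 0..<\<gamma> 0 + k})"
    by (rule bij_betwI[where g = "\<lambda>(i, j). N + (j - \<gamma> 0)"]) auto
  ultimately have "bij_betw (\<lambda>s. (?\<rho> s, ?\<kappa> s)) ({..<N} \<union> {N..<N + k}) (diagram \<gamma> \<union> ({0} \<times> {\<gamma> 0..<\<gamma> 0 + k}))"
    by (rule bij_betw_combine) (auto simp: diagram_def)
  moreover have "{..<N} \<union> {N..<N + k} = {..<N + k}" by auto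
  moreover have "diagram \<gamma> \<union> ({0} \<times> {\<gamma> 0..<\<gamma> 0 + k}) = diagram ?\<gamma>"
    by (auto simp: diagram_def row_partition_def not_less split: if_splits)
  ultimately show ?thesis by (simp add: labelling_def)
qed

text \<open>
  Up to the factor \<open>k!\<close> this is the determinant of \<open>(x(i, j, 0))\<close> with \<open>i, j < k\<close>; the entries are
  \<open>N, \<dots>, N + k - 1\<close> so that it extends a filling by \<open>{..<N}\<close>.
\<close>
definition det_poly :: "nat \<Rightarrow> nat \<Rightarrow> point \<Rightarrow> complex" where
  "det_poly N k = alt_poly {N..<N + k} (\<lambda>s. s - N) (\<lambda>s. 0) (\<lambda>s. s - N) (\<lambda>s. 0) (\<lambda>s. 0) (\<lambda>s. s)"

text \<open>At a point whose slice is the identity matrix only the terms with equal row and column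
  permutations survive. Each is the square of a sign, so the value is the number of
  permutations.\<close>

lemma det_poly_nonzero: "det_poly N k (\<lambda>(i, j, l). if i = j then 1 else 0) \<noteq> 0"
proof -
  let ?T = "{N..<N + k}"
  let ?P = "column_perms ?T (\<lambda>s. 0)"
  \<comment> \<open>In the third filling every entry has a column of its own.\<close>
  have id: "column_perms ?T (\<lambda>s. s) = {id}"
  proof -
    have "q = id" if q: "q \<in> column_perms ?T (\<lambda>s. s)" for q
    proof
      fix s show "q s = id s" using column_permsD(2,4)[OF q, of s] by (cases "s \<in> ?T") auto
    qed
    then show ?thesis by (auto simp: column_perms_def)
  qed
  have prod: "(\<Prod>s\<in>?T. if q s - N = q' s - N then 1 else 0) = (if q = q' then 1 else (0::complex))"
    if q: "q \<in> ?P" and q': "q' \<in> ?P" for q q'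
  proof (cases "q = q'")
    case False
    then obtain s where s: "q s \<noteq> q' s" by auto
    then have sT: "s \<in> ?T" using column_permsD(4)[OF q, of s] column_permsD(4)[OF q', of s] by metis
    then have "q s \<ge> N" "q' s \<ge> N" using column_permsD(3)[OF q sT] column_permsD(3)[OF q' sT] by auto
    then have "q s - N \<noteq> q' s - N" using s by auto
    then have "\<exists>s\<in>?T. (if q s - N = q' s - N then 1 else 0) = (0::complex)" using sT by auto
    then have "(\<Prod>s\<in>?T. if q s - N = q' s - N then 1 else 0) = (0::complex)" by (rule prod_zero[OF finite_atLeastLessThan])
    then show ?thesis using False by simp
  qed simp
  have "det_poly N k (\<lambda>(i, j, l). if i = j then 1 else 0)
     = (\<Sum>q\<in>?P. of_int (sign q) * (\<Sum>q'\<in>?P. of_int (sign q') * (\<Prod>s\<in>?T. if q s - N = q' s - N then 1 else 0)))"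
    unfolding det_poly_def alt_poly_def alt_sum_def id by simp
  also have "\<dots> = (\<Sum>q\<in>?P. 1)"
  proof (rule sum.cong[OF refl])
    fix q assume q: "q \<in> ?P"
    have "(\<Sum>q'\<in>?P. of_int (sign q') * (\<Prod>s\<in>?T. if q s - N = q' s - N then 1 else 0))
       = (\<Sum>q'\<in>?P. if q = q' then of_int (sign q) else (0::complex))"
      by (rule sum.cong[OF refl]) (simp add: prod[OF q])
    then have "(\<Sum>q'\<in>?P. of_int (sign q') * (\<Prod>s\<in>?T. if q s - N = q' s - N then 1 else 0)) = (of_int (sign q) :: complex)"
      using q by simp
    moreover have "of_int (sign q) * of_int (sign q) = (1::complex)"
      unfolding of_int_mult[symmetric] sign_idempotent by simp
    ultimately show "of_int (sign q) * (\<Sum>q'\<in>?P. of_int (sign q') * (\<Prod>s\<in>?T. if q s - N = q' s - N then 1 else 0)) = (1::complex)"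
      by simp
  qed
  also have "\<dots> \<noteq> 0"
  proof -
    have "id \<in> ?P" by (simp add: column_perms_def)
    then show ?thesis by (auto simp: card_eq_0_iff)
  qed
  finally show ?thesis .
qed

section \<open>Multiplication by the determinant\<close>

lemma hw_polysI:
  assumes "labelling {..<N} \<alpha> \<rho>1 \<kappa>1" "labelling {..<N} \<beta> \<rho>2 \<kappa>2" "labelling {..<N} \<gamma> \<rho>3 \<kappa>3"
  shows "alt_poly {..<N} \<rho>1 \<kappa>1 \<rho>2 \<kappa>2 \<rho>3 \<kappa>3 \<in> hw_polys N \<alpha> \<beta> \<gamma>"
  using assms unfolding hw_polys_def by blast

lemma hw_polysE:
  assumes "F \<in> hw_polys N \<alpha> \<beta> \<gamma>"
  obtains \<rho>1 \<kappa>1 \<rho>2 \<kappa>2 \<rho>3 \<kappa>3 where "F = alt_poly {..<N} \<rho>1 \<kappa>1 \<rho>2 \<kappa>2 \<rho>3 \<kappa>3"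
    "labelling {..<N} \<alpha> \<rho>1 \<kappa>1" "labelling {..<N} \<beta> \<rho>2 \<kappa>2" "labelling {..<N} \<gamma> \<rho>3 \<kappa>3"
  using assms unfolding hw_polys_def mem_Collect_eq by (elim exE conjE) (rule that)

text \<open>In all three enlarged fillings the new entries share no column with the old ones, so the
  alternations factor. The old entries reproduce F, as their columns are merely renamed, and the new
  ones give the determinant.\<close>

lemma hw_polys_mult_det:
  assumes \<alpha>: "antimono \<alpha>" and \<beta>: "antimono \<beta>" and \<gamma>: "antimono \<gamma>" and k: "k \<ge> 1" and F: "F \<in> hw_polys N \<alpha> \<beta> \<gamma>"
  shows "(\<lambda>x. F x * det_poly N k x)
    \<in> hw_polys (N + k) (\<alpha> + rect_partition 1 k) (\<beta> + rect_partition 1 k) (\<gamma> + row_partition k)"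
proof -
  obtain \<rho>1 \<kappa>1 \<rho>2 \<kappa>2 \<rho>3 \<kappa>3 where Feq: "F = alt_poly {..<N} \<rho>1 \<kappa>1 \<rho>2 \<kappa>2 \<rho>3 \<kappa>3"
    and lab: "labelling {..<N} \<alpha> \<rho>1 \<kappa>1" "labelling {..<N} \<beta> \<rho>2 \<kappa>2" "labelling {..<N} \<gamma> \<rho>3 \<kappa>3"
    by (rule hw_polysE[OF F])
  define r where "r \<rho> s = (if s < N then \<rho> s else s - N)" for \<rho> :: "nat \<Rightarrow> nat" and s
  define c where "c \<delta> \<kappa> s = (if s < N then (if \<kappa> s < \<delta> (k - 1) then \<kappa> s else Suc (\<kappa> s)) else \<delta> (k - 1))"
    for \<delta> \<kappa> :: "nat \<Rightarrow> nat" and s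
  define r3 where "r3 s = (if s < N then \<rho>3 s else 0)" for s
  define c3 where "c3 s = (if s < N then \<kappa>3 s else \<gamma> 0 + (s - N))" for s
  have lab': "labelling {..<N + k} (\<alpha> + rect_partition 1 k) (r \<rho>1) (c \<alpha> \<kappa>1)"
    "labelling {..<N + k} (\<beta> + rect_partition 1 k) (r \<rho>2) (c \<beta> \<kappa>2)"
    "labelling {..<N + k} (\<gamma> + row_partition k) r3 c3"
    unfolding r_def c_def r3_def c3_def
    by (rule labelling_add_column[OF lab(1) \<alpha> k], rule labelling_add_column[OF lab(2) \<beta> k],
        rule labelling_add_row[OF lab(3)])
  have "\<kappa>3 s < \<gamma> 0" if "s < N" for s
  proof -
    have "(\<rho>3 s, \<kappa>3 s) \<in> diagram \<gamma>"
      using bij_betwE[OF lab(3)[unfolded labelling_def]] that by simp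
    then have "\<kappa>3 s < \<gamma> (\<rho>3 s)" by (simp add: diagram_def)
    also have "\<dots> \<le> \<gamma> 0" by (rule antimonoD[OF \<gamma>]) simp
    finally show ?thesis .
  qed
  then have c3: "c3 s < \<gamma> 0 \<longleftrightarrow> s < N" for s unfolding c3_def by (cases "s < N") simp_all
  have c: "c \<delta> \<kappa> s \<noteq> \<delta> (k - 1) \<longleftrightarrow> s < N" for \<delta> \<kappa> s by (simp add: c_def)
  have disj_c: "c \<delta> \<kappa> ` {..<N} \<inter> c \<delta> \<kappa> ` {N..<N + k} = {}" for \<delta> \<kappa>
  proof -
    have "c \<delta> \<kappa> s \<noteq> c \<delta> \<kappa> s'" if "s < N" "N \<le> s'" for s s'
      using c[of \<delta> \<kappa> s] c[of \<delta> \<kappa> s'] that by auto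
    then show ?thesis by fastforce
  qed
  have disj3: "c3 ` {..<N} \<inter> c3 ` {N..<N + k} = {}"
  proof -
    have "c3 s \<noteq> c3 s'" if "s < N" "N \<le> s'" for s s'
      using c3[of s] c3[of s'] that by auto
    then show ?thesis by fastforce
  qed
  have un: "{..<N + k} = {..<N} \<union> {N..<N + k}" by auto
  have 1: "alt_poly {..<N} (r \<rho>1) (c \<alpha> \<kappa>1) (r \<rho>2) (c \<beta> \<kappa>2) r3 c3 = F"
    unfolding Feq
    by (rule alt_poly_cong; (rule column_perms_eqI)?) (auto simp: r_def r3_def c_def c3_def)
  have 2: "alt_poly {N..<N + k} (r \<rho>1) (c \<alpha> \<kappa>1) (r \<rho>2) (c \<beta> \<kappa>2) r3 c3 = det_poly N k"
    unfolding det_poly_def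
    by (rule alt_poly_cong; (rule column_perms_eqI)?) (auto simp: r_def r3_def c_def c3_def)
  have "alt_poly {..<N + k} (r \<rho>1) (c \<alpha> \<kappa>1) (r \<rho>2) (c \<beta> \<kappa>2) r3 c3 = (\<lambda>x. F x * det_poly N k x)"
    unfolding un
    by (rule ext, subst alt_poly_union[OF finite_lessThan finite_atLeastLessThan disj_c disj_c disj3]) (simp only: 1 2)
  from this[symmetric] show ?thesis using hw_polysI[OF lab'] by (simp only:)
qed

lemma finite_hw_polys:
  assumes "partition_of N \<alpha>" "partition_of N \<beta>" "partition_of N \<gamma>"
  shows "finite (hw_polys N \<alpha> \<beta> \<gamma>)"
  unfolding hw_polys_eq[OF assms] by simp

lemma hw_polys_poly_on_lines: "F \<in> cfun.span (hw_polys N \<alpha> \<beta> \<gamma>) \<Longrightarrow> poly_on_lines F"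
  by (erule poly_on_lines_span) (auto elim!: hw_polysE simp: poly_on_lines_alt_poly)

lemma kronecker_mono_step:
  assumes \<alpha>: "partition_of N \<alpha>" and \<beta>: "partition_of N \<beta>" and \<gamma>: "partition_of N \<gamma>" and k: "k \<ge> 1"
  shows "kronecker N \<alpha> \<beta> \<gamma>
    \<le> kronecker (N + k) (\<alpha> + rect_partition 1 k) (\<beta> + rect_partition 1 k) (\<gamma> + row_partition k)"
proof -
  have \<alpha>': "partition_of (N + k) (\<alpha> + rect_partition 1 k)" and \<beta>': "partition_of (N + k) (\<beta> + rect_partition 1 k)"
    and \<gamma>': "partition_of (N + k) (\<gamma> + row_partition k)"
    using partition_of_add[OF \<alpha> partition_of_rect[of 1 k]] partition_of_add[OF \<beta> partition_of_rect[of 1 k]]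
      partition_of_add[OF \<gamma> partition_of_row[of k]] by simp_all
  have anti: "antimono \<alpha>" "antimono \<beta>" "antimono \<gamma>" using \<alpha> \<beta> \<gamma> unfolding partition_of_def by blast+
  define M where "M F = (\<lambda>x. F x * det_poly N k x)" for F
  have lin: "clinear M" by (rule clinearI) (simp_all add: M_def algebra_simps)
  have D: "poly_on_lines (det_poly N k)" unfolding det_poly_def by (rule poly_on_lines_alt_poly)
  have inj: "F = 0" if F: "F \<in> cfun.span (hw_polys N \<alpha> \<beta> \<gamma>)" and z: "M F = 0" for F
  proof (rule ext)
    fix x
    have "F x * det_poly N k x = 0" for x using fun_cong[OF z, of x] by (simp add: M_def)
    then have "F x = 0"
      by (rule poly_on_lines_mult_eq_0[where F = F and D = "det_poly N k" and x = x
            and y = "\<lambda>(i, j, l). if i = j then 1 else 0", OF hw_polys_poly_on_lines[OF F] D det_poly_nonzero])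
    then show "F x = 0 x" by simp
  qed
  have sub: "M F \<in> cfun.span (hw_polys (N + k) (\<alpha> + rect_partition 1 k) (\<beta> + rect_partition 1 k) (\<gamma> + row_partition k))"
    if "F \<in> hw_polys N \<alpha> \<beta> \<gamma>" for F
    unfolding M_def by (rule cfun.span_base, rule hw_polys_mult_det[OF anti k that])
  show ?thesis
    unfolding kronecker_eq_dim_hw_polys[OF \<alpha> \<beta> \<gamma>] kronecker_eq_dim_hw_polys[OF \<alpha>' \<beta>' \<gamma>']
    by (rule cfun_dim_span_le(1)[OF lin inj sub finite_hw_polys[OF \<alpha>' \<beta>' \<gamma>']])
qed

section \<open>Boundedness\<close>

text \<open>Following q by the transposition of b and b' leaves every factor unchanged and reverses
  the sign, so the terms cancel in pairs.\<close>

lemma alt_sum_vanish: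
  assumes fin: "finite S" and b: "b \<in> S" "b' \<in> S" "b \<noteq> b'" "\<kappa> b = \<kappa> b'" "\<rho> b = \<rho> b'"
  shows "alt_sum S \<kappa> (\<lambda>q. \<Prod>r\<in>S. y r (\<rho> (q r))) = 0"
proof -
  let ?t = "transpose b b'" and ?P = "column_perms S \<kappa>"
  let ?f = "\<lambda>q. of_int (sign q) * (\<Prod>r\<in>S. y r (\<rho> (q r))) :: complex"
  have tt: "?t \<circ> (?t \<circ> q) = q" for q by (simp add: fun_eq_iff)
  have \<kappa>t: "\<kappa> (?t s) = \<kappa> s" and \<rho>t: "\<rho> (?t s) = \<rho> s" for s using b by (auto simp: transpose_def)
  have tP: "?t \<circ> q \<in> ?P" if q: "q \<in> ?P" for q
    using column_permsD(1,2)[OF q] permutes_swap_id[OF b(1,2)]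
    by (auto simp: column_perms_def \<kappa>t permutes_compose)
  have sgn: "?f (?t \<circ> q) = - ?f q" if q: "q \<in> ?P" for q
  proof -
    have "permutation q" using column_permsD(1)[OF q] fin permutation_permutes by blast
    then have "sign (?t \<circ> q) = - sign q"
      using b(3) by (simp add: sign_compose permutation_swap_id sign_swap_id)
    then show ?thesis by (simp add: \<rho>t)
  qed
  have "sum ?f ?P = (\<Sum>q\<in>?P. ?f (?t \<circ> q))"
    by (rule sum.reindex_bij_witness[of _ "\<lambda>q. ?t \<circ> q" "\<lambda>q. ?t \<circ> q"]) (simp_all only: tt tP)
  also have "\<dots> = (\<Sum>q\<in>?P. - ?f q)" by (rule sum.cong[OF refl], rule sgn)
  also have "\<dots> = - sum ?f ?P" by (rule sum_negf)
  finally have "sum ?f ?P = 0" by simp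
  then show ?thesis by (simp add: alt_sum_def)
qed

lemma alt_sum_scale: "alt_sum S \<kappa> (\<lambda>q. c * F q) = c * alt_sum S \<kappa> F"
  by (simp add: alt_sum_def sum_distrib_left mult.left_commute)

lemma alt_sum_sum: "alt_sum S \<kappa> (\<lambda>q. \<Sum>i\<in>I. F i q) = (\<Sum>i\<in>I. alt_sum S \<kappa> (F i))"
  unfolding alt_sum_def sum_distrib_left by (rule sum.swap)

lemma alt_sum_swap:
  "alt_sum S \<kappa> (\<lambda>q. alt_sum S \<kappa>' (\<lambda>q'. F q q')) = alt_sum S \<kappa>' (\<lambda>q'. alt_sum S \<kappa> (\<lambda>q. F q q'))"
  unfolding alt_sum_def sum_distrib_left
  by (rule trans[OF sum.swap], rule sum.cong[OF refl], rule sum.cong[OF refl], rule mult.left_commute)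

lemma prod_permute_inv:
  assumes "q permutes S"
  shows "(\<Prod>r\<in>S. h (q r) r) = (\<Prod>b\<in>S. h b (inv q b))"
  using prod.permute[OF assms, of "\<lambda>b. h b (inv q b)"] permutes_inverses(2)[OF assms] by (simp add: o_def)

text \<open>
  When the product is expanded, in every other term two boxes of one column carry the same row index.
\<close>
lemma alt_sum_row_op:
  assumes fin: "finite S" and anti: "antimono \<alpha>" and lab: "labelling S \<alpha> \<rho> \<kappa>"
  shows "alt_sum S \<kappa> (\<lambda>q. \<Prod>r\<in>S. y r (\<rho> (q r)) + (if s < \<rho> (q r) then c (\<rho> (q r)) * y r s else 0))
    = alt_sum S \<kappa> (\<lambda>q. \<Prod>r\<in>S. y r (\<rho> (q r)))"
proof -
  \<comment> \<open>Z is the set of boxes where the second summand is chosen; \<open>d\<close>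
    collects the coefficients of the resulting term and \<open>\<rho>'\<close> its row
    indices.\<close>
  define d where "d Z b = (if b \<in> Z then (if s < \<rho> b then c (\<rho> b) else 0) else (1::complex))" for Z b
  define \<rho>' where "\<rho>' Z b = (if b \<in> Z then s else \<rho> b)" for Z b
  have "(\<Prod>r\<in>S. y r (\<rho> (q r)) + (if s < \<rho> (q r) then c (\<rho> (q r)) * y r s else 0))
      = (\<Sum>Z\<in>Pow S. (\<Prod>b\<in>S. d Z b) * (\<Prod>r\<in>S. y r (\<rho>' Z (q r))))" if q: "q permutes S" for q
  proof -
    \<comment> \<open>Reindexed by the box b = q r, so that the coefficients become independent of q
      and can leave the alternation.\<close>
    have "(\<Prod>r\<in>S. y r (\<rho> (q r)) + (if s < \<rho> (q r) then c (\<rho> (q r)) * y r s else 0))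
       = (\<Prod>b\<in>S. (if s < \<rho> b then c (\<rho> b) * y (inv q b) s else 0) + y (inv q b) (\<rho> b))"
      using prod_permute_inv[OF q, of "\<lambda>b r. y r (\<rho> b) + (if s < \<rho> b then c (\<rho> b) * y r s else 0)"]
      by (simp add: add.commute)
    also have "\<dots> = (\<Sum>Z\<in>Pow S. (\<Prod>b\<in>Z. if s < \<rho> b then c (\<rho> b) * y (inv q b) s else 0)
        * (\<Prod>b\<in>S - Z. y (inv q b) (\<rho> b)))"
      by (rule prod_add[OF fin])
    also have "\<dots> = (\<Sum>Z\<in>Pow S. (\<Prod>b\<in>S. d Z b) * (\<Prod>r\<in>S. y r (\<rho>' Z (q r))))"
    proof (rule sum.cong[OF refl])
      fix Z assume "Z \<in> Pow S"
      then have Z: "Z \<subseteq> S" by simp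
      have "(\<Prod>b\<in>S. d Z b) * (\<Prod>r\<in>S. y r (\<rho>' Z (q r))) = (\<Prod>b\<in>S. d Z b * y (inv q b) (\<rho>' Z b))"
        unfolding prod_permute_inv[OF q, of "\<lambda>b r. y r (\<rho>' Z b)"] by (rule prod.distrib[symmetric])
      also have "\<dots> = (\<Prod>b\<in>S - Z. d Z b * y (inv q b) (\<rho>' Z b)) * (\<Prod>b\<in>Z. d Z b * y (inv q b) (\<rho>' Z b))"
        by (rule prod.subset_diff[OF Z fin])
      also have "\<dots> = (\<Prod>b\<in>S - Z. y (inv q b) (\<rho> b)) * (\<Prod>b\<in>Z. if s < \<rho> b then c (\<rho> b) * y (inv q b) s else 0)"
        by (intro arg_cong2[of _ _ _ _ "(*)"] prod.cong refl) (auto simp: d_def \<rho>'_def)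
      finally show "(\<Prod>b\<in>Z. if s < \<rho> b then c (\<rho> b) * y (inv q b) s else 0) * (\<Prod>b\<in>S - Z. y (inv q b) (\<rho> b))
          = (\<Prod>b\<in>S. d Z b) * (\<Prod>r\<in>S. y r (\<rho>' Z (q r)))" by (simp add: mult.commute)
    qed
    finally show ?thesis .
  qed
  then have "alt_sum S \<kappa> (\<lambda>q. \<Prod>r\<in>S. y r (\<rho> (q r)) + (if s < \<rho> (q r) then c (\<rho> (q r)) * y r s else 0))
     = alt_sum S \<kappa> (\<lambda>q. \<Sum>Z\<in>Pow S. (\<Prod>b\<in>S. d Z b) * (\<Prod>r\<in>S. y r (\<rho>' Z (q r))))"
    by (intro alt_sum_cong) (simp add: column_permsD(1))
  also have "\<dots> = (\<Sum>Z\<in>Pow S. (\<Prod>b\<in>S. d Z b) * alt_sum S \<kappa> (\<lambda>q. \<Prod>r\<in>S. y r (\<rho>' Z (q r))))"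
    by (simp only: alt_sum_sum alt_sum_scale)
  also have "\<dots> = (\<Sum>Z\<in>{{}}. (\<Prod>b\<in>S. d Z b) * alt_sum S \<kappa> (\<lambda>q. \<Prod>r\<in>S. y r (\<rho>' Z (q r))))"
  proof (rule sum.mono_neutral_right)
    show "\<forall>Z\<in>Pow S - {{}}. (\<Prod>b\<in>S. d Z b) * alt_sum S \<kappa> (\<lambda>q. \<Prod>r\<in>S. y r (\<rho>' Z (q r))) = 0"
    proof
      fix Z assume Z: "Z \<in> Pow S - {{}}"
      show "(\<Prod>b\<in>S. d Z b) * alt_sum S \<kappa> (\<lambda>q. \<Prod>r\<in>S. y r (\<rho>' Z (q r))) = 0"
      proof (cases "\<forall>b\<in>Z. s < \<rho> b")
        case False
        then have "\<exists>b\<in>S. d Z b = 0" using Z by (auto simp: d_def)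
        then have "(\<Prod>b\<in>S. d Z b) = 0" by (rule prod_zero[OF fin])
        then show ?thesis by simp
      next
        case True
        \<comment> \<open>The column of b has a box b' in row s, because s precedes the row of b. It
          is not in Z, as all rows of Z come after s. So b and b' both carry the row index
          s.\<close>
        obtain b where b: "b \<in> Z" "b \<in> S" using Z by auto
        have "(\<rho> b, \<kappa> b) \<in> diagram \<alpha>" using bij_betwE[OF lab[unfolded labelling_def]] b by simp
        then have "\<kappa> b < \<alpha> (\<rho> b)" by (simp add: diagram_def)
        also have "\<alpha> (\<rho> b) \<le> \<alpha> s" by (rule antimonoD[OF anti]) (use True b in auto)
        finally have "(s, \<kappa> b) \<in> diagram \<alpha>" by (simp add: diagram_def)
        then have "(s, \<kappa> b) \<in> (\<lambda>s. (\<rho> s, \<kappa> s)) ` S"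
          using bij_betw_imp_surj_on[OF lab[unfolded labelling_def]] by simp
        then obtain b' where b': "b' \<in> S" "\<rho> b' = s" "\<kappa> b' = \<kappa> b" by auto
        then have nZ: "b' \<notin> Z" using True by auto
        have "alt_sum S \<kappa> (\<lambda>q. \<Prod>r\<in>S. y r (\<rho>' Z (q r))) = 0"
          by (rule alt_sum_vanish[OF fin b(2) b'(1)]) (use b b' nZ in \<open>auto simp: \<rho>'_def\<close>)
        then show ?thesis by simp
      qed
    qed
  qed (use fin in auto)
  also have "\<dots> = alt_sum S \<kappa> (\<lambda>q. \<Prod>r\<in>S. y r (\<rho> (q r)))" by (simp add: d_def \<rho>'_def)
  finally show ?thesis .
qed

text \<open>Multiples of row s are added to all later rows at once and in every slice l, so that one
  operation clears the rest of a column of the slice l = 0. The values c a with a \<le> s are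
  ignored.\<close>

definition row_op :: "nat \<Rightarrow> (nat \<Rightarrow> complex) \<Rightarrow> point \<Rightarrow> point" where
  "row_op s c x = (\<lambda>(a, b, l). x (a, b, l) + (if s < a then c a * x (s, b, l) else 0))"

definition col_op :: "nat \<Rightarrow> (nat \<Rightarrow> complex) \<Rightarrow> point \<Rightarrow> point" where
  "col_op s c x = (\<lambda>(a, b, l). x (a, b, l) + (if s < b then c b * x (a, s, l) else 0))"

lemma alt_poly_row_op:
  assumes fin: "finite S" and anti: "antimono \<alpha>" and lab: "labelling S \<alpha> \<rho>1 \<kappa>1"
  shows "alt_poly S \<rho>1 \<kappa>1 \<rho>2 \<kappa>2 \<rho>3 \<kappa>3 (row_op s c x) = alt_poly S \<rho>1 \<kappa>1 \<rho>2 \<kappa>2 \<rho>3 \<kappa>3 x"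
proof -
  have "alt_poly S \<rho>1 \<kappa>1 \<rho>2 \<kappa>2 \<rho>3 \<kappa>3 x' = alt_sum S \<kappa>2 (\<lambda>q2. alt_sum S \<kappa>3 (\<lambda>q3. alt_sum S \<kappa>1 (\<lambda>q1.
       \<Prod>r\<in>S. x' (\<rho>1 (q1 r), \<rho>2 (q2 r), \<rho>3 (q3 r)))))" for x'
    unfolding alt_poly_def by (rule trans[OF alt_sum_swap], rule alt_sum_cong, rule alt_sum_swap)
  note eq = this
  show ?thesis
    unfolding eq row_op_def prod.case
    by (rule alt_sum_cong, rule alt_sum_cong,
        rule alt_sum_row_op[OF fin anti lab, where y = "\<lambda>r a. x (a, \<rho>2 (_ r), \<rho>3 (_ r))"])
qed

lemma alt_poly_col_op:
  assumes fin: "finite S" and anti: "antimono \<beta>" and lab: "labelling S \<beta> \<rho>2 \<kappa>2"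
  shows "alt_poly S \<rho>1 \<kappa>1 \<rho>2 \<kappa>2 \<rho>3 \<kappa>3 (col_op s c x) = alt_poly S \<rho>1 \<kappa>1 \<rho>2 \<kappa>2 \<rho>3 \<kappa>3 x"
proof -
  have "alt_poly S \<rho>1 \<kappa>1 \<rho>2 \<kappa>2 \<rho>3 \<kappa>3 x' = alt_sum S \<kappa>1 (\<lambda>q1. alt_sum S \<kappa>3 (\<lambda>q3. alt_sum S \<kappa>2 (\<lambda>q2.
       \<Prod>r\<in>S. x' (\<rho>1 (q1 r), \<rho>2 (q2 r), \<rho>3 (q3 r)))))" for x'
    unfolding alt_poly_def by (rule alt_sum_cong, rule alt_sum_swap)
  note eq = this
  show ?thesis
    unfolding eq col_op_def prod.case
    by (rule alt_sum_cong, rule alt_sum_cong,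
        rule alt_sum_row_op[OF fin anti lab, where y = "\<lambda>r a. x (\<rho>1 (_ r), a, \<rho>3 (_ r))"])
qed

definition diag_part :: "point \<Rightarrow> point" where
  "diag_part x = (\<lambda>(a, b, l). if l = 0 \<and> a \<noteq> b then 0 else x (a, b, l))"

definition agree :: "nat \<Rightarrow> point \<Rightarrow> point \<Rightarrow> bool" where
  "agree m x x' \<longleftrightarrow> (\<forall>a b l. a < m \<longrightarrow> b < m \<longrightarrow> x (a, b, l) = x' (a, b, l))"

lemma labelling_row_less:
  assumes "labelling S \<alpha> \<rho> \<kappa>" "s \<in> S" "\<And>i. i \<ge> m \<Longrightarrow> \<alpha> i = 0"
  shows "\<rho> s < m"
proof -
  have "(\<rho> s, \<kappa> s) \<in> diagram \<alpha>" using bij_betwE[OF assms(1)[unfolded labelling_def]] assms(2) by simp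
  then have "\<alpha> (\<rho> s) \<noteq> 0" by (simp add: diagram_def)
  then show ?thesis using assms(3)[of "\<rho> s"] by (meson not_less)
qed

lemma span_invariant:
  assumes "F \<in> cfun.span A" "\<And>f. f \<in> A \<Longrightarrow> f x = f x'"
  shows "F x = F x'"
proof -
  have "cfun.subspace {F. F x = F x'}" by (rule cfun.subspaceI) auto
  from cfun.span_minimal[OF _ this, of A] assms show ?thesis by auto
qed

lemma poly_zero_off_0:
  fixes p :: "complex poly"
  assumes "\<And>t. t \<noteq> 0 \<Longrightarrow> poly p t = 0"
  shows "poly p t = 0"
proof -
  have "UNIV - {0} \<subseteq> {t. poly p t = 0}" using assms by auto
  then have "infinite {t. poly p t = 0}" using infinite_UNIV_char_0 finite_subset by (metis finite_Diff2 finite.emptyI finite.insertI)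
  then have "p = 0" using poly_roots_finite by blast
  then show ?thesis by simp
qed

text \<open>
  Elimination with the pivots \<open>x(s, s, 0)\<close>. If a pivot vanishes, perturb it: a polynomial in one
  variable that vanishes off one point vanishes there as well.
\<close>
lemma elimination:
  assumes pl: "poly_on_lines F"
    and row: "\<And>s c x. F (row_op s c x) = F x" and col: "\<And>s c x. F (col_op s c x) = F x"
    and local: "\<And>x x'. agree m x x' \<Longrightarrow> F x = F x'"
    and zero: "\<And>x. F (diag_part x) = 0"
  shows "F x = 0"
proof -
  \<comment> \<open>The slice l = 0 is already diagonal in the rows and columns of index less than
    s, within the m by m corner that F depends on. The induction is on the number m - s of pivots
    still to be treated.\<close>
  define P where "P s x \<longleftrightarrow> (\<forall>a b. a < m \<longrightarrow> b < m \<longrightarrow> a \<noteq> b \<longrightarrow> min a b < s \<longrightarrow> x (a, b, 0) = 0)" for s and x :: point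
  have "P (m - k) x \<Longrightarrow> F x = 0" for k x
  proof (induction k arbitrary: x)
    case 0
    have "agree m x (diag_part x)" using 0 by (auto simp: P_def agree_def diag_part_def)
    then have "F x = F (diag_part x)" by (rule local)
    then show ?case using zero by simp
  next
    case (Suc k)
    show ?case
    proof (cases "k < m")
      case False
      then show ?thesis using Suc by simp
    next
      case True
      define s where "s = m - Suc k"
      have s: "s < m" "m - k = Suc s" using True by (auto simp: s_def)
      have pivot: "F z = 0" if z: "P s z" "z (s, s, 0) \<noteq> 0" for z
      proof -
        \<comment> \<open>These multipliers clear the rest of column s, and those in
          \<open>?d\<close> then the rest of row s. The first operation does not change the pivot,
          so both have the same denominator.\<close>
        let ?c = "\<lambda>a. - z (a, s, 0) / z (s, s, 0)"
        define z1 where "z1 = row_op s ?c z"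
        let ?d = "\<lambda>b. - z1 (s, b, 0) / z (s, s, 0)"
        define z2 where "z2 = col_op s ?d z1"
        have P1: "P s z1" unfolding P_def
        proof (intro allI impI)
          fix a b assume ab: "a < m" "b < m" "a \<noteq> b" "min a b < s"
          have "z (a, b, 0) = 0" using z(1) ab by (auto simp: P_def)
          \<comment> \<open>This is the entry that gets added to row a: since b < s, it has been
            cleared before.\<close>
          moreover have "z (s, b, 0) = 0" if "s < a"
          proof -
            have "b < s" using ab(4) that by (simp add: min_def split: if_splits)
            then show ?thesis using z(1) ab(2) s(1) by (simp add: P_def)
          qed
          ultimately show "z1 (a, b, 0) = 0" by (simp add: z1_def row_op_def)
        qed
        have z1s: "z1 (a, s, 0) = 0" if "s < a" for a
          using z(2) that by (simp add: z1_def row_op_def)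
        have z1ss: "z1 (s, s, 0) = z (s, s, 0)" by (simp add: z1_def row_op_def)
        have "P (Suc s) z2" unfolding P_def
        proof (intro allI impI)
          fix a b assume ab: "a < m" "b < m" "a \<noteq> b" "min a b < Suc s"
          show "z2 (a, b, 0) = 0"
          proof (cases "min a b < s")
            case True
            have "z1 (a, b, 0) = 0" using P1 ab True by (auto simp: P_def)
            moreover have "z1 (a, s, 0) = 0" if "s < b"
            proof -
              have "a < s" using True that by (simp add: min_def split: if_splits)
              then show ?thesis using P1 ab(1) s(1) by (simp add: P_def)
            qed
            ultimately show ?thesis by (simp add: z2_def col_op_def)
          next
            case False
            then consider "a = s" "s < b" | "b = s" "s < a" using ab by (auto simp: min_def split: if_splits)
            then show ?thesis
            proof cases
              case 1
              then show ?thesis using z(2) by (simp add: z2_def col_op_def z1ss)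
            next
              case 2
              then show ?thesis by (simp add: z2_def col_op_def z1s)
            qed
          qed
        qed
        then have "F z2 = 0" using Suc.IH[of z2] s(2) by simp
        then show "F z = 0" by (simp add: z2_def z1_def row col)
      qed
      define e :: point where "e = (\<lambda>k. if k = (s, s, 0) then 1 else 0)"
      obtain p where p: "\<And>t. F (\<lambda>k. x k + t * e k) = poly p t"
        using pl unfolding poly_on_lines_def by (elim allE[of _ x] allE[of _ e]) blast
      have Px: "P s x" using Suc.prems by (simp add: s_def)
      \<comment> \<open>Here t is the value given to the pivot. Changing the pivot preserves P s, so
        \<open>pivot\<close> applies whenever t is not 0.\<close>
      have "poly p (t - x (s, s, 0)) = 0" if "t \<noteq> 0" for t
      proof -
        have "F (\<lambda>k. x k + (t - x (s, s, 0)) * e k) = 0"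
          by (rule pivot) (use Px that in \<open>auto simp: P_def e_def\<close>)
        then show ?thesis by (simp only: p)
      qed
      then have "poly (pcompose p [:- x (s, s, 0), 1:]) t = 0" if "t \<noteq> 0" for t
        using that by (simp add: poly_pcompose)
      from poly_zero_off_0[OF this, of "x (s, s, 0)"] have "poly p 0 = 0" by (simp add: poly_pcompose)
      then show ?thesis using p[of 0] by simp
    qed
  qed
  from this[of m x] show ?thesis by (simp add: P_def)
qed

text \<open>The hypotheses of \<open>elimination\<close> hold for the generators and pass to the
  span: invariance under row and column operations comes from \<open>alt_poly_row_op\<close> and
  \<open>alt_poly_col_op\<close>, and locality from the lengths of \<alpha> and \<beta>, which keep
  the first two indices below m.\<close>

lemma hw_polys_eq_0:
  assumes \<alpha>: "antimono \<alpha>" and \<beta>: "antimono \<beta>"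
    and m: "\<And>i. i \<ge> m \<Longrightarrow> \<alpha> i = 0" "\<And>i. i \<ge> m \<Longrightarrow> \<beta> i = 0"
    and F: "F \<in> cfun.span (hw_polys N \<alpha> \<beta> \<gamma>)" and zero: "\<And>x. F (diag_part x) = 0"
  shows "F x = 0"
proof (rule elimination[of F m, OF hw_polys_poly_on_lines[OF F] _ _ _ zero])
  fix s c x
  show "F (row_op s c x) = F x"
  proof (rule span_invariant[OF F])
    fix f assume "f \<in> hw_polys N \<alpha> \<beta> \<gamma>"
    then show "f (row_op s c x) = f x"
      by (rule hw_polysE) (simp only: alt_poly_row_op[OF finite_lessThan \<alpha>])
  qed
  show "F (col_op s c x) = F x"
  proof (rule span_invariant[OF F])
    fix f assume "f \<in> hw_polys N \<alpha> \<beta> \<gamma>"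
    then show "f (col_op s c x) = f x"
      by (rule hw_polysE) (simp only: alt_poly_col_op[OF finite_lessThan \<beta>])
  qed
next
  fix x x' assume ag: "agree m x x'"
  show "F x = F x'"
  proof (rule span_invariant[OF F])
    fix f assume "f \<in> hw_polys N \<alpha> \<beta> \<gamma>"
    then show "f x = f x'"
    proof (rule hw_polysE)
      fix \<rho>1 \<kappa>1 \<rho>2 \<kappa>2 \<rho>3 \<kappa>3
      assume f: "f = alt_poly {..<N} \<rho>1 \<kappa>1 \<rho>2 \<kappa>2 \<rho>3 \<kappa>3"
        and l: "labelling {..<N} \<alpha> \<rho>1 \<kappa>1" "labelling {..<N} \<beta> \<rho>2 \<kappa>2"
      show "f x = f x'"
        unfolding f alt_poly_def
      proof (rule alt_sum_cong, rule alt_sum_cong, rule alt_sum_cong, rule prod.cong[OF refl])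
        fix q1 q2 q3 r
        assume q: "q1 \<in> column_perms {..<N} \<kappa>1" "q2 \<in> column_perms {..<N} \<kappa>2" and r: "r \<in> {..<N}"
        have "\<rho>1 (q1 r) < m" "\<rho>2 (q2 r) < m"
          using labelling_row_less[OF l(1) column_permsD(3)[OF q(1) r] m(1)]
            labelling_row_less[OF l(2) column_permsD(3)[OF q(2) r] m(2)] by auto
        then show "x (\<rho>1 (q1 r), \<rho>2 (q2 r), \<rho>3 (q3 r)) = x' (\<rho>1 (q1 r), \<rho>2 (q2 r), \<rho>3 (q3 r))"
          using ag by (simp add: agree_def)
      qed
    qed
  qed
qed

text \<open>
  On the points with diagonal slice \<open>l = 0\<close> a monomial is determined by its exponents at the
  coordinates with \<open>l \<ge> 1\<close>, because the total exponent of row \<open>a\<close> is \<open>\<alpha> a\<close>.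
\<close>
definition outer_box :: "nat \<Rightarrow> (nat \<times> nat \<times> nat) set" where
  "outer_box m = {..<m} \<times> {..<m} \<times> {1..<m}"

text \<open>R will be N - \<gamma> 0, the number of entries outside row 0 of the third filling, and
  hence the total degree in the coordinates with l \<ge> 1.\<close>

definition outer_exponents :: "nat \<Rightarrow> nat \<Rightarrow> (nat \<times> nat \<times> nat \<Rightarrow> nat) set" where
  "outer_exponents m R = {c. \<forall>d. (d \<in> outer_box m \<longrightarrow> c d \<in> {..R}) \<and> (d \<notin> outer_box m \<longrightarrow> c d = 0)}"

lemma finite_outer_exponents: "finite (outer_exponents m R)"
  unfolding outer_exponents_def by (rule finite_set_of_finite_funs) (simp_all add: outer_box_def)

text \<open>The subtraction is truncated, so this is a genuine exponent for those c that come from a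
  monomial of the right weight; any other c merely enlarges the finite count.\<close>

definition full_exponent :: "nat \<Rightarrow> (nat \<Rightarrow> nat) \<Rightarrow> (nat \<times> nat \<times> nat \<Rightarrow> nat) \<Rightarrow> nat \<times> nat \<times> nat \<Rightarrow> nat" where
  "full_exponent m \<alpha> c = (\<lambda>(a, b, l). if l = 0 then
     (if a = b then \<alpha> a - (\<Sum>(b, l)\<in>{..<m} \<times> {1..<m}. c (a, b, l)) else 0) else c (a, b, l))"

definition outer_monomial :: "nat \<Rightarrow> (nat \<Rightarrow> nat) \<Rightarrow> (nat \<times> nat \<times> nat \<Rightarrow> nat) \<Rightarrow> point \<Rightarrow> complex" where
  "outer_monomial m \<alpha> c x = (\<Prod>d\<in>{..<m} \<times> {..<m} \<times> {..<m}. x d ^ full_exponent m \<alpha> c d)"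

text \<open>\<open>\<tau> r\<close> is the coordinate belonging to the entry r, and exponents are
  sizes of fibres of \<open>\<tau>\<close>. Splitting the \<alpha> a entries with first index a into
  those at (a, a, 0) and those with l \<ge> 1 gives the diagonal exponent.\<close>

lemma diag_part_prod:
  assumes fin: "finite S" and \<tau>: "\<And>r. r \<in> S \<Longrightarrow> \<tau> r \<in> {..<m} \<times> {..<m} \<times> {..<m}"
    and rows: "\<And>a. card {r\<in>S. fst (\<tau> r) = a} = \<alpha> a"
    and outer: "card {r\<in>S. snd (snd (\<tau> r)) \<noteq> 0} \<le> R"
    and diag: "\<And>r. r \<in> S \<Longrightarrow> snd (snd (\<tau> r)) = 0 \<Longrightarrow> fst (\<tau> r) = fst (snd (\<tau> r))"
  shows "\<exists>c\<in>outer_exponents m R. \<forall>x. (\<Prod>r\<in>S. diag_part x (\<tau> r)) = outer_monomial m \<alpha> c x"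
proof -
  let ?D = "{..<m} \<times> {..<m} \<times> {..<m}"
  define c where "c d = (if d \<in> outer_box m then card {r\<in>S. \<tau> r = d} else 0)" for d
  have "card {r\<in>S. \<tau> r = d} \<le> R" if "d \<in> outer_box m" for d
  proof -
    have "card {r\<in>S. \<tau> r = d} \<le> card {r\<in>S. snd (snd (\<tau> r)) \<noteq> 0}"
      using fin that by (intro card_mono) (auto simp: outer_box_def)
    then show ?thesis using outer by simp
  qed
  then have c: "c \<in> outer_exponents m R" by (simp add: outer_exponents_def c_def)
  have e: "full_exponent m \<alpha> c d = card {r\<in>S. \<tau> r = d}" if d: "d \<in> ?D" for d
  proof -
    obtain a b l where dd: "d = (a, b, l)" by (cases d)
    show ?thesis
    proof (cases "l = 0")
      case False
      then show ?thesis using d by (auto simp: dd full_exponent_def c_def outer_box_def)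
    next
      case True
      show ?thesis
      proof (cases "a = b")
        case False
        have "\<tau> r \<noteq> d" if "r \<in> S" for r using diag[OF that] False True by (auto simp: dd)
        then have "{r\<in>S. \<tau> r = d} = {}" by blast
        moreover have "full_exponent m \<alpha> c d = 0" using False True by (simp add: dd full_exponent_def)
        ultimately show ?thesis by (simp only: card.empty)
      next
        case ab: True
        let ?I = "{..<m} \<times> {1..<m}"
        have "{r\<in>S. fst (\<tau> r) = a} = {r\<in>S. \<tau> r = (a, a, 0)} \<union> (\<Union>p\<in>?I. {r\<in>S. \<tau> r = (a, p)})"
        proof (intro equalityI subsetI)
          fix r assume r: "r \<in> {r\<in>S. fst (\<tau> r) = a}"
          obtain b' l' where t: "\<tau> r = (a, b', l')" using r by (cases "\<tau> r") auto
          show "r \<in> {r\<in>S. \<tau> r = (a, a, 0)} \<union> (\<Union>p\<in>?I. {r\<in>S. \<tau> r = (a, p)})"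
          proof (cases "l' = 0")
            case True
            then show ?thesis using diag[of r] r t by auto
          next
            case False
            then have "(b', l') \<in> ?I" using \<tau>[of r] r t by auto
            then show ?thesis using r t by blast
          qed
        qed auto
        then have "\<alpha> a = card ({r\<in>S. \<tau> r = (a, a, 0)} \<union> (\<Union>p\<in>?I. {r\<in>S. \<tau> r = (a, p)}))"
          using rows[of a] by simp
        also have "\<dots> = card {r\<in>S. \<tau> r = (a, a, 0)} + card (\<Union>p\<in>?I. {r\<in>S. \<tau> r = (a, p)})"
          using fin by (intro card_Un_disjoint) auto
        also have "card (\<Union>p\<in>?I. {r\<in>S. \<tau> r = (a, p)}) = (\<Sum>p\<in>?I. card {r\<in>S. \<tau> r = (a, p)})"
          using fin by (intro card_UN_disjoint) auto
        also have "\<dots> = (\<Sum>(b, l)\<in>?I. c (a, b, l))"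
          using d by (intro sum.cong refl) (auto simp: c_def outer_box_def dd)
        finally show ?thesis by (simp add: dd full_exponent_def True ab)
      qed
    qed
  qed
  have "(\<Prod>r\<in>S. diag_part x (\<tau> r)) = outer_monomial m \<alpha> c x" for x
  proof -
    have "(\<Prod>r\<in>S. diag_part x (\<tau> r)) = (\<Prod>r\<in>S. x (\<tau> r))"
    proof (rule prod.cong[OF refl])
      fix r assume "r \<in> S"
      then show "diag_part x (\<tau> r) = x (\<tau> r)"
        using diag[of r] by (cases "\<tau> r") (auto simp: diag_part_def)
    qed
    also have "\<dots> = (\<Prod>d\<in>?D. \<Prod>r\<in>{r\<in>S. \<tau> r = d}. x (\<tau> r))"
      by (rule prod.group[symmetric, OF fin _ image_subsetI[OF \<tau>]]) simp_all
    also have "\<dots> = (\<Prod>d\<in>?D. x d ^ card {r\<in>S. \<tau> r = d})"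
      by (intro prod.cong refl) simp
    also have "\<dots> = outer_monomial m \<alpha> c x"
      unfolding outer_monomial_def by (intro prod.cong refl) (simp add: e)
    finally show ?thesis .
  qed
  with c show ?thesis by blast
qed

text \<open>The permutation q only rearranges the entries, so the counts are those of the filling
  itself. The second count, for the third filling, is the degree in the coordinates outside slice
  0.\<close>

lemma card_labelling_row:
  assumes lab: "labelling S \<alpha> \<rho> \<kappa>" and fin: "finite S" and q: "q permutes S"
  shows "card {r\<in>S. \<rho> (q r) = a} = \<alpha> a" and "card {r\<in>S. \<rho> (q r) \<noteq> 0} = card S - \<alpha> 0"
proof -
  have perm: "card {r\<in>S. Q (\<rho> (q r))} = card {r\<in>S. Q (\<rho> r)}" for Q
  proof (rule bij_betw_same_card[of q])
    show "bij_betw q {r\<in>S. Q (\<rho> (q r))} {r\<in>S. Q (\<rho> r)}"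
      by (rule bij_betwI[where g = "inv q"])
        (use q in \<open>auto simp: permutes_in_image permutes_inverses permutes_in_image[OF permutes_inv[OF q]]\<close>)
  qed
  have "{r\<in>S. \<rho> r < Suc a} = {r\<in>S. \<rho> r < a} \<union> {r\<in>S. \<rho> r = a}" by auto
  then have "card {r\<in>S. \<rho> r < Suc a} = card {r\<in>S. \<rho> r < a} + card {r\<in>S. \<rho> r = a}"
    using fin by (simp add: card_Un_disjoint disjoint_iff)
  then have row: "card {r\<in>S. \<rho> r = a} = \<alpha> a" by (simp add: labelling_card_rows[OF lab])
  then show "card {r\<in>S. \<rho> (q r) = a} = \<alpha> a" using perm[of "\<lambda>i. i = a"] by simp
  have "card {r\<in>S. \<rho> r < Suc 0} = \<alpha> 0" using labelling_card_rows[OF lab, of "Suc 0"] by simp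
  moreover have "{r\<in>S. \<rho> r \<noteq> 0} = S - {r\<in>S. \<rho> r < Suc 0}" by auto
  ultimately have "card {r\<in>S. \<rho> r \<noteq> 0} = card S - \<alpha> 0" using fin by (simp add: card_Diff_subset)
  then show "card {r\<in>S. \<rho> (q r) \<noteq> 0} = card S - \<alpha> 0" using perm[of "\<lambda>i. i \<noteq> 0"] by simp
qed

lemma span_alt_sum:
  assumes "\<And>q. q \<in> column_perms S \<kappa> \<Longrightarrow> F q \<in> cfun.span B"
  shows "(\<lambda>x. alt_sum S \<kappa> (\<lambda>q. F q x)) \<in> cfun.span B"
proof -
  have "(\<lambda>x. alt_sum S \<kappa> (\<lambda>q. F q x)) = (\<Sum>q\<in>column_perms S \<kappa>. (\<lambda>x. of_int (sign q) * F q x))"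
    by (rule ext) (simp add: alt_sum_def sum_fun_apply)
  also have "\<dots> \<in> cfun.span B" by (intro cfun.span_sum cfun.span_scale assms)
  finally show ?thesis .
qed

text \<open>After the alternations are expanded, each product either is an
  \<open>outer_monomial\<close> or contains an off-diagonal coordinate of slice 0 and vanishes on
  diagonal slices.\<close>

lemma hw_polys_diag_part:
  assumes m: "\<And>i. i \<ge> m \<Longrightarrow> \<alpha> i = 0" "\<And>i. i \<ge> m \<Longrightarrow> \<beta> i = 0" "\<And>i. i \<ge> m \<Longrightarrow> \<gamma> i = 0"
    and F: "F \<in> hw_polys N \<alpha> \<beta> \<gamma>"
  shows "(\<lambda>x. F (diag_part x)) \<in> cfun.span (outer_monomial m \<alpha> ` outer_exponents m (N - \<gamma> 0))"
  using F
proof (rule hw_polysE)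
  fix \<rho>1 \<kappa>1 \<rho>2 \<kappa>2 \<rho>3 \<kappa>3
  let ?S = "{..<N}" and ?B = "outer_monomial m \<alpha> ` outer_exponents m (N - \<gamma> 0)"
  assume f: "F = alt_poly {..<N} \<rho>1 \<kappa>1 \<rho>2 \<kappa>2 \<rho>3 \<kappa>3"
    and l: "labelling {..<N} \<alpha> \<rho>1 \<kappa>1" "labelling {..<N} \<beta> \<rho>2 \<kappa>2" "labelling {..<N} \<gamma> \<rho>3 \<kappa>3"
  show "(\<lambda>x. F (diag_part x)) \<in> cfun.span ?B"
    unfolding f alt_poly_def
  proof (rule span_alt_sum, rule span_alt_sum, rule span_alt_sum)
    fix q1 q2 q3
    assume q: "q1 \<in> column_perms ?S \<kappa>1" "q2 \<in> column_perms ?S \<kappa>2" "q3 \<in> column_perms ?S \<kappa>3"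
    define \<tau> where "\<tau> r = (\<rho>1 (q1 r), \<rho>2 (q2 r), \<rho>3 (q3 r))" for r
    have "(\<lambda>x. \<Prod>r\<in>?S. diag_part x (\<tau> r)) \<in> cfun.span ?B"
    proof (cases "\<forall>r\<in>?S. snd (snd (\<tau> r)) = 0 \<longrightarrow> fst (\<tau> r) = fst (snd (\<tau> r))")
      case True
      have range: "\<tau> r \<in> {..<m} \<times> {..<m} \<times> {..<m}" if r: "r \<in> ?S" for r
        using labelling_row_less[OF l(1) column_permsD(3)[OF q(1) r] m(1)]
          labelling_row_less[OF l(2) column_permsD(3)[OF q(2) r] m(2)]
          labelling_row_less[OF l(3) column_permsD(3)[OF q(3) r] m(3)] by (simp add: \<tau>_def)
      have rows: "card {r\<in>?S. fst (\<tau> r) = a} = \<alpha> a" for a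
        using card_labelling_row(1)[OF l(1) finite_lessThan column_permsD(1)[OF q(1)]] by (simp add: \<tau>_def)
      have outer: "card {r\<in>?S. snd (snd (\<tau> r)) \<noteq> 0} \<le> N - \<gamma> 0"
        using card_labelling_row(2)[OF l(3) finite_lessThan column_permsD(1)[OF q(3)]] by (simp add: \<tau>_def)
      obtain c where c: "c \<in> outer_exponents m (N - \<gamma> 0)" "\<And>x. (\<Prod>r\<in>?S. diag_part x (\<tau> r)) = outer_monomial m \<alpha> c x"
        using diag_part_prod[of ?S \<tau> m \<alpha>, OF finite_lessThan range rows outer] True by blast
      have "(\<lambda>x. \<Prod>r\<in>?S. diag_part x (\<tau> r)) = outer_monomial m \<alpha> c" by (rule ext) (rule c(2))
      then show ?thesis using c(1) by (simp add: cfun.span_base)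
    next
      case False
      then obtain r where r: "r \<in> ?S" "snd (snd (\<tau> r)) = 0" "fst (\<tau> r) \<noteq> fst (snd (\<tau> r))" by blast
      have "(\<Prod>r\<in>?S. diag_part x (\<tau> r)) = 0" for x
        by (rule prod_zero[OF finite_lessThan], rule bexI[OF _ r(1)])
          (use r(2,3) in \<open>cases "\<tau> r"; simp add: diag_part_def\<close>)
      then have "(\<lambda>x. \<Prod>r\<in>?S. diag_part x (\<tau> r)) = 0" by (intro ext) simp
      then show ?thesis by (simp only: cfun.span_zero)
    qed
    then show "(\<lambda>x. \<Prod>r\<in>?S. diag_part x (\<rho>1 (q1 r), \<rho>2 (q2 r), \<rho>3 (q3 r))) \<in> cfun.span ?B"
      by (simp only: \<tau>_def)
  qed
qed

lemma kronecker_bound: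
  assumes \<alpha>: "partition_of N \<alpha>" and \<beta>: "partition_of N \<beta>" and \<gamma>: "partition_of N \<gamma>"
    and m: "\<And>i. i \<ge> m \<Longrightarrow> \<alpha> i = 0" "\<And>i. i \<ge> m \<Longrightarrow> \<beta> i = 0" "\<And>i. i \<ge> m \<Longrightarrow> \<gamma> i = 0"
  shows "kronecker N \<alpha> \<beta> \<gamma> \<le> card (outer_exponents m (N - \<gamma> 0))"
proof -
  have anti: "antimono \<alpha>" "antimono \<beta>" using \<alpha> \<beta> unfolding partition_of_def by blast+
  define M where "M F = (\<lambda>x. F (diag_part x))" for F :: "point \<Rightarrow> complex"
  have lin: "clinear M" by (rule clinearI) (simp_all add: M_def)
  have inj: "F = 0" if F: "F \<in> cfun.span (hw_polys N \<alpha> \<beta> \<gamma>)" and z: "M F = 0" for F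
  proof (rule ext)
    fix x
    have "F (diag_part y) = 0" for y using fun_cong[OF z, of y] by (simp add: M_def)
    then have "F x = 0" using hw_polys_eq_0[OF anti m(1,2) F] by blast
    then show "F x = 0 x" by simp
  qed
  have sub: "M F \<in> cfun.span (outer_monomial m \<alpha> ` outer_exponents m (N - \<gamma> 0))" if "F \<in> hw_polys N \<alpha> \<beta> \<gamma>" for F
    unfolding M_def by (rule hw_polys_diag_part[OF m that])
  have fin: "finite (outer_monomial m \<alpha> ` outer_exponents m (N - \<gamma> 0))"
    by (rule finite_imageI[OF finite_outer_exponents])
  have "cfun.dim (cfun.span (hw_polys N \<alpha> \<beta> \<gamma>)) \<le> card (outer_monomial m \<alpha> ` outer_exponents m (N - \<gamma> 0))"
    by (rule cfun_dim_span_le(2)[OF lin inj sub fin])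
  also have "\<dots> \<le> card (outer_exponents m (N - \<gamma> 0))"
    by (rule card_image_le[OF finite_outer_exponents])
  finally show ?thesis by (simp only: kronecker_eq_dim_hw_polys[OF \<alpha> \<beta> \<gamma>])
qed

theorem theorem1p1:
  fixes lam mu nu :: "nat \<Rightarrow> nat" and n k :: nat and G :: "nat \<Rightarrow> nat"
  assumes "partition_of n lam" and "partition_of n mu" and "partition_of n nu"
    and "k \<ge> 1"
    and "\<And>t. G t = kronecker (n + t * k)
           (lam + rect_partition t k) (mu + rect_partition t k) (nu + row_partition (t * k))"
  shows "bdd_above (range G) \<and> mono G"
proof
  note lam = assms(1) and mu = assms(2) and nu = assms(3) and k = assms(4) and G = assms(5)
  have p: "partition_of (n + t * k) (lam + rect_partition t k)" "partition_of (n + t * k) (mu + rect_partition t k)"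
    "partition_of (n + t * k) (nu + row_partition (t * k))" for t
    by (intro partition_of_add lam mu nu partition_of_rect partition_of_row)+
  show "mono G"
  proof (rule mono_iff_le_Suc[THEN iffD2], rule allI)
    fix t
    have "rect_partition t k + rect_partition 1 k = rect_partition (Suc t) k"
      and "row_partition (t * k) + row_partition k = row_partition (Suc t * k)"
      by (auto simp: rect_partition_def row_partition_def fun_eq_iff)
    moreover have "(n + t * k) + k = n + Suc t * k" by simp
    ultimately show "G t \<le> G (Suc t)"
      using kronecker_mono_step[OF p(1)[of t] p(2)[of t] p(3)[of t] k] by (simp only: G add.assoc)
  qed
  obtain m1 m2 m3 where m: "\<And>i. i \<ge> m1 \<Longrightarrow> lam i = 0" "\<And>i. i \<ge> m2 \<Longrightarrow> mu i = 0" "\<And>i. i \<ge> m3 \<Longrightarrow> nu i = 0"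
    using partition_of_prefix_sum(2)[OF lam] partition_of_prefix_sum(2)[OF mu] partition_of_prefix_sum(2)[OF nu]
    by metis
  \<comment> \<open>Bounds the lengths of all three partitions for every t: the rectangle has at
    most k rows, and k \<ge> 1 makes m positive, which accounts for the boxes added in row 0 of
    \<open>nu\<close>.\<close>
  define m where "m = max (max m1 m2) (max m3 k)"
  have "G t \<le> card (outer_exponents m (n - nu 0))" for t
  proof -
    have "G t \<le> card (outer_exponents m (n + t * k - (nu + row_partition (t * k)) 0))"
      unfolding G by (rule kronecker_bound[OF p])
        (use m k in \<open>auto simp: m_def rect_partition_def row_partition_def\<close>)
    \<comment> \<open>The t k boxes added to \<open>nu\<close> all lie in row 0, so the number of
      boxes outside that row does not depend on t.\<close>
    also have "n + t * k - (nu + row_partition (t * k)) 0 = n - nu 0"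
      by (simp add: row_partition_def)
    finally show ?thesis .
  qed
  then show "bdd_above (range G)" by (intro bdd_aboveI[of _ "card (outer_exponents m (n - nu 0))"]) auto
qed

end
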